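(* Let $R$ be an integral domain and $T$ a $t$-linked overring of $R$. If $R$ is $w$-stable, then $T$ is $w'$-stable, where $w'$ denotes the $w$-operation of the domain $T$.
   Context: $R$ is an integral domain with quotient field $K\neq R$. For nonzero $R$-submodules $A,B$ of $K$, $(A:B)=\{x\in K: xB\subseteq A\}$; $E(I)=(I:I)$. For a nonzero fractional ideal $I$, $I_v=(R:(R:I))$, $I_t=\bigcup\{J_v: J\subseteq I\text{ nonzero finitely generated}\}$; $t\text{-Max}(R)$ is the set of ideals maximal among proper $t$-ideals (ideals with $I=I_t$). For a nonzero $R$-submodule $E$ of $K$, $E_w=\bigcap_{M\in t\text{-Max}(R)}ER_M$; $I$ is a $w$-ideal if $I=I_w$. $R$ is $w$-stable if every $w$-ideal $I$ of $R$ satisfies $(I(E(I):I))_w=E(I)$. An overring $T$ ($R\subseteq T\subseteq K$) is $t$-linked over $R$ if $T_w=T$. The $w'$-operation of $T$ is defined in the same way using $T$ in place of $R$ (with $t\text{-Max}(T)$), and $T$ is $w'$-stable if every $w'$-ideal $I$ of $T$ satisfies $(I(E(I):I))_{w'}=E(I)$. *)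

theory Defs
  imports Main
begin

text \<open>Ambient field K is the type 'a (class field). A domain R is a subring of K
  whose quotient field is K; overrings are subrings T with R \<subseteq> T.
  All star operations are parametrised by the ring (R or T) they are taken over.\<close>

definition subring :: "'a::field set \<Rightarrow> bool" where
  "subring R \<longleftrightarrow> 0 \<in> R \<and> 1 \<in> R \<and> (\<forall>x\<in>R. \<forall>y\<in>R. x + y \<in> R \<and> x - y \<in> R \<and> x * y \<in> R)"

definition has_quotient_field_UNIV :: "'a::field set \<Rightarrow> bool" where
  "has_quotient_field_UNIV R \<longleftrightarrow> (\<forall>x. \<exists>a\<in>R. \<exists>b\<in>R. b \<noteq> 0 \<and> x = a / b)"

definition submodule :: "'a::field set \<Rightarrow> 'a set \<Rightarrow> bool" where
  "submodule R M \<longleftrightarrow> 0 \<in> M \<and> (\<forall>x\<in>M. \<forall>y\<in>M. x + y \<in> M) \<and> (\<forall>r\<in>R. \<forall>x\<in>M. r * x \<in> M)"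

definition nonzero_submodule :: "'a::field set \<Rightarrow> 'a set \<Rightarrow> bool" where
  "nonzero_submodule R M \<longleftrightarrow> submodule R M \<and> M \<noteq> {0}"

definition nonzero_ideal :: "'a::field set \<Rightarrow> 'a set \<Rightarrow> bool" where
  "nonzero_ideal R I \<longleftrightarrow> nonzero_submodule R I \<and> I \<subseteq> R"

definition colon :: "'a::field set \<Rightarrow> 'a set \<Rightarrow> 'a set" where
  "colon A B = {x. \<forall>b\<in>B. x * b \<in> A}"

definition Eend :: "'a::field set \<Rightarrow> 'a set" where
  "Eend I = colon I I"

definition setprod :: "'a::field set \<Rightarrow> 'a set \<Rightarrow> 'a set" where
  "setprod A B = {(\<Sum>i<n. a i * b i) | (n::nat) a b. \<forall>i<n. a i \<in> A \<and> b i \<in> B}"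

definition fgen :: "'a::field set \<Rightarrow> 'a set \<Rightarrow> 'a set" where
  "fgen R F = {(\<Sum>i<n. r i * f i) | (n::nat) r f. \<forall>i<n. r i \<in> R \<and> f i \<in> F}"

definition v_op :: "'a::field set \<Rightarrow> 'a set \<Rightarrow> 'a set" where
  "v_op R I = colon R (colon R I)"

definition t_op :: "'a::field set \<Rightarrow> 'a set \<Rightarrow> 'a set" where
  "t_op R I = \<Union>{v_op R J | J. \<exists>F. finite F \<and> J = fgen R F \<and> J \<noteq> {0} \<and> J \<subseteq> I}"

definition t_ideal :: "'a::field set \<Rightarrow> 'a set \<Rightarrow> bool" where
  "t_ideal R I \<longleftrightarrow> nonzero_ideal R I \<and> t_op R I = I"

definition tMax :: "'a::field set \<Rightarrow> 'a set set" where
  "tMax R = {M. t_ideal R M \<and> M \<noteq> R \<and>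
     (\<forall>N. t_ideal R N \<and> N \<noteq> R \<and> M \<subseteq> N \<longrightarrow> N = M)}"

definition loc :: "'a::field set \<Rightarrow> 'a set \<Rightarrow> 'a set" where
  "loc R M = {a / s | a s. a \<in> R \<and> s \<in> R \<and> s \<notin> M}"

definition w_op :: "'a::field set \<Rightarrow> 'a set \<Rightarrow> 'a set" where
  "w_op R E = \<Inter>{setprod E (loc R M) | M. M \<in> tMax R}"

definition w_ideal :: "'a::field set \<Rightarrow> 'a set \<Rightarrow> bool" where
  "w_ideal R I \<longleftrightarrow> nonzero_ideal R I \<and> w_op R I = I"

definition w_stable :: "'a::field set \<Rightarrow> bool" where
  "w_stable R \<longleftrightarrow> (\<forall>I. w_ideal R I \<longrightarrow>
      w_op R (setprod I (colon (Eend I) I)) = Eend I)"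

definition t_linked :: "'a::field set \<Rightarrow> 'a set \<Rightarrow> bool" where
  "t_linked R T \<longleftrightarrow> w_op R T = T"

end

theory Submission
  imports Defs
begin

text \<open>
  Call a domain stable if \<open>1 \<in> J L\<close> with \<open>L = (J : J\<^sup>2)\<close> for each of its fractional ideals \<open>J\<close>.
  Localizing a \<open>w\<close>-stable domain \<open>R\<close> at a maximal \<open>t\<close>-ideal \<open>M\<close> gives a stable local domain, and
  \<open>R\<close> has finite \<open>t\<close>-character. Let \<open>I\<close> be a \<open>w'\<close>-ideal of \<open>T\<close> and \<open>0 \<noteq> d \<in> I \<inter> R\<close>.
  Stability of \<open>R\<close> speaks only about fractional \<open>R\<close>-ideals, which \<open>I\<close> need not be. The local theory
  repairs this: for every \<open>M\<close> there is a fractional \<open>R\<^sub>M\<close>-ideal \<open>J\<^sub>M \<subseteq> I\<^sub>M\<close> with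
  \<open>I\<^sub>M = J\<^sub>M E(I\<^sub>M)\<close>. As \<open>d\<close> lies in only finitely many \<open>M\<close>, one denominator \<open>c\<close> serves
  all of them, and for \<open>J = I \<inter> c\<^sup>-\<^sup>1R\<close> the inclusion \<open>(J : J\<^sup>2) \<subseteq> (I : I\<^sup>2)\<close> can be checked at
  every \<open>M\<close>. Hence \<open>1 \<in> (J (J : J\<^sup>2))\<^sub>w \<subseteq> (I (E(I) : I))\<^sub>w\<close>, and \<open>t\<close>-linkedness makes the
  latter a subset of \<open>(I (E(I) : I))\<^sub>w\<^sub>'\<close>.

  For the local theory let \<open>R\<close> be local and stable, and let \<open>D\<close> be the set of elements of degree at most
  two over \<open>R\<close>. Stability of finitely generated modules shows that \<open>D\<close> is a ring, that every
  \<open>R\<close>-module between \<open>R\<close> and \<open>D\<close> is a ring, and that each ideal of an overring is generated by its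
  intersection with \<open>D\<close>. If \<open>D\<close> is not local, it is generated by two elements over \<open>R\<close>, since three
  maximal ideals would produce a module that is not stable. If \<open>D\<close> is local, it is a valuation ring, and
  either each of its \<open>R\<close>-submodules has an element of least value or \<open>D\<close> is a fractional ideal of
  \<open>R\<close>.
\<close>

subsection \<open>Products of subsets of a field\<close>

text \<open>In a local ring the closure drops out of stability, and \<open>1 \<in> J L\<close>
  becomes a relation with finitely many coefficients. Two facts give it force. An endomorphism of a
  module with two generators satisfies a monic quadratic equation, so \<open>E(J)\<close> is caught
  in \<open>D\<close>. And if \<open>1 \<in> J\<close>, then \<open>L\<close> is closed under
  multiplication, so norms of a relation with coefficients in \<open>L\<close> yield
  \<open>1 \<in> L\<close>, which says \<open>J J \<subseteq> J\<close>.

  Globally, the \<open>w\<close>-operation is handled through finite sets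
  \<open>F \<subseteq> R\<close> with \<open>(R : F) = R\<close>: an element lies in the closure of
  \<open>E\<close> iff such an \<open>F\<close> multiplies it into \<open>E\<close>.
  \<open>t\<close>-linkedness says that every such \<open>F\<close> also satisfies
  \<open>(T : F) = T\<close>, so the two operations are compared without relating the maximal
  \<open>t\<close>-ideals of \<open>R\<close> and \<open>T\<close>.

  Finite \<open>t\<close>-character is needed because each \<open>M\<close> brings its own
  denominator. Where \<open>d\<close> is not in \<open>M\<close>, it is a unit of the localization
  that already lies in \<open>J\<close>, and no denominator is spent.\<close>

lemma setprod_induct [consumes 1, case_names zero add prod]:
  assumes "z \<in> setprod A B" and "P 0" and "\<And>x y. P x \<Longrightarrow> P y \<Longrightarrow> P (x + y)"
    and "\<And>a b. a \<in> A \<Longrightarrow> b \<in> B \<Longrightarrow> P (a * b)"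
  shows "P z"
proof -
  obtain n a b where z: "z = (\<Sum>i<(n::nat). a i * b i)" and ab: "\<forall>i<n. a i \<in> A \<and> b i \<in> B"
    using assms(1) unfolding setprod_def by blast
  have "k \<le> n \<Longrightarrow> P (\<Sum>i<k. a i * b i)" for k
    by (induction k) (use assms(2-4) ab in auto)
  then show ?thesis using z by simp
qed

lemma setprod_zero [simp]: "0 \<in> setprod A B"
  unfolding setprod_def by (rule CollectI, rule exI[of _ 0]) auto

lemma setprod_add:
  assumes "x \<in> setprod A B" "y \<in> setprod A B"
  shows "x + y \<in> setprod A B"
proof -
  obtain n a b where x: "x = (\<Sum>i<(n::nat). a i * b i)" and ab: "\<forall>i<n. a i \<in> A \<and> b i \<in> B"
    using assms(1) unfolding setprod_def by blast
  obtain k c d where y: "y = (\<Sum>i<(k::nat). c i * d i)" and cd: "\<forall>i<k. c i \<in> A \<and> d i \<in> B"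
    using assms(2) unfolding setprod_def by blast
  define p where "p i = (if i < n then a i else c (i - n))" for i
  define q where "q i = (if i < n then b i else d (i - n))" for i
  have "(\<Sum>i<n + j. p i * q i) = (\<Sum>i<n. a i * b i) + (\<Sum>i<j. c i * d i)" for j
    by (induction j) (auto simp: p_def q_def add.assoc)
  then have "x + y = (\<Sum>i<n + k. p i * q i)"
    using x y by simp
  moreover have "\<forall>i<n + k. p i \<in> A \<and> q i \<in> B"
    using ab cd by (auto simp: p_def q_def)
  ultimately show ?thesis unfolding setprod_def by blast
qed

lemma setprod_prod: "a \<in> A \<Longrightarrow> b \<in> B \<Longrightarrow> a * b \<in> setprod A B"
  unfolding setprod_def
  by (rule CollectI, rule exI[of _ 1], rule exI[of _ "\<lambda>_. a"], rule exI[of _ "\<lambda>_. b"]) auto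

lemma setprod_mono:
  assumes "A \<subseteq> A'" "B \<subseteq> B'"
  shows "setprod A B \<subseteq> setprod A' B'"
proof
  fix z assume "z \<in> setprod A B"
  then show "z \<in> setprod A' B'"
    by (induction rule: setprod_induct) (use assms in \<open>auto intro: setprod_add setprod_prod\<close>)
qed

lemma setprod_scale:
  assumes "z \<in> setprod A B" "\<And>a. a \<in> A \<Longrightarrow> c * a \<in> A'"
  shows "c * z \<in> setprod A' B"
  using assms(1)
proof (induction rule: setprod_induct)
  case (prod a b)
  then show ?case using setprod_prod[OF assms(2)[OF prod(1)] prod(2)] by (simp add: mult.assoc)
qed (auto simp: distrib_left intro: setprod_add)

lemma mem_colon_Eend: "l \<in> colon (Eend J) J \<longleftrightarrow> (\<forall>x\<in>J. \<forall>y\<in>J. l * x * y \<in> J)"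
  by (auto simp: colon_def Eend_def)

definition fractional :: "'a::field set \<Rightarrow> 'a set \<Rightarrow> bool" where
  "fractional R J \<longleftrightarrow> nonzero_submodule R J \<and> (\<exists>d. d \<noteq> 0 \<and> (\<forall>x\<in>J. d * x \<in> R))"

text \<open>The product \<open>J (E(J) : J)\<close> is an \<open>E(J)\<close>-submodule of
  \<open>E(J)\<close>, so containing \<open>1\<close> means being all of \<open>E(J)\<close>:
  \<open>J\<close> is invertible over its endomorphism ring.\<close>

definition stable :: "'a::field set \<Rightarrow> bool" where
  "stable R \<longleftrightarrow> (\<forall>J. fractional R J \<longrightarrow> 1 \<in> setprod J (colon (Eend J) J))"

text \<open>Multiplying \<open>1 = l + l' x\<close> by its conjugate \<open>l + l' b - l' x\<close> expresses \<open>1\<close> through the norm.\<close>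
lemma one_mem_quadratic:
  fixes L R :: "'a::field set"
  assumes R: "subring R"
    and add: "\<And>x y. x \<in> L \<Longrightarrow> y \<in> L \<Longrightarrow> x + y \<in> L"
    and mult: "\<And>x y. x \<in> L \<Longrightarrow> y \<in> L \<Longrightarrow> x * y \<in> L"
    and smult: "\<And>r x. r \<in> R \<Longrightarrow> x \<in> L \<Longrightarrow> r * x \<in> L"
    and x: "x * x = a + b * x" "a \<in> R" "b \<in> R"
    and l: "l \<in> L" "l' \<in> L" "1 = l + l' * x"
  shows "1 \<in> L"
proof -
  have m: "- y \<in> L" if "y \<in> L" for y
  proof -
    have "0 - 1 \<in> R" using R by (metis subring_def)
    then show ?thesis using smult[of "-1" y] that by simp
  qed
  have "(l + l' * x) * (l + l' * b - l' * x) = l * l + b * (l * l') + - (l' * l' * (x * x)) + l' * l' * (b * x)"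
    by (simp add: algebra_simps)
  also have "\<dots> = l * l + b * (l * l') + - (a * (l' * l'))"
    by (simp only: x) (simp add: algebra_simps)
  finally have "l + l' * b - (1 - l) = l * l + b * (l * l') + - (a * (l' * l'))"
    using l(3) by (metis add_diff_cancel_left' mult_1)
  then have "1 = (l + l) + b * l' + - (l * l + b * (l * l') + - (a * (l' * l')))"
    by (simp add: algebra_simps)
  also have "\<dots> \<in> L"
    by (intro add m mult smult x l)
  finally show ?thesis .
qed

text \<open>\<open>L + L x\<close> inherits from \<open>L\<close> the closure properties that the
  quadratic case demands, so \<open>y\<close> is eliminated first, over \<open>L + L x\<close>, and
  \<open>x\<close> afterwards, over \<open>L\<close>.\<close>

lemma one_mem_biquadratic:
  fixes L R :: "'a::field set"
  assumes R: "subring R"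
    and add: "\<And>x y. x \<in> L \<Longrightarrow> y \<in> L \<Longrightarrow> x + y \<in> L"
    and mult: "\<And>x y. x \<in> L \<Longrightarrow> y \<in> L \<Longrightarrow> x * y \<in> L"
    and smult: "\<And>r x. r \<in> R \<Longrightarrow> x \<in> L \<Longrightarrow> r * x \<in> L"
    and x: "x * x = a + b * x" "a \<in> R" "b \<in> R"
    and y: "y * y = a' + b' * y" "a' \<in> R" "b' \<in> R"
    and l: "p \<in> L" "q \<in> L" "r \<in> L" "s \<in> L" "1 = (p + q * x) + (r + s * x) * y"
  shows "1 \<in> L"
proof -
  define L1 where "L1 = {p + q * x | p q. p \<in> L \<and> q \<in> L}"
  have "1 \<in> L1"
  proof (rule one_mem_quadratic[OF R _ _ _ y _ _ l(5)])
    show "p + q * x \<in> L1" "r + s * x \<in> L1" unfolding L1_def using l by blast+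
  next
    fix s t assume st: "s \<in> L1" "t \<in> L1"
    then obtain s1 s2 t1 t2 where h: "s1 \<in> L" "s2 \<in> L" "t1 \<in> L" "t2 \<in> L" "s = s1 + s2 * x" "t = t1 + t2 * x"
      unfolding L1_def by blast
    have "s + t = (s1 + t1) + (s2 + t2) * x" unfolding h by (simp add: algebra_simps)
    then show "s + t \<in> L1" unfolding L1_def
      by (intro CollectI exI conjI, assumption) (intro add h)+
    have "s * t = s1 * t1 + (s1 * t2 + s2 * t1) * x + s2 * t2 * (x * x)"
      unfolding h by (simp add: algebra_simps)
    also have "\<dots> = (s1 * t1 + a * (s2 * t2)) + (s1 * t2 + s2 * t1 + b * (s2 * t2)) * x"
      unfolding x by (simp add: algebra_simps)
    finally show "s * t \<in> L1" unfolding L1_def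
      by (intro CollectI exI conjI, assumption) (intro add mult smult h x)+
  next
    fix r s assume r: "r \<in> R" and "s \<in> L1"
    then obtain s1 s2 where h: "s1 \<in> L" "s2 \<in> L" "s = s1 + s2 * x"
      unfolding L1_def by blast
    then have "r * s = r * s1 + r * s2 * x" by (simp add: algebra_simps)
    then show "r * s \<in> L1" unfolding L1_def
      by (intro CollectI exI conjI, assumption) (intro smult h r)+
  qed
  then obtain p' q' where pq': "p' \<in> L" "q' \<in> L" "1 = p' + q' * x" unfolding L1_def by blast
  show "1 \<in> L" by (rule one_mem_quadratic[OF R add mult smult x pq'])
qed

subsection \<open>Local stable domains\<close>

locale local_stable =
  fixes R m :: "'a::field set"
  assumes subring_R: "subring R"
    and quot: "has_quotient_field_UNIV R"
    and stable_R: "stable R"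
    and m_sub: "m \<subseteq> R"
    and m_add: "x \<in> m \<Longrightarrow> y \<in> m \<Longrightarrow> x + y \<in> m"
    and m_mult: "r \<in> R \<Longrightarrow> x \<in> m \<Longrightarrow> r * x \<in> m"
    and m_unit: "x \<in> R \<Longrightarrow> x \<notin> m \<Longrightarrow> inverse x \<in> R"
    and one_m: "1 \<notin> m"
    and m_nz: "\<exists>x\<in>m. x \<noteq> 0"
begin

lemma R_simps: "0 \<in> R" "1 \<in> R" "x \<in> R \<Longrightarrow> y \<in> R \<Longrightarrow> x + y \<in> R"
  "x \<in> R \<Longrightarrow> y \<in> R \<Longrightarrow> x - y \<in> R" "x \<in> R \<Longrightarrow> y \<in> R \<Longrightarrow> x * y \<in> R"
  "x \<in> R \<Longrightarrow> - x \<in> R"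
proof -
  show *: "0 \<in> R" "1 \<in> R" "x \<in> R \<Longrightarrow> y \<in> R \<Longrightarrow> x + y \<in> R"
    "x \<in> R \<Longrightarrow> y \<in> R \<Longrightarrow> x - y \<in> R" "x \<in> R \<Longrightarrow> y \<in> R \<Longrightarrow> x * y \<in> R" for x y
    using subring_R unfolding subring_def by auto
  show "x \<in> R \<Longrightarrow> - x \<in> R" using *(4)[of 0 x] *(1) by simp
qed

lemma m_R: "x \<in> m \<Longrightarrow> x \<in> R" using m_sub by auto

lemma zero_m: "0 \<in> m" using m_nz m_mult[of 0] R_simps by auto

lemma m_minus: "x \<in> m \<Longrightarrow> - x \<in> m"
  using m_mult[of "-1" x] R_simps by auto

lemma m_diff: "x \<in> m \<Longrightarrow> y \<in> m \<Longrightarrow> x - y \<in> m"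
  using m_add[OF _ m_minus] by fastforce

lemma m_mult2: "r \<in> R \<Longrightarrow> x \<in> m \<Longrightarrow> x * r \<in> m"
  using m_mult by (simp add: mult.commute)

lemmas mR = R_simps m_R zero_m m_minus m_diff m_add m_mult m_mult2

lemma m_prime:
  assumes "x \<in> R" "y \<in> R" "x * y \<in> m"
  shows "x \<in> m \<or> y \<in> m"
proof (rule ccontr)
  assume c: "\<not> ?thesis"
  then have "inverse x \<in> R" "inverse y \<in> R" using assms m_unit by auto
  then have "(inverse x * inverse y) * (x * y) \<in> m" by (intro m_mult R_simps assms)
  moreover have "x \<noteq> 0" "y \<noteq> 0" using c zero_m by auto
  then have "(inverse x * inverse y) * (x * y) = 1" by (simp add: field_simps)
  ultimately show False using one_m by simp
qed

lemma unit_in_m: "x \<in> m \<Longrightarrow> x \<noteq> 0 \<Longrightarrow> inverse x \<notin> R"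
  using m_mult[of "inverse x" x] one_m by auto

section \<open>Elements of degree at most two\<close>

text \<open>Degree is meant in the integral sense: the quadratic polynomial is monic.\<close>

definition D :: "'a set" where
  "D = {x. \<exists>a\<in>R. \<exists>b\<in>R. x * x = a + b * x}"

lemma denom: "\<exists>d\<in>R. d \<noteq> 0 \<and> d * x \<in> R"
proof -
  obtain a b where "a \<in> R" "b \<in> R" "b \<noteq> 0" "x = a / b"
    using quot unfolding has_quotient_field_UNIV_def by blast
  then show ?thesis by (intro bexI[of _ b]) auto
qed

lemma denom3: "\<exists>d\<in>R. d \<noteq> 0 \<and> d * x \<in> R \<and> d * y \<in> R \<and> d * z \<in> R"
proof -
  obtain a b c where d: "a \<in> R" "b \<in> R" "c \<in> R" "a \<noteq> 0" "b \<noteq> 0" "c \<noteq> 0"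
     "a * x \<in> R" "b * y \<in> R" "c * z \<in> R" using denom by metis
  have "b * c * (a * x) \<in> R" "a * c * (b * y) \<in> R" "a * b * (c * z) \<in> R"
    using d by (auto intro!: R_simps)
  moreover have "a * b * c \<in> R" "a * b * c \<noteq> 0" using d by (auto intro!: R_simps)
  ultimately show ?thesis by (intro bexI[of _ "a * b * c"]) (auto simp: mult_ac)
qed

lemma stableD:
  assumes "submodule R J" "j \<in> J" "j \<noteq> 0" "d \<noteq> 0" "\<And>x. x \<in> J \<Longrightarrow> d * x \<in> R"
  shows "1 \<in> setprod J (colon (Eend J) J)"
proof -
  have "fractional R J"
    unfolding fractional_def nonzero_submodule_def using assms by auto
  then show ?thesis using stable_R unfolding stable_def by blast
qed

text \<open>From \<open>1 \<in> J\<close> one gets \<open>L J \<subseteq> J\<close> for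
  \<open>L = (J : J^2)\<close>, and \<open>L\<close> is closed under products since
  \<open>l' a b\<close> is again in \<open>J\<close>. It need not contain \<open>1\<close>; if it
  does, then \<open>J J \<subseteq> J\<close>.\<close>

lemma L_closed:
  assumes J: "submodule R J" "1 \<in> J"
  shows "x \<in> colon (Eend J) J \<Longrightarrow> y \<in> colon (Eend J) J \<Longrightarrow> x + y \<in> colon (Eend J) J"
    and "x \<in> colon (Eend J) J \<Longrightarrow> y \<in> colon (Eend J) J \<Longrightarrow> x * y \<in> colon (Eend J) J"
    and "r \<in> R \<Longrightarrow> x \<in> colon (Eend J) J \<Longrightarrow> r * x \<in> colon (Eend J) J"
    and "x \<in> colon (Eend J) J \<Longrightarrow> j \<in> J \<Longrightarrow> x * j \<in> J"
    and "x \<in> colon (Eend J) J \<Longrightarrow> x \<in> J"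
proof -
  have a: "x * j \<in> J" if "x \<in> colon (Eend J) J" "j \<in> J" for x j
    using that J(2) unfolding mem_colon_Eend by (metis mult.right_neutral)
  show "x \<in> colon (Eend J) J \<Longrightarrow> j \<in> J \<Longrightarrow> x * j \<in> J" by (rule a)
  show "x \<in> colon (Eend J) J \<Longrightarrow> x \<in> J" using a[OF _ J(2)] by simp
  show "x \<in> colon (Eend J) J \<Longrightarrow> y \<in> colon (Eend J) J \<Longrightarrow> x + y \<in> colon (Eend J) J"
    using J(1) unfolding mem_colon_Eend submodule_def by (auto simp: distrib_right)
  show "r \<in> R \<Longrightarrow> x \<in> colon (Eend J) J \<Longrightarrow> r * x \<in> colon (Eend J) J"
    using J(1) unfolding mem_colon_Eend submodule_def by (auto simp: mult.assoc)
  show "x \<in> colon (Eend J) J \<Longrightarrow> y \<in> colon (Eend J) J \<Longrightarrow> x * y \<in> colon (Eend J) J"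
    using a[of x] unfolding mem_colon_Eend[of y] mem_colon_Eend[of "x * y"] by (simp add: mult.assoc)
qed

text \<open>Stability writes \<open>1\<close> with coefficients from \<open>L = (J : J^2)\<close> on
  \<open>1, x, y, x y\<close>; norms move \<open>1\<close> into \<open>L\<close>. The span includes
  \<open>x y\<close> because \<open>D\<close> is not yet known to be closed under products.\<close>

lemma ring_between:
  assumes J: "submodule R J" "1 \<in> J" and x: "x \<in> D" and y: "y \<in> D"
    and sub: "\<And>z. z \<in> J \<Longrightarrow> \<exists>p\<in>R. \<exists>q\<in>R. \<exists>r\<in>R. \<exists>s\<in>R. z = (p + q * x) + (r + s * x) * y"
    and u: "u \<in> J" and v: "v \<in> J"
  shows "u * v \<in> J"
proof -
  define L where "L = colon (Eend J) J"
  have Lc: "\<And>x y. x \<in> L \<Longrightarrow> y \<in> L \<Longrightarrow> x + y \<in> L" "\<And>x y. x \<in> L \<Longrightarrow> y \<in> L \<Longrightarrow> x * y \<in> L"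
    "\<And>r x. r \<in> R \<Longrightarrow> x \<in> L \<Longrightarrow> r * x \<in> L"
    unfolding L_def using L_closed[OF J] by auto
  have L0: "0 \<in> L" using J(1) unfolding L_def mem_colon_Eend submodule_def by auto
  obtain a b where ab: "x * x = a + b * x" "a \<in> R" "b \<in> R" using x unfolding D_def by blast
  obtain a' b' where ab': "y * y = a' + b' * y" "a' \<in> R" "b' \<in> R" using y unfolding D_def by blast
  obtain d where d: "d \<in> R" "d \<noteq> 0" "d * x \<in> R" "d * y \<in> R" "d * (x * y) \<in> R"
    using denom3 by blast
  have "1 \<in> setprod J L" unfolding L_def
  proof (rule stableD[OF J, of d])
    show "d * z \<in> R" if zJ: "z \<in> J" for z
    proof -
      obtain p q r s where z: "p \<in> R" "q \<in> R" "r \<in> R" "s \<in> R" "z = (p + q * x) + (r + s * x) * y"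
        using sub[OF zJ] by blast
      have "d * z = p * d + q * (d * x) + r * (d * y) + s * (d * (x * y))"
        unfolding z by (simp add: algebra_simps)
      then show ?thesis using z d by (auto intro!: R_simps)
    qed
  qed (use d in auto)
  then have "\<exists>p\<in>L. \<exists>q\<in>L. \<exists>r\<in>L. \<exists>s\<in>L. 1 = (p + q * x) + (r + s * x) * y"
  proof (induction rule: setprod_induct)
    case zero
    show ?case by (intro bexI[of _ 0] L0) auto
  next
    case (add z w)
    then obtain p q r s p' q' r' s' where h: "p \<in> L" "q \<in> L" "r \<in> L" "s \<in> L" "p' \<in> L" "q' \<in> L" "r' \<in> L" "s' \<in> L"
      and zw: "z = (p + q * x) + (r + s * x) * y" "w = (p' + q' * x) + (r' + s' * x) * y"
      by (elim bexE) (rule that; assumption)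
    have "z + w = ((p + p') + (q + q') * x) + ((r + r') + (s + s') * x) * y"
      unfolding zw by (simp add: algebra_simps)
    then show ?case by (intro bexI, assumption) (intro Lc h)+
  next
    case (prod j l)
    obtain p q r s where z: "p \<in> R" "q \<in> R" "r \<in> R" "s \<in> R" "j = (p + q * x) + (r + s * x) * y"
      using sub[OF prod(1)] by blast
    have "j * l = (p * l + q * l * x) + (r * l + s * l * x) * y"
      unfolding z by (simp add: algebra_simps)
    then show ?case by (intro bexI, assumption) (intro Lc z prod)+
  qed
  then obtain p q r s where h: "p \<in> L" "q \<in> L" "r \<in> L" "s \<in> L" "1 = (p + q * x) + (r + s * x) * y"
    by blast
  have "1 \<in> L" by (rule one_mem_biquadratic[OF subring_R Lc ab ab' h])
  then show ?thesis using u v unfolding L_def mem_colon_Eend by auto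
qed

lemma D_I: "a \<in> R \<Longrightarrow> b \<in> R \<Longrightarrow> x * x = a + b * x \<Longrightarrow> x \<in> D"
  unfolding D_def by blast

lemma D_E:
  assumes "x \<in> D"
  obtains a b where "a \<in> R" "b \<in> R" "x * x = a + b * x"
  using assms unfolding D_def by blast

lemma R_D: "R \<subseteq> D"
  by (auto intro!: D_I[of 0] R_simps)

lemma submodule2: "submodule R {p + q * x | p q. p \<in> R \<and> q \<in> R}"
  unfolding submodule_def
proof (intro conjI ballI)
  show "0 \<in> {p + q * x | p q. p \<in> R \<and> q \<in> R}" using R_simps(1) by force
next
  fix s t assume "s \<in> {p + q * x | p q. p \<in> R \<and> q \<in> R}" "t \<in> {p + q * x | p q. p \<in> R \<and> q \<in> R}"
  then obtain p q p' q' where "p \<in> R" "q \<in> R" "p' \<in> R" "q' \<in> R" "s = p + q * x" "t = p' + q' * x" by blast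
  then show "s + t \<in> {p + q * x | p q. p \<in> R \<and> q \<in> R}"
    by (intro CollectI exI[of _ "p + p'"] exI[of _ "q + q'"]) (auto simp: algebra_simps R_simps)
next
  fix r s assume "r \<in> R" "s \<in> {p + q * x | p q. p \<in> R \<and> q \<in> R}"
  then obtain p q where "p \<in> R" "q \<in> R" "s = p + q * x" by blast
  then show "r * s \<in> {p + q * x | p q. p \<in> R \<and> q \<in> R}" using \<open>r \<in> R\<close>
    by (intro CollectI exI[of _ "r * p"] exI[of _ "r * q"]) (auto simp: algebra_simps R_simps)
qed

text \<open>\<open>R + R z\<close> lies in the span of \<open>1, x, y, x y\<close>, hence is closed
  under products, and \<open>z z \<in> R + R z\<close> is the equation that \<open>D\<close> asks
  for.\<close>

lemma D_quad:
  assumes "x \<in> D" "y \<in> D" "z = (p + q * x) + (r + s * x) * y" "p \<in> R" "q \<in> R" "r \<in> R" "s \<in> R"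
  shows "z \<in> D"
proof -
  let ?J = "{p + q * z | p q. p \<in> R \<and> q \<in> R}"
  have "z * z \<in> ?J"
  proof (rule ring_between[OF submodule2 _ assms(1,2)])
    show "1 \<in> ?J" "z \<in> ?J" "z \<in> ?J" using R_simps(1,2) by force+
    fix w assume "w \<in> ?J"
    then obtain a b where ab: "a \<in> R" "b \<in> R" "w = a + b * z" by blast
    have "w = ((a + b * p) + (b * q) * x) + (b * r + b * s * x) * y"
      unfolding ab assms(3) by (simp add: algebra_simps)
    then show "\<exists>p\<in>R. \<exists>q\<in>R. \<exists>r\<in>R. \<exists>s\<in>R. w = (p + q * x) + (r + s * x) * y"
      by (intro bexI) (auto intro!: R_simps ab assms)
  qed
  then show ?thesis using D_I by blast
qed

lemma D_add: "x \<in> D \<Longrightarrow> y \<in> D \<Longrightarrow> x + y \<in> D"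
  by (rule D_quad[of x y _ 0 1 1 0]) (auto intro: R_simps)
lemma D_diff: "x \<in> D \<Longrightarrow> y \<in> D \<Longrightarrow> x - y \<in> D"
  by (rule D_quad[of x y _ 0 1 "-1" 0]) (auto intro: R_simps)
lemma D_mult: "x \<in> D \<Longrightarrow> y \<in> D \<Longrightarrow> x * y \<in> D"
  by (rule D_quad[of x y _ 0 0 0 1]) (auto intro: R_simps)
lemma D_R: "x \<in> R \<Longrightarrow> x \<in> D" using R_D by auto
lemma D_minus: "x \<in> D \<Longrightarrow> - x \<in> D" using D_diff[of 0 x] D_R R_simps by auto

text \<open>\<open>ring_between\<close> for \<open>R + R x + R y\<close>. That the product needs no
  new generator is stronger than closure of \<open>D\<close>; it makes every module between
  \<open>R\<close> and \<open>D\<close> a ring.\<close>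

lemma D_prod_span:
  assumes "x \<in> D" "y \<in> D"
  obtains p q r where "p \<in> R" "q \<in> R" "r \<in> R" "x * y = p + q * x + r * y"
proof -
  let ?J = "{(p + q * x) + r * y | p q r. p \<in> R \<and> q \<in> R \<and> r \<in> R}"
  have "submodule R ?J" unfolding submodule_def
  proof (intro conjI ballI)
    have "0 = (0 + 0 * x) + 0 * y" by simp
    then show "0 \<in> ?J" using R_simps(1) by blast
  next
    fix s t assume "s \<in> ?J" "t \<in> ?J"
    then obtain p q r p' q' r' where h: "p \<in> R" "q \<in> R" "r \<in> R" "p' \<in> R" "q' \<in> R" "r' \<in> R" "s = p + q * x + r * y" "t = p' + q' * x + r' * y" by blast
    have "s + t = (p + p') + (q + q') * x + (r + r') * y" unfolding h by (simp add: algebra_simps)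
    then show "s + t \<in> ?J"
      by (intro CollectI exI conjI) (auto intro!: R_simps h)
  next
    fix a s assume "a \<in> R" "s \<in> ?J"
    then obtain p q r where h: "p \<in> R" "q \<in> R" "r \<in> R" "s = p + q * x + r * y" by blast
    have "a * s = a * p + (a * q) * x + (a * r) * y" unfolding h by (simp add: algebra_simps)
    then show "a * s \<in> ?J"
      by (intro CollectI exI conjI) (auto intro!: R_simps h \<open>a \<in> R\<close>)
  qed
  then have "x * y \<in> ?J"
  proof (rule ring_between[of _ x y])
    have "1 = (1 + 0 * x) + 0 * y" "x = (0 + 1 * x) + 0 * y" "y = (0 + 0 * x) + 1 * y" by auto
    then show "1 \<in> ?J" "x \<in> ?J" "y \<in> ?J" using R_simps(1,2) by blast+
    show "x \<in> D" "y \<in> D" by (fact assms)+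
    fix z assume "z \<in> ?J"
    then obtain p q r where "p \<in> R" "q \<in> R" "r \<in> R" "z = (p + q * x) + (r + 0 * x) * y" by auto
    then show "\<exists>p\<in>R. \<exists>q\<in>R. \<exists>r\<in>R. \<exists>s\<in>R. z = (p + q * x) + (r + s * x) * y"
      using R_simps(1) by blast
  qed
  then show ?thesis using that by blast
qed

lemma ring_in_D:
  assumes S: "submodule R S" "1 \<in> S" "S \<subseteq> D" and x: "x \<in> S" and y: "y \<in> S"
  shows "x * y \<in> S"
proof -
  obtain p q r where pqr: "p \<in> R" "q \<in> R" "r \<in> R" "x * y = p + q * x + r * y"
    using D_prod_span[OF subsetD[OF S(3) x] subsetD[OF S(3) y]] by blast
  have "p * 1 + q * x + r * y \<in> S" using pqr(1-3) S x y unfolding submodule_def by metis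
  then show ?thesis using pqr by simp
qed

lemma D_unit_R:
  assumes "x \<in> R" "inverse x \<in> D" shows "inverse x \<in> R"
proof (cases "x = 0")
  case False
  obtain a b where ab: "a \<in> R" "b \<in> R" "inverse x * inverse x = a + b * inverse x"
    using assms(2) by (rule D_E)
  then have "inverse x = a * x + b" using False by (simp add: field_simps)
  then show ?thesis using ab assms R_simps by auto
qed (use R_simps(1) in auto)

text \<open>Stability of \<open>J = R + R \<theta>\<close> for an arbitrary \<theta>. The
  coefficients \<open>u\<close>, \<open>v\<close> come from \<open>L = (J : J^2)\<close>, and
  \<open>L J \<subseteq> E(J) \<subseteq> D\<close>. They also lie in \<open>J\<close>, hence in
  every overring that contains \<theta>.\<close>

lemma theta_split:
  obtains u v where "u + v * \<theta> = 1" "u \<in> D" "u * \<theta> \<in> D" "v \<in> D" "v * \<theta> \<in> D"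
    "\<exists>p\<in>R. \<exists>q\<in>R. u = p + q * \<theta>" "\<exists>p\<in>R. \<exists>q\<in>R. v = p + q * \<theta>"
proof -
  define J where "J = {p + q * \<theta> | p q. p \<in> R \<and> q \<in> R}"
  define L where "L = colon (Eend J) J"
  have J: "submodule R J" "1 \<in> J" "\<theta> \<in> J" unfolding J_def using submodule2 R_simps(1,2) by force+
  note Lc = L_closed[OF J(1,2), folded L_def]
  have E: "e \<in> D" if e: "\<And>j. j \<in> J \<Longrightarrow> e * j \<in> J" for e
  proof -
    obtain a b where ab: "a \<in> R" "b \<in> R" "e = a + b * \<theta>" using e[OF J(2)] unfolding J_def by auto
    obtain c d where cd: "c \<in> R" "d \<in> R" "e * \<theta> = c + d * \<theta>" using e[OF J(3)] unfolding J_def by auto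
    \<comment> \<open>Characteristic polynomial of the matrix by which \<open>e\<close> acts on the
      generators \<open>1\<close> and \<theta>.\<close>
    have "(e - a) * (e - d) = b * (e * \<theta> - d * \<theta>)" using ab(3) by (simp add: algebra_simps)
    also have "\<dots> = b * c" using cd by simp
    finally have "e * e = (b * c - a * d) + (a + d) * e" by (simp add: algebra_simps)
    then show ?thesis
      by (rule D_I[rotated 2]) (intro R_simps ab cd)+
  qed
  obtain d where d: "d \<in> R" "d \<noteq> 0" "d * \<theta> \<in> R" using denom by blast
  have "1 \<in> setprod J L" unfolding L_def
  proof (rule stableD[OF J(1,2), of d])
    show "d * z \<in> R" if zJ: "z \<in> J" for z
    proof -
      obtain p q where z: "p \<in> R" "q \<in> R" "z = p + q * \<theta>" using zJ unfolding J_def by blast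
      have "d * z = d * p + q * (d * \<theta>)" unfolding z by (simp add: algebra_simps)
      then show ?thesis using z d R_simps by auto
    qed
  qed (use d in auto)
  then have "\<exists>u\<in>L. \<exists>v\<in>L. u + v * \<theta> = 1"
  proof (induction rule: setprod_induct)
    case zero
    have "0 \<in> L" using J(1) unfolding L_def mem_colon_Eend submodule_def by auto
    then show ?case by (intro bexI[of _ 0]) auto
  next
    case (add x y)
    then obtain u v u' v' where "u \<in> L" "v \<in> L" "u' \<in> L" "v' \<in> L" "u + v * \<theta> = x" "u' + v' * \<theta> = y" by blast
    then have "(u + u') + (v + v') * \<theta> = x + y" "u + u' \<in> L" "v + v' \<in> L"
      using Lc(1) by (auto simp: algebra_simps)
    then show ?case by blast
  next
    case (prod j l)
    then obtain p q where "p \<in> R" "q \<in> R" "j = p + q * \<theta>" unfolding J_def by blast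
    then have "p * l + q * l * \<theta> = j * l" "p * l \<in> L" "q * l \<in> L"
      using Lc(3) prod by (auto simp: distrib_right mult_ac(1) mult.commute[of l \<theta>])
    then show ?case by blast
  qed
  then obtain u v where uv: "u \<in> L" "v \<in> L" "u + v * \<theta> = 1" by blast
  have 1: "w \<in> D" "w * \<theta> \<in> D" if "w \<in> L" for w
    using that Lc(4) J by (auto intro!: E simp: L_def mem_colon_Eend)
  have 2: "\<exists>p\<in>R. \<exists>q\<in>R. w = p + q * \<theta>" if "w \<in> L" for w
    using Lc(5)[OF that] unfolding J_def by blast
  show ?thesis by (rule that[of u v]) (fact uv(3) | rule 1 2 uv)+
qed

section \<open>The case of a non-local ring \<open>D\<close>\<close>

lemma L_lin:
  assumes "submodule R J"
  shows "x \<in> colon (Eend J) J \<Longrightarrow> y \<in> colon (Eend J) J \<Longrightarrow> x + y \<in> colon (Eend J) J"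
    and "r \<in> R \<Longrightarrow> x \<in> colon (Eend J) J \<Longrightarrow> r * x \<in> colon (Eend J) J"
    and "0 \<in> colon (Eend J) J"
  using assms unfolding mem_colon_Eend submodule_def by (auto simp: distrib_right mult.assoc)

text \<open>Modulo the three ideals, \<open>X = (1, 1, 0)\<close> and \<open>Y = (0, 1, 1)\<close>. An endomorphism of \<open>RX + RY\<close> is
  congruent to the same scalar modulo all three, so it is a non-unit as soon as it lies in one of them.\<close>
lemma no_three_ideals:
  assumes A: "R \<subseteq> A" "\<And>x y. x \<in> A \<Longrightarrow> y \<in> A \<Longrightarrow> x + y \<in> A" "\<And>x y. x \<in> A \<Longrightarrow> y \<in> A \<Longrightarrow> x * y \<in> A"
    and id: "\<And>n. n \<in> {n1, n2, n3} \<Longrightarrow> m \<subseteq> n \<and> 1 \<notin> n \<and> (\<forall>x\<in>n. \<forall>y\<in>n. x + y \<in> n) \<and> (\<forall>a\<in>A. \<forall>x\<in>n. a * x \<in> n)"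
    and XY: "X \<in> A" "Y \<in> A" "Z \<in> A" "Y + X * Z = 1"
    and X: "X - 1 \<in> n1" "X - 1 \<in> n2" "X \<in> n3"
    and Y: "Y \<in> n1" "Y - 1 \<in> n2" "Y - 1 \<in> n3"
  shows False
proof -
  have RA: "r \<in> R \<Longrightarrow> r \<in> A" for r using A by auto
  have A_diff: "x - y \<in> A" if "x \<in> A" "y \<in> A" for x y
  proof -
    have "x + (- 1) * y \<in> A" by (intro A that RA R_simps)
    then show ?thesis by simp
  qed
  have nm: "m \<subseteq> n1" "m \<subseteq> n2" "m \<subseteq> n3" using id by auto
  have n_add: "x + y \<in> n" if "n \<in> {n1, n2, n3}" "x \<in> n" "y \<in> n" for n x y
    using id[OF that(1)] that by blast
  have n_mult: "a * x \<in> n" if "n \<in> {n1, n2, n3}" "a \<in> A" "x \<in> n" for n x a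
    using id[OF that(1)] that by blast
  have n_diff: "x - y \<in> n" if "n \<in> {n1, n2, n3}" "x \<in> n" "y \<in> n" for n x y
  proof -
    have "x + (- 1) * y \<in> n" by (intro n_add n_mult that RA R_simps)
    then show ?thesis by simp
  qed
  have n_R: "r \<in> m" if "n \<in> {n1, n2, n3}" "r \<in> R" "r \<in> n" for n r
  proof (rule ccontr)
    assume "r \<notin> m"
    then have "inverse r \<in> A" "r \<noteq> 0" using m_unit that zero_m RA by auto
    then show False using n_mult[OF that(1), of "inverse r" r] that id[OF that(1)] by auto
  qed
  define J where "J = {p * X + q * Y | p q. p \<in> R \<and> q \<in> R}"
  define L where "L = colon (Eend J) J"
  have J: "submodule R J" unfolding submodule_def
  proof (intro conjI ballI)
    have "0 = 0 * X + 0 * Y" by simp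
    then show "0 \<in> J" unfolding J_def using R_simps(1) by blast
  next
    fix s t assume "s \<in> J" "t \<in> J"
    then obtain p q p' q' where h: "p \<in> R" "q \<in> R" "p' \<in> R" "q' \<in> R" "s = p * X + q * Y" "t = p' * X + q' * Y"
      unfolding J_def by blast
    have "s + t = (p + p') * X + (q + q') * Y" unfolding h by (simp add: algebra_simps)
    then show "s + t \<in> J" unfolding J_def
      by (intro CollectI exI conjI, assumption) (intro R_simps h)+
  next
    fix r s assume r: "r \<in> R" and "s \<in> J"
    then obtain p q where h: "p \<in> R" "q \<in> R" "s = p * X + q * Y"
      unfolding J_def by blast
    have "r * s = (r * p) * X + (r * q) * Y" unfolding h by (simp add: algebra_simps)
    then show "r * s \<in> J" unfolding J_def
      by (intro CollectI exI conjI, assumption) (intro R_simps h r)+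
  qed
  have XJ: "X \<in> J" and YJ: "Y \<in> J"
  proof -
    have "X = 1 * X + 0 * Y" "Y = 0 * X + 1 * Y" by auto
    then show "X \<in> J" "Y \<in> J" unfolding J_def using R_simps(1,2) by blast+
  qed
  have JA: "J \<subseteq> A"
  proof
    fix s assume "s \<in> J"
    then obtain p q where h: "p \<in> R" "q \<in> R" "s = p * X + q * Y" unfolding J_def by blast
    show "s \<in> A" unfolding h(3) by (intro A XY RA h)
  qed
  \<comment> \<open>\<open>X\<close> and \<open>Y\<close> generate the unit ideal of
    \<open>A\<close>; the witness \<open>Z\<close> recovers \<open>e\<close> from \<open>e X\<close>
    and \<open>e Y\<close>.\<close>
  have EA: "e \<in> A" if "e * X \<in> J" "e * Y \<in> J" for e
  proof -
    have "e = e * Y + (e * X) * Z" using XY(4) by (metis distrib_left mult.assoc mult.right_neutral)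
    moreover have "e * Y \<in> A" "e * X \<in> A" using that JA by auto
    ultimately show ?thesis using A XY by metis
  qed
  \<comment> \<open>\<open>X\<close> vanishes at \<open>n3\<close> and \<open>Y\<close> at
    \<open>n1\<close>, which puts the off-diagonal entries \<open>q\<close> and \<open>p'\<close>
    into \<open>m\<close>. At \<open>n2\<close> both are \<open>1\<close>, so the diagonal entries
    \<open>p\<close> and \<open>q'\<close> agree modulo \<open>m\<close>.\<close>
  have key: "\<exists>p\<in>R. e - p \<in> n1 \<and> e - p \<in> n2 \<and> e - p \<in> n3" if eJ: "e * X \<in> J" "e * Y \<in> J" for e
  proof -
    have e: "e \<in> A" using EA eJ by blast
    obtain p q where pq: "p \<in> R" "q \<in> R" "e * X = p * X + q * Y" using eJ unfolding J_def by blast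
    obtain p' q' where pq': "p' \<in> R" "q' \<in> R" "e * Y = p' * X + q' * Y" using eJ unfolding J_def by blast
    note I = n_add n_diff n_mult A A_diff RA pq(1,2) pq'(1,2) e XY(1,2) X Y
    have q: "q \<in> m"
    proof (rule n_R[of n3])
      have "q = (e - p) * X - q * (Y - 1)" using pq by (simp add: algebra_simps)
      also have "\<dots> \<in> n3" by (intro I) auto
      finally show "q \<in> n3" .
    qed (use pq in auto)
    have p': "p' \<in> m"
    proof (rule n_R[of n1])
      have "p' = (e - q') * Y - p' * (X - 1)" using pq' by (simp add: algebra_simps)
      also have "\<dots> \<in> n1" by (intro I) auto
      finally show "p' \<in> n1" .
    qed (use pq' in auto)
    have p1: "e - p = q * Y - (e - p) * (X - 1)" using pq by (simp add: algebra_simps)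
    also have "\<dots> \<in> n1" by (intro I) auto
    finally have e1: "e - p \<in> n1" .
    have q1: "e - q' = p' * X - (e - q') * (Y - 1)" using pq' by (simp add: algebra_simps)
    also have "\<dots> \<in> n3" by (intro I) auto
    finally have e3: "e - q' \<in> n3" .
    have qn: "q \<in> n2" "p' \<in> n2" using q p' nm by auto
    have "Y * q - (e - p) * (X - 1) \<in> n2" by (intro I qn) auto
    then have e2: "e - p \<in> n2" using p1 by (simp add: mult.commute)
    have "X * p' - (e - q') * (Y - 1) \<in> n2" by (intro I qn) auto
    then have e2': "e - q' \<in> n2" using q1 by (simp add: mult.commute)
    have "(e - q') - (e - p) \<in> n2" by (intro n_diff e2 e2') auto
    then have "p - q' \<in> m" using n_R[of n2 "p - q'"] R_simps(4)[OF pq(1) pq'(2)] by auto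
    then have pq3: "p - q' \<in> n3" using nm by auto
    have "(e - q') - (p - q') \<in> n3" by (rule n_diff[OF _ e3 pq3]) simp
    then have "e - p \<in> n3" by simp
    then show ?thesis using e1 e2 pq by auto
  qed
  obtain d where d: "d \<in> R" "d \<noteq> 0" "d * X \<in> R" "d * Y \<in> R" using denom3 by blast
  have nz: "\<exists>j\<in>J. j \<noteq> 0" using XJ YJ XY(4) by (metis add_0 mult_zero_left zero_neq_one)
  then obtain j where j: "j \<in> J" "j \<noteq> 0" by blast
  have "1 \<in> setprod J L" unfolding L_def
  proof (rule stableD[OF J j d(2)])
    fix x assume "x \<in> J"
    then obtain p q where h: "p \<in> R" "q \<in> R" "x = p * X + q * Y"
      unfolding J_def by blast
    have "d * x = p * (d * X) + q * (d * Y)" unfolding h by (simp add: algebra_simps)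
    then show "d * x \<in> R" using h d by (simp add: R_simps)
  qed
  then have "\<exists>l\<in>L. \<exists>l'\<in>L. l * X + l' * Y = 1"
  proof (induction rule: setprod_induct)
    case zero
    then show ?case using L_lin(3)[OF J, folded L_def] by (intro bexI[of _ 0]) auto
  next
    case (add x y)
    then obtain l l' k k' where h: "l \<in> L" "l' \<in> L" "k \<in> L" "k' \<in> L" "l * X + l' * Y = x" "k * X + k' * Y = y" by blast
    then have "(l + k) * X + (l' + k') * Y = x + y" by (auto simp: algebra_simps)
    then show ?case by (intro bexI, assumption) (intro L_lin(1)[OF J, folded L_def] h)+
  next
    case (prod j l)
    then obtain p q where h: "p \<in> R" "q \<in> R" "j = p * X + q * Y"
      unfolding J_def by blast
    then have "(p * l) * X + (q * l) * Y = j * l" by (auto simp: algebra_simps)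
    then show ?case by (intro bexI, assumption) (intro L_lin(2)[OF J, folded L_def] h prod)+
  qed
  then obtain l l' where l: "l \<in> L" "l' \<in> L" "l * X + l' * Y = 1" by blast
  have LE: "k * x * X \<in> J" "k * x * Y \<in> J" if "k \<in> L" "x \<in> J" for k x
    using that XJ YJ unfolding L_def mem_colon_Eend by auto
  have LA: "k \<in> A" if "k \<in> L" for k
  proof -
    have "k * X \<in> A" "k * Y \<in> A" using LE[OF that] EA XJ YJ by auto
    moreover have "k = k * Y + (k * X) * Z" using XY(4) by (metis distrib_left mult.assoc mult.right_neutral)
    ultimately show ?thesis using A XY by metis
  qed
  \<comment> \<open>\<open>l X\<close> vanishes at \<open>n3\<close>, so its scalar is zero modulo
    \<open>m\<close> and it vanishes at \<open>n2\<close> too; \<open>l' Y\<close> is carried over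
    from \<open>n1\<close> in the same way.\<close>
  have "l * X \<in> n2"
  proof -
    obtain p where p: "p \<in> R" "l * X - p \<in> n2" "l * X - p \<in> n3" using key LE l XJ by blast
    have "l * X - (l * X - p) \<in> n3" by (intro n_diff n_mult p LA l X) auto
    then have "p \<in> m" using n_R[of n3 p] p by auto
    then have "(l * X - p) + p \<in> n2" using nm by (intro n_add p) auto
    then show ?thesis by simp
  qed
  moreover have "l' * Y \<in> n2"
  proof -
    obtain p where p: "p \<in> R" "l' * Y - p \<in> n2" "l' * Y - p \<in> n1" using key LE l YJ by blast
    have "l' * Y - (l' * Y - p) \<in> n1" by (intro n_diff n_mult p LA l Y) auto
    then have "p \<in> m" using n_R[of n1 p] p by auto
    then have "(l' * Y - p) + p \<in> n2" using nm by (intro n_add p) auto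
    then show ?thesis by simp
  qed
  ultimately have "l * X + l' * Y \<in> n2" by (intro n_add) auto
  then show False using l(3) id[of n2] by simp
qed

text \<open>The expression is the norm of \<open>p + z\<close>, its product with the conjugate
  \<open>p + b - z\<close>; were it a unit, the conjugate divided by it would invert
  \<open>p + z\<close> in \<open>D\<close>.\<close>

lemma norm_nonunit:
  assumes z: "z * z = a + b * z" "a \<in> R" "b \<in> R" and p: "p \<in> R" and n: "inverse (p + z) \<notin> D"
  shows "p * p + p * b - a \<in> m"
proof (rule ccontr)
  assume u: "p * p + p * b - a \<notin> m"
  have N: "(p + z) * (p + b - z) = p * p + p * b - a"
    using z(1) by (simp add: algebra_simps)
  have "inverse (p * p + p * b - a) \<in> R" using u by (intro m_unit R_simps z p)
  moreover have "p + b - z \<in> D" by (intro D_diff D_add D_R p z D_I[OF z(2,3,1)])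
  ultimately have "(p + b - z) * inverse (p * p + p * b - a) \<in> D" using D_mult D_R by blast
  moreover have "p * p + p * b - a \<noteq> 0" using u zero_m by auto
  then have "inverse (p + z) = (p + b - z) * inverse (p * p + p * b - a)"
    using N by (metis inverse_unique mult.assoc right_inverse)
  ultimately show False using n by simp
qed

text \<open>Independence of \<open>1\<close>, \<eta>, \<open>x\<close> modulo \<open>m\<close>: it
  licenses the comparison of coefficients in the computations below.\<close>

lemma span_indep:
  assumes \<eta>: "\<eta> \<in> D" "inverse \<eta> \<notin> D" "inverse (1 - \<eta>) \<notin> D"
    and x: "x \<in> D" "\<not> (\<exists>p\<in>R. \<exists>q\<in>R. x = p + q * \<eta>)"
    and pqr: "p \<in> R" "q \<in> R" "r \<in> R" "p + q * \<eta> + r * x = 0"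
  shows "p \<in> m" "q \<in> m" "r \<in> m"
proof -
  obtain e f where ef: "e \<in> R" "f \<in> R" "x * x = e + f * x" using x(1) by (rule D_E)
  obtain a b where ab: "a \<in> R" "b \<in> R" "\<eta> * \<eta> = a + b * \<eta>" using \<eta>(1) by (rule D_E)
  show r: "r \<in> m"
  proof (rule ccontr)
    assume r: "r \<notin> m"
    then have "r \<noteq> 0" using zero_m by auto
    have "r * x = - (p + q * \<eta>)" using pqr(4) by (metis add.commute add_eq_0_iff)
    then have "x = (- (inverse r * p)) + (- (inverse r * q)) * \<eta>"
      using \<open>r \<noteq> 0\<close> by (simp add: field_simps)
    moreover have "inverse r \<in> R" using r pqr m_unit by auto
    ultimately show False using x(2) pqr R_simps(6)[OF R_simps(5)] by blast
  qed
  \<comment> \<open>Otherwise \<eta> = \<rho> + \<mu> x with \<mu> \<in> m. Modulo \<open>m\<close>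
    the norms of \<eta> and 1 - \<eta> are then the squares of \<rho> and 1 - \<rho>, and both would
    vanish.\<close>
  show q: "q \<in> m"
  proof (rule ccontr)
    assume q: "q \<notin> m"
    then have q0: "q \<noteq> 0" using zero_m by auto
    have qi: "inverse q \<in> R" using q pqr m_unit by auto
    define \<rho> where "\<rho> = - (inverse q * p)"
    define \<mu> where "\<mu> = - (inverse q * r)"
    have \<rho>: "\<rho> \<in> R" unfolding \<rho>_def using qi pqr R_simps by auto
    have \<mu>: "\<mu> \<in> m" unfolding \<mu>_def using qi r mR by auto
    have "q * \<eta> = - (p + r * x)" using pqr(4) by (metis add.commute add.left_commute add_eq_0_iff)
    then have \<eta>e: "\<eta> = \<rho> + \<mu> * x" unfolding \<rho>_def \<mu>_def using q0 by (simp add: field_simps)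
    have z: "(\<mu> * x) * (\<mu> * x) = (\<mu> * \<mu> * e) + (\<mu> * f) * (\<mu> * x)"
    proof -
      have "(\<mu> * x) * (\<mu> * x) = \<mu> * \<mu> * (x * x)" by (simp add: mult_ac)
      then show ?thesis unfolding ef by (simp add: algebra_simps)
    qed
    have \<mu>f: "\<mu> * f \<in> m" "\<mu> * \<mu> * e \<in> m"
      using m_mult2[OF ef(2) \<mu>] m_mult2[OF ef(1) m_mult[OF m_R[OF \<mu>] \<mu>]] by auto
    have "\<rho> * \<rho> + \<rho> * (\<mu> * f) - \<mu> * \<mu> * e \<in> m"
      by (rule norm_nonunit[OF z]) (use \<eta>(2) \<eta>e in \<open>auto intro!: \<rho> m_R[OF \<mu>f(1)] m_R[OF \<mu>f(2)]\<close>)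
    moreover have "\<rho> * (\<mu> * f) - \<mu> * \<mu> * e \<in> m"
      by (intro m_diff m_mult[OF \<rho>] \<mu>f)
    ultimately have "(\<rho> * \<rho> + \<rho> * (\<mu> * f) - \<mu> * \<mu> * e) - (\<rho> * (\<mu> * f) - \<mu> * \<mu> * e) \<in> m"
      by (rule m_diff)
    then have "\<rho> * \<rho> \<in> m" by simp
    then have 1: "\<rho> \<in> m" using m_prime \<rho> by blast
    have z': "(- \<mu> * x) * (- \<mu> * x) = (\<mu> * \<mu> * e) + (- (\<mu> * f)) * (- \<mu> * x)"
      using z by simp
    have "(1 - \<rho>) * (1 - \<rho>) + (1 - \<rho>) * (- (\<mu> * f)) - \<mu> * \<mu> * e \<in> m"
    proof (rule norm_nonunit[OF z'])
      have eq: "1 - \<eta> = 1 - \<rho> + - \<mu> * x" by (simp add: \<eta>e)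
      show "inverse (1 - \<rho> + - \<mu> * x) \<notin> D" using \<eta>(3) unfolding eq .
    qed (auto intro!: R_simps \<rho> m_R[OF \<mu>f(1)] m_R[OF \<mu>f(2)])
    moreover have "(1 - \<rho>) * (- (\<mu> * f)) - \<mu> * \<mu> * e \<in> m"
      by (intro m_diff m_mult m_minus \<mu>f R_simps \<rho>)
    ultimately have "((1 - \<rho>) * (1 - \<rho>) + (1 - \<rho>) * (- (\<mu> * f)) - \<mu> * \<mu> * e) - ((1 - \<rho>) * (- (\<mu> * f)) - \<mu> * \<mu> * e) \<in> m"
      by (rule m_diff)
    then have "(1 - \<rho>) * (1 - \<rho>) \<in> m" by simp
    then have "1 - \<rho> \<in> m" using m_prime R_simps(4)[OF R_simps(2) \<rho>] by blast
    then have "(1 - \<rho>) + \<rho> \<in> m" using 1 m_add by blast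
    then show False using one_m by simp
  qed
  \<comment> \<open>Dividing by \<open>p\<close> would write \<open>1\<close> with coefficients from
    \<open>m\<close> on \<eta> and \<open>x\<close>; the norm argument with \<open>m\<close> in the
    role of \<open>L\<close> gives \<open>1 \<in> m\<close>.\<close>
  show "p \<in> m"
  proof (rule ccontr)
    assume p: "p \<notin> m"
    then have p0: "p \<noteq> 0" using zero_m by auto
    have pi: "inverse p \<in> R" using p pqr m_unit by auto
    have "p = - (q * \<eta> + r * x)" using pqr(4) by (metis add.assoc add_eq_0_iff2)
    then have "1 = - (inverse p) * (q * \<eta> + r * x)"
      using p0 by (metis left_inverse mult_minus_left mult_minus_right)
    then have 1: "1 = (0 + - (inverse p * q) * \<eta>) + (- (inverse p * r) + 0 * \<eta>) * x"
      by (simp add: algebra_simps)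
    have "1 \<in> m"
      by (rule one_mem_biquadratic[OF subring_R m_add _ m_mult ab(3,1,2) ef(3,1,2) _ _ _ _ 1])
        (use q r pi mR in auto)
    then show False using one_m by simp
  qed
qed

text \<open>Modulo \<open>m\<close> the elements \<open>\<eta>\<close>, \<open>x\<close> and \<open>1 - \<eta> - x\<close> turn out to be orthogonal idempotents.\<close>
lemma nonlocal_orthogonal_False:
  assumes \<eta>: "\<eta> \<in> D" "inverse \<eta> \<notin> D" "inverse (1 - \<eta>) \<notin> D"
    and x: "x \<in> D" "\<not> (\<exists>p\<in>R. \<exists>q\<in>R. x = p + q * \<eta>)"
    and ac: "a \<in> R" "c \<in> m" "\<eta> * x = a + c * x"
  shows False
proof -
  note indep = span_indep[OF \<eta> x]
  have cR: "c \<in> R" using ac m_R by auto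
  obtain e f where ef: "e \<in> R" "f \<in> R" "x * x = e + f * x" using x(1) by (rule D_E)
  obtain a0 b0 where ab: "a0 \<in> R" "b0 \<in> R" "\<eta> * \<eta> = a0 + b0 * \<eta>" using \<eta>(1) by (rule D_E)
  have "0 * 0 + 0 * b0 - a0 \<in> m"
    by (rule norm_nonunit[OF ab(3,1,2)]) (use \<eta>(2) R_simps(1) in auto)
  then have a0: "a0 \<in> m" using m_minus[of "- a0"] by simp
  have n\<eta>: "(- \<eta>) * (- \<eta>) = a0 + (- b0) * (- \<eta>)" using ab by simp
  have "1 * 1 + 1 * (- b0) - a0 \<in> m"
    by (rule norm_nonunit[OF n\<eta> ab(1)]) (use \<eta>(3) in \<open>auto intro!: R_simps ab\<close>)
  then have "(1 * 1 + 1 * (- b0) - a0) + a0 \<in> m" using a0 by (rule m_add)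
  then have b0: "1 - b0 \<in> m" by simp
  \<comment> \<open>Coefficient of \<eta> in the two evaluations of \<eta> \<eta> x.\<close>
  have am: "a \<in> m"
  proof (rule indep(2))
    have "\<eta> * (\<eta> * x) = \<eta> * \<eta> * x" by (simp add: mult_ac)
    then have "\<eta> * (a + c * x) = (a0 + b0 * \<eta>) * x" unfolding ac(3) ab(3) .
    then have "a * \<eta> + c * (\<eta> * x) = a0 * x + b0 * (\<eta> * x)" by (simp add: algebra_simps)
    then show "(c * a - b0 * a) + a * \<eta> + (c * c - a0 - b0 * c) * x = 0"
      unfolding ac(3) by (simp add: algebra_simps)
  qed (intro R_simps ac cR ab)+
  have em: "e \<in> m"
  proof (rule indep(2))
    have "x * (\<eta> * x) = \<eta> * (x * x)" by (simp add: mult_ac)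
    then have "x * (a + c * x) = \<eta> * (e + f * x)" unfolding ac(3) ef(3) .
    then have "a * x + c * (x * x) = e * \<eta> + f * (\<eta> * x)" by (simp add: algebra_simps)
    then show "(f * a - c * e) + e * \<eta> + (f * c - a - c * f) * x = 0"
      unfolding ac(3) ef(3) by (simp add: algebra_simps)
  qed (intro R_simps ac cR ab ef)+
  \<comment> \<open>The equation of \<open>x + \<eta>\<close> has a single trace \<sigma>; the
    coefficients of \<eta> and of \<open>x\<close> show that \<sigma> is congruent to
    \<open>b0\<close>, hence to \<open>1\<close>, and also to \<open>f\<close>.\<close>
  have fm: "1 - f \<in> m"
  proof -
    obtain \<rho> \<sigma> where rs: "\<rho> \<in> R" "\<sigma> \<in> R" "(x + \<eta>) * (x + \<eta>) = \<rho> + \<sigma> * (x + \<eta>)"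
      using D_add[OF x(1) \<eta>(1)] by (rule D_E)
    have "x * x + (\<eta> * x + \<eta> * x) + \<eta> * \<eta> = \<rho> + \<sigma> * (x + \<eta>)"
      using rs(3) by (simp add: algebra_simps)
    then have rel: "(e + (a + a) + a0 - \<rho>) + (b0 - \<sigma>) * \<eta> + (f + (c + c) - \<sigma>) * x = 0"
      unfolding ef(3) ac(3) ab(3) by (simp add: algebra_simps)
    have 1: "b0 - \<sigma> \<in> m" by (rule indep(2)[OF _ _ _ rel]) (intro R_simps ef ac ab rs cR)+
    have 2: "f + (c + c) - \<sigma> \<in> m" by (rule indep(3)[OF _ _ _ rel]) (intro R_simps ef ac ab rs cR)+
    have "(1 - b0) + (b0 - \<sigma>) - (f + (c + c) - \<sigma>) + (c + c) \<in> m"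
      by (rule 1 2 b0 ac(2) | rule m_add m_diff)+
    then show ?thesis by (simp add: algebra_simps)
  qed
  define A where "A = {p + q * \<eta> + r * x | p q r. p \<in> R \<and> q \<in> R \<and> r \<in> R}"
  \<comment> \<open>Kernel of the evaluation of \<eta> at \<beta> and \<open>x\<close> at \<gamma>,
    with values in \<open>R / m\<close>. The points (1,0), (0,1), (0,0) respect the idempotent
    relations, and \<open>span_indep\<close> keeps \<open>1\<close> out of the kernel.\<close>
  define N where "N \<beta> \<gamma> = {p + q * \<eta> + r * x | p q r. p \<in> R \<and> q \<in> R \<and> r \<in> R \<and> p + \<beta> * q + \<gamma> * r \<in> m}" for \<beta> \<gamma>
  have AI: "p + q * \<eta> + r * x \<in> A" if "p \<in> R" "q \<in> R" "r \<in> R" for p q r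
    unfolding A_def using that by blast
  have NI: "p + q * \<eta> + r * x \<in> N \<beta> \<gamma>" if "p \<in> R" "q \<in> R" "r \<in> R" "p + \<beta> * q + \<gamma> * r \<in> m" for p q r \<beta> \<gamma>
    unfolding N_def using that by blast
  have NE: "\<exists>p q r. p \<in> R \<and> q \<in> R \<and> r \<in> R \<and> p + \<beta> * q + \<gamma> * r \<in> m \<and> z = p + q * \<eta> + r * x" if "z \<in> N \<beta> \<gamma>" for z \<beta> \<gamma>
    using that unfolding N_def by blast
  have A_add: "s + t \<in> A" if st: "s \<in> A" "t \<in> A" for s t
  proof -
    obtain p q r p' q' r' where h: "p \<in> R" "q \<in> R" "r \<in> R" "p' \<in> R" "q' \<in> R" "r' \<in> R"
      "s = p + q * \<eta> + r * x" "t = p' + q' * \<eta> + r' * x"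
      using st unfolding A_def by blast
    have "s + t = (p + p') + (q + q') * \<eta> + (r + r') * x" unfolding h by (simp add: algebra_simps)
    then show ?thesis using AI[of "p + p'" "q + q'" "r + r'"] h R_simps(3) by metis
  qed
  have N_add: "s + t \<in> N \<beta> \<gamma>" if st: "s \<in> N \<beta> \<gamma>" "t \<in> N \<beta> \<gamma>" for s t \<beta> \<gamma>
  proof -
    obtain p q r where h: "p \<in> R" "q \<in> R" "r \<in> R" "p + \<beta> * q + \<gamma> * r \<in> m" "s = p + q * \<eta> + r * x"
      using NE[OF st(1)] by blast
    obtain p' q' r' where h': "p' \<in> R" "q' \<in> R" "r' \<in> R" "p' + \<beta> * q' + \<gamma> * r' \<in> m" "t = p' + q' * \<eta> + r' * x"
      using NE[OF st(2)] by blast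
    have 1: "s + t = (p + p') + (q + q') * \<eta> + (r + r') * x" unfolding h h' by (simp add: algebra_simps)
    have "(p + p') + \<beta> * (q + q') + \<gamma> * (r + r') = (p + \<beta> * q + \<gamma> * r) + (p' + \<beta> * q' + \<gamma> * r')"
      by (simp add: algebra_simps)
    also have "\<dots> \<in> m" by (intro m_add h h')
    finally show ?thesis unfolding 1 by (intro NI R_simps h(1-3) h'(1-3))
  qed
  have N_R: "s * z \<in> N \<beta> \<gamma>" if s: "s \<in> R" and z: "z \<in> N \<beta> \<gamma>" for s z \<beta> \<gamma>
  proof -
    obtain p q r where h: "p \<in> R" "q \<in> R" "r \<in> R" "p + \<beta> * q + \<gamma> * r \<in> m" "z = p + q * \<eta> + r * x"
      using NE[OF z] by blast
    have 1: "s * z = (s * p) + (s * q) * \<eta> + (s * r) * x" unfolding h by (simp add: algebra_simps)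
    have "(s * p) + \<beta> * (s * q) + \<gamma> * (s * r) = s * (p + \<beta> * q + \<gamma> * r)"
      by (simp add: algebra_simps)
    also have "\<dots> \<in> m" by (intro m_mult h s)
    finally show ?thesis unfolding 1 by (intro NI R_simps h(1-3) s)
  qed
  have N_\<eta>: "\<eta> * z \<in> N \<beta> \<gamma>" if bg: "\<beta> \<in> R" "\<gamma> \<in> R" "\<beta> * \<beta> = \<beta>" "\<beta> * \<gamma> = 0" and z: "z \<in> N \<beta> \<gamma>" for z \<beta> \<gamma>
  proof -
    obtain p q r where h: "p \<in> R" "q \<in> R" "r \<in> R" "p + \<beta> * q + \<gamma> * r \<in> m" "z = p + q * \<eta> + r * x"
      using NE[OF z] by blast
    have "\<eta> * z = p * \<eta> + q * (\<eta> * \<eta>) + r * (\<eta> * x)" unfolding h by (simp add: algebra_simps)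
    then have 1: "\<eta> * z = (q * a0 + r * a) + (p + q * b0) * \<eta> + (r * c) * x" unfolding ab ac by (simp add: algebra_simps)
    have "\<beta> * (p + \<beta> * q + \<gamma> * r) = \<beta> * p + (\<beta> * \<beta>) * q + (\<beta> * \<gamma>) * r" by (simp add: algebra_simps)
    then have e: "\<beta> * (p + \<beta> * q + \<gamma> * r) = \<beta> * p + \<beta> * q" unfolding bg by simp
    have "(q * a0 + r * a) + \<beta> * (p + q * b0) + \<gamma> * (r * c) =
       (q * a0 + r * a) + (\<beta> * (p + \<beta> * q + \<gamma> * r) - (\<beta> * q) * (1 - b0)) + (\<gamma> * r) * c"
      unfolding e by (simp add: algebra_simps)
    also have "\<dots> \<in> m"
    proof -
      have "q * a0 \<in> m" "r * a \<in> m" "\<beta> * (p + \<beta> * q + \<gamma> * r) \<in> m" "(\<beta> * q) * (1 - b0) \<in> m" "(\<gamma> * r) * c \<in> m"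
        by (rule m_mult, (rule h a0 am b0 ac bg(1,2) R_simps(5))+)+
      note 2 = this
      show ?thesis by (rule 2 | rule m_add m_diff)+
    qed
    finally show ?thesis unfolding 1 by (intro NI R_simps h(1-3) ab ac cR)
  qed
  have N_x: "x * z \<in> N \<beta> \<gamma>" if bg: "\<beta> \<in> R" "\<gamma> \<in> R" "\<gamma> * \<gamma> = \<gamma>" "\<beta> * \<gamma> = 0" and z: "z \<in> N \<beta> \<gamma>" for z \<beta> \<gamma>
  proof -
    obtain p q r where h: "p \<in> R" "q \<in> R" "r \<in> R" "p + \<beta> * q + \<gamma> * r \<in> m" "z = p + q * \<eta> + r * x"
      using NE[OF z] by blast
    have "x * z = p * x + q * (\<eta> * x) + r * (x * x)" unfolding h by (simp add: algebra_simps)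
    then have 1: "x * z = (q * a + r * e) + 0 * \<eta> + (p + q * c + r * f) * x" unfolding ef ac by (simp add: algebra_simps)
    have "\<gamma> * (p + \<beta> * q + \<gamma> * r) = \<gamma> * p + (\<beta> * \<gamma>) * q + (\<gamma> * \<gamma>) * r" by (simp add: algebra_simps)
    then have e: "\<gamma> * (p + \<beta> * q + \<gamma> * r) = \<gamma> * p + \<gamma> * r" unfolding bg by simp
    have "(q * a + r * e) + \<beta> * 0 + \<gamma> * (p + q * c + r * f) =
       (q * a + r * e) + (\<gamma> * (p + \<beta> * q + \<gamma> * r) - (\<gamma> * r) * (1 - f)) + (\<gamma> * q) * c"
      unfolding e by (simp add: algebra_simps)
    also have "\<dots> \<in> m"
    proof -
      have "q * a \<in> m" "r * e \<in> m" "\<gamma> * (p + \<beta> * q + \<gamma> * r) \<in> m" "(\<gamma> * r) * (1 - f) \<in> m" "(\<gamma> * q) * c \<in> m"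
        by (rule m_mult, (rule h em am fm ac bg(1,2) R_simps(5))+)+
      note 2 = this
      show ?thesis by (rule 2 | rule m_add m_diff)+
    qed
    finally show ?thesis unfolding 1 by (intro NI R_simps h(1-3) ef cR ac(1))
  qed
  have N_id: "m \<subseteq> N \<beta> \<gamma> \<and> 1 \<notin> N \<beta> \<gamma> \<and> (\<forall>x\<in>N \<beta> \<gamma>. \<forall>y\<in>N \<beta> \<gamma>. x + y \<in> N \<beta> \<gamma>) \<and> (\<forall>a\<in>A. \<forall>x\<in>N \<beta> \<gamma>. a * x \<in> N \<beta> \<gamma>)"
    if bg: "\<beta> \<in> R" "\<gamma> \<in> R" "\<beta> * \<beta> = \<beta>" "\<gamma> * \<gamma> = \<gamma>" "\<beta> * \<gamma> = 0" for \<beta> \<gamma>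
  proof (intro conjI ballI)
    show "m \<subseteq> N \<beta> \<gamma>"
    proof
      fix z assume "z \<in> m"
      then show "z \<in> N \<beta> \<gamma>" using NI[of z 0 0 \<beta> \<gamma>] m_R R_simps(1) by simp
    qed
    show "1 \<notin> N \<beta> \<gamma>"
    proof
      assume "1 \<in> N \<beta> \<gamma>"
      then obtain p q r where h: "p \<in> R" "q \<in> R" "r \<in> R" "p + \<beta> * q + \<gamma> * r \<in> m" "1 = p + q * \<eta> + r * x"
        using NE by blast
      have rel: "(p - 1) + q * \<eta> + r * x = 0" using h(5) by (simp add: algebra_simps)
      have 1: "p - 1 \<in> R" by (intro R_simps h)
      have "(p + \<beta> * q + \<gamma> * r) - \<gamma> * r - \<beta> * q - (p - 1) \<in> m"
        by (rule h(4) indep[OF 1 h(2,3) rel] bg(1,2) | rule m_diff m_mult)+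
      then show False using one_m by simp
    qed
    show "s + t \<in> N \<beta> \<gamma>" if "s \<in> N \<beta> \<gamma>" "t \<in> N \<beta> \<gamma>" for s t using N_add that by blast
    show "s * z \<in> N \<beta> \<gamma>" if s: "s \<in> A" and z: "z \<in> N \<beta> \<gamma>" for s z
    proof -
      obtain p q r where h: "p \<in> R" "q \<in> R" "r \<in> R" "s = p + q * \<eta> + r * x"
        using s unfolding A_def by blast
      have 1: "s * z = p * z + q * (\<eta> * z) + r * (x * z)" unfolding h by (simp add: algebra_simps)
      show ?thesis unfolding 1 by (intro N_add N_R N_\<eta> N_x h z bg)
    qed
  qed
  have A_D: "A \<subseteq> D"
  proof
    fix z assume "z \<in> A"
    then obtain p q r where h: "p \<in> R" "q \<in> R" "r \<in> R" "z = p + q * \<eta> + r * x"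
      unfolding A_def by blast
    show "z \<in> D" unfolding h(4) by (intro D_add D_mult \<eta>(1) x(1) D_R[OF h(1)] D_R[OF h(2)] D_R[OF h(3)])
  qed
  have A_R: "R \<subseteq> A"
  proof
    fix r assume "r \<in> R" then show "r \<in> A" using AI[of r 0 0] R_simps(1) by simp
  qed
  have A_sm: "submodule R A"
    unfolding submodule_def
  proof (intro conjI ballI)
    show "0 \<in> A" using A_R R_simps(1) by auto
    show "s + t \<in> A" if "s \<in> A" "t \<in> A" for s t using A_add that by blast
    fix s z assume s: "s \<in> R" and "z \<in> A"
    then obtain p q r where h: "p \<in> R" "q \<in> R" "r \<in> R" "z = p + q * \<eta> + r * x"
      unfolding A_def by blast
    have 1: "s * z = (s * p) + (s * q) * \<eta> + (s * r) * x" unfolding h by (simp add: algebra_simps)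
    show "s * z \<in> A" unfolding 1 by (intro AI R_simps h s)
  qed
  have A_mult: "s * t \<in> A" if "s \<in> A" "t \<in> A" for s t
    using ring_in_D[OF A_sm _ A_D that] A_R R_simps(2) by auto
  have YR: "1 - (\<eta> + x) * \<eta> = (1 - a0 - a) + (- b0) * \<eta> + (- c) * x"
  proof -
    have "1 - (\<eta> + x) * \<eta> = 1 - (\<eta> * \<eta>) - (\<eta> * x)" by (simp add: algebra_simps)
    then show ?thesis unfolding ab(3) ac(3) by (simp add: algebra_simps)
  qed
  note 01 = R_simps(1,2)
  show False
  \<comment> \<open>At the three points \<open>X = \<eta> + x\<close> takes the values 1, 1, 0 and
    \<open>Z = \<eta>\<close> the values 1, 0, 0, so \<open>Y = 1 - X Z\<close> takes 0, 1,
    1.\<close>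
  proof (rule no_three_ideals[of A "N 1 0" "N 0 1" "N 0 0" "\<eta> + x" "1 - (\<eta> + x) * \<eta>" \<eta>])
    show "R \<subseteq> A" by (fact A_R)
    show "s + t \<in> A" "s * t \<in> A" if "s \<in> A" "t \<in> A" for s t using that A_add A_mult by auto
    show "m \<subseteq> n \<and> 1 \<notin> n \<and> (\<forall>x\<in>n. \<forall>y\<in>n. x + y \<in> n) \<and> (\<forall>a\<in>A. \<forall>x\<in>n. a * x \<in> n)"
      if "n \<in> {N 1 0, N 0 1, N 0 0}" for n
      using that N_id[of 1 0] N_id[of 0 1] N_id[of 0 0] 01 by auto
    show "\<eta> + x \<in> A" using AI[of 0 1 1] 01 by simp
    show "\<eta> \<in> A" using AI[of 0 1 0] 01 by simp
    show "1 - (\<eta> + x) * \<eta> \<in> A" unfolding YR by (intro AI R_simps ab ac cR)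
    show "1 - (\<eta> + x) * \<eta> + (\<eta> + x) * \<eta> = 1" by simp
    show "\<eta> + x - 1 \<in> N 1 0" using NI[of "- 1" 1 1 1 0] 01 zero_m R_simps(6)[of 1] by (simp add: algebra_simps)
    show "\<eta> + x - 1 \<in> N 0 1" using NI[of "- 1" 1 1 0 1] 01 zero_m R_simps(6)[of 1] by (simp add: algebra_simps)
    show "\<eta> + x \<in> N 0 0" using NI[of 0 1 1 0 0] 01 zero_m by simp
    show "1 - (\<eta> + x) * \<eta> \<in> N 1 0" unfolding YR
    proof (rule NI)
      have "(1 - b0) - a0 - a \<in> m" by (rule b0 a0 am | rule m_diff)+
      then show "1 - a0 - a + 1 * - b0 + 0 * - c \<in> m" by (simp add: algebra_simps)
    qed (intro R_simps ab ac cR)+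
    have Y1: "1 - (\<eta> + x) * \<eta> - 1 = (- a0 - a) + (- b0) * \<eta> + (- c) * x" unfolding YR by simp
    show "1 - (\<eta> + x) * \<eta> - 1 \<in> N 0 1" unfolding Y1
    proof (rule NI)
      have "- a0 - a - c \<in> m" by (intro m_diff m_minus a0 am ac)
      then show "- a0 - a + 0 * - b0 + 1 * - c \<in> m" by simp
    qed (intro R_simps ab ac cR)+
    show "1 - (\<eta> + x) * \<eta> - 1 \<in> N 0 0" unfolding Y1
    proof (rule NI)
      have "- a0 - a \<in> m" by (intro m_diff m_minus a0 am)
      then show "- a0 - a + 0 * - b0 + 0 * - c \<in> m" by simp
    qed (intro R_simps ab ac cR)+
  qed
qed

text \<open>For \<open>y\<close> outside \<open>R + R \<eta>\<close> a translate \<open>x\<close>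
  satisfies \<open>\<eta> x = a' + c x\<close>, and associativity makes \<open>c\<close> congruent
  to \<open>0\<close> or \<open>1\<close> modulo \<open>m\<close>. Replacing \<eta> by
  \<open>1 - \<eta>\<close> interchanges the two cases, and \<open>nonlocal_orthogonal_False\<close>
  excludes the first.\<close>

lemma D_nonlocal:
  assumes \<eta>: "\<eta> \<in> D" "inverse \<eta> \<notin> D" "inverse (1 - \<eta>) \<notin> D" and y: "y \<in> D"
  shows "\<exists>p\<in>R. \<exists>q\<in>R. y = p + q * \<eta>"
proof (rule ccontr)
  assume y2: "\<not> ?thesis"
  obtain a b c where abc: "a \<in> R" "b \<in> R" "c \<in> R" "\<eta> * y = a + b * \<eta> + c * y"
    using \<eta>(1) y by (rule D_prod_span)
  \<comment> \<open>The translation by \<open>b\<close> removes the \<eta>-term from the product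
    with \<eta>.\<close>
  define x where "x = y - b"
  have x: "x \<in> D" unfolding x_def using y abc D_diff D_R by blast
  have x2: "\<not> (\<exists>p\<in>R. \<exists>q\<in>R. x = p + q * \<eta>)"
  proof
    assume "\<exists>p\<in>R. \<exists>q\<in>R. x = p + q * \<eta>"
    then obtain p q where pq: "p \<in> R" "q \<in> R" "x = p + q * \<eta>" by blast
    then have "y = (p + b) + q * \<eta>" unfolding x_def by (simp add: algebra_simps)
    then show False using y2 pq R_simps(3)[OF pq(1) abc(2)] by blast
  qed
  define a' where "a' = a + c * b"
  have a': "a' \<in> R" unfolding a'_def by (intro R_simps abc)
  have \<eta>x: "\<eta> * x = a' + c * x"
    unfolding x_def a'_def using abc(4) by (simp add: algebra_simps)
  obtain a0 b0 where ab: "a0 \<in> R" "b0 \<in> R" "\<eta> * \<eta> = a0 + b0 * \<eta>" using \<eta>(1) by (rule D_E)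
  have "0 * 0 + 0 * b0 - a0 \<in> m"
    by (rule norm_nonunit[OF ab(3,1,2)]) (use \<eta>(2) R_simps(1) in auto)
  then have a0: "a0 \<in> m" using m_minus[of "- a0"] by simp
  have n\<eta>: "(- \<eta>) * (- \<eta>) = a0 + (- b0) * (- \<eta>)" using ab by simp
  have "1 * 1 + 1 * (- b0) - a0 \<in> m"
    by (rule norm_nonunit[OF n\<eta> ab(1)]) (use \<eta>(3) in \<open>auto intro!: R_simps ab\<close>)
  then have "(1 * 1 + 1 * (- b0) - a0) + a0 \<in> m" using a0 by (rule m_add)
  then have b0: "1 - b0 \<in> m" by simp
  have "c * c - a0 - b0 * c \<in> m"
  proof (rule span_indep(3)[OF \<eta> x x2])
    have "\<eta> * (\<eta> * x) = \<eta> * \<eta> * x" by (simp add: mult_ac)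
    then have "\<eta> * (a' + c * x) = (a0 + b0 * \<eta>) * x" unfolding \<eta>x ab(3) .
    then have "a' * \<eta> + c * (\<eta> * x) = a0 * x + b0 * (\<eta> * x)" by (simp add: algebra_simps)
    then show "(c * a' - b0 * a') + a' * \<eta> + (c * c - a0 - b0 * c) * x = 0"
      unfolding \<eta>x by (simp add: algebra_simps)
  qed (intro R_simps a' abc ab)+
  then have "(c * c - a0 - b0 * c) + a0 \<in> m" using a0 by (rule m_add)
  then have "c * (c - b0) \<in> m" by (simp add: algebra_simps)
  then consider "c \<in> m" | "c - b0 \<in> m" using m_prime abc ab R_simps(4) by blast
  then show False
  proof cases
    case 1
    show False by (rule nonlocal_orthogonal_False[OF \<eta> x x2 a' 1 \<eta>x])
  next
    case 2
    have "(1 - b0) - (c - b0) \<in> m" by (rule b0 2 | rule m_diff)+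
    then have c1: "1 - c \<in> m" by simp
    have e: "(1 - \<eta>) * x = - a' + (1 - c) * x" using \<eta>x by (simp add: algebra_simps)
    have x3: "\<not> (\<exists>p\<in>R. \<exists>q\<in>R. x = p + q * (1 - \<eta>))"
    proof
      assume "\<exists>p\<in>R. \<exists>q\<in>R. x = p + q * (1 - \<eta>)"
      then obtain p q where pq: "p \<in> R" "q \<in> R" "x = p + q * (1 - \<eta>)" by blast
      then have "x = (p + q) + (- q) * \<eta>" by (simp add: algebra_simps)
      then show False using x2 R_simps(3)[OF pq(1,2)] R_simps(6)[OF pq(2)] by blast
    qed
    show False
    proof (rule nonlocal_orthogonal_False[OF _ _ _ x x3 _ c1 e])
      show "1 - \<eta> \<in> D" using \<eta> D_diff D_R R_simps(2) by blast
      show "inverse (1 - (1 - \<eta>)) \<notin> D" using \<eta> by simp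
    qed (use \<eta> a' R_simps(6) in auto)
  qed
qed

end

section \<open>Elements divisible by all powers of \<open>x\<close>\<close>

text \<open>Here \<open>Q\<close> is the prime \<open>\<Inter>x\<^sup>kD\<close> of the valuation ring \<open>D\<close>, and \<open>H\<close> is the localization of \<open>R\<close> at \<open>Q \<inter> R\<close>.\<close>
locale deep_valuation = local_stable +
  fixes x y\<^sub>0
  assumes val: "\<theta> \<notin> D \<Longrightarrow> inverse \<theta> \<in> D"
    and x: "x \<in> m" "x \<noteq> 0"
    and y\<^sub>0: "y\<^sub>0 \<in> R" "y\<^sub>0 \<noteq> 0" "\<And>k. y\<^sub>0 * inverse (x ^ k) \<in> D"
begin

definition Q where "Q = {y. \<forall>k. y * inverse (x ^ k) \<in> D}"
definition H where "H = {a * inverse s | a s. a \<in> R \<and> s \<in> R \<and> s \<notin> Q}"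

lemma xR: "x \<in> R" using x m_R by auto

lemma Q_add: "a \<in> Q \<Longrightarrow> b \<in> Q \<Longrightarrow> a + b \<in> Q"
  unfolding Q_def by (auto simp: distrib_right intro: D_add)

lemma Q_mult: "d \<in> D \<Longrightarrow> a \<in> Q \<Longrightarrow> d * a \<in> Q"
  unfolding Q_def by (auto simp: mult.assoc intro: D_mult)

lemma Q_mult2: "d \<in> D \<Longrightarrow> a \<in> Q \<Longrightarrow> a * d \<in> Q"
  using Q_mult[of d a] by (simp add: mult.commute)

lemma Q_diff: "a \<in> Q \<Longrightarrow> b \<in> Q \<Longrightarrow> a - b \<in> Q"
  unfolding Q_def by (auto simp: left_diff_distrib intro: D_diff)

lemma Q_D: "a \<in> Q \<Longrightarrow> a \<in> D"
  unfolding Q_def by (auto dest: spec[of _ 0])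

lemma zero_Q: "0 \<in> Q"
  unfolding Q_def using D_R[OF R_simps(1)] by simp

lemma y\<^sub>0_Q: "y\<^sub>0 \<in> Q" unfolding Q_def using y\<^sub>0 by simp

lemma x_Q: "x \<notin> Q"
proof
  assume "x \<in> Q"
  then have "x * inverse (x ^ 2) \<in> D" unfolding Q_def by blast
  moreover have "x * inverse (x ^ 2) = inverse x" using x(2) by (simp add: power2_eq_square)
  ultimately have "inverse x \<in> D" by simp
  then show False using D_unit_R[OF xR] unit_in_m x by blast
qed

lemma one_Q: "1 \<notin> Q"
  using Q_mult[OF D_R[OF xR], of 1] x_Q by auto

text \<open>The valuation property puts some \<open>x ^ k / s\<close> into \<open>D\<close>, and
  \<open>y\<close> can spare any power of \<open>x\<close>.\<close>

lemma Q_div: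
  assumes y: "y \<in> Q" and s: "s \<in> R" "s \<notin> Q"
  shows "y * inverse s \<in> Q"
proof -
  obtain k where "s * inverse (x ^ k) \<notin> D" using s unfolding Q_def by blast
  then have "inverse (s * inverse (x ^ k)) \<in> D" by (rule val)
  then have k: "inverse s * x ^ k \<in> D" by simp
  have "y * inverse s * inverse (x ^ j) \<in> D" for j
  proof -
    have "y * inverse (x ^ (k + j)) \<in> D" using y unfolding Q_def by blast
    then have "(y * inverse (x ^ (k + j))) * (inverse s * x ^ k) \<in> D" using k by (rule D_mult)
    moreover have "(y * inverse (x ^ (k + j))) * (inverse s * x ^ k) = y * inverse s * inverse (x ^ j)"
      using x(2) by (simp add: power_add field_simps)
    ultimately show ?thesis by simp
  qed
  then show ?thesis unfolding Q_def by blast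
qed

lemma Q_prime:
  assumes "s \<in> R" "s \<notin> Q" "t \<notin> Q" shows "s * t \<notin> Q"
proof
  assume "s * t \<in> Q"
  then have "s * t * inverse s \<in> Q" using assms Q_div by blast
  moreover have "s \<noteq> 0" using assms zero_Q by auto
  then have "s * t * inverse s = t" by simp
  ultimately show False using assms by simp
qed

lemma R_H: "r \<in> R \<Longrightarrow> r \<in> H"
  unfolding H_def using R_simps(2) one_Q by force

lemma H_I: "a \<in> R \<Longrightarrow> s \<in> R \<Longrightarrow> s \<notin> Q \<Longrightarrow> a * inverse s \<in> H"
  unfolding H_def by blast

lemma H_add: assumes "h \<in> H" "k \<in> H" shows "h + k \<in> H"
proof -
  obtain a s b t where h: "a \<in> R" "s \<in> R" "s \<notin> Q" "h = a * inverse s" "b \<in> R" "t \<in> R" "t \<notin> Q" "k = b * inverse t"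
    using assms unfolding H_def by blast
  have "s \<noteq> 0" "t \<noteq> 0" using h zero_Q by auto
  then have "h + k = (a * t + b * s) * inverse (s * t)" unfolding h by (simp add: field_simps)
  moreover have "s * t \<notin> Q" using Q_prime h by blast
  ultimately show ?thesis using H_I[of "a * t + b * s" "s * t"] h(1,2,5,6) R_simps(3,5) by simp
qed

lemma H_mult: assumes "h \<in> H" "k \<in> H" shows "h * k \<in> H"
proof -
  obtain a s b t where h: "a \<in> R" "s \<in> R" "s \<notin> Q" "h = a * inverse s" "b \<in> R" "t \<in> R" "t \<notin> Q" "k = b * inverse t"
    using assms unfolding H_def by blast
  have "h * k = (a * b) * inverse (s * t)" unfolding h by (simp add: field_simps)
  moreover have "s * t \<notin> Q" using Q_prime h by blast
  ultimately show ?thesis using H_I[of "a * b" "s * t"] h(1,2,5,6) R_simps(5) by simp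
qed

lemma H_minus: "h \<in> H \<Longrightarrow> - h \<in> H"
  using H_mult[OF R_H[of "- 1"], of h] R_simps(6)[OF R_simps(2)] by simp

lemma H_diff: "h \<in> H \<Longrightarrow> k \<in> H \<Longrightarrow> h - k \<in> H"
  using H_add[OF _ H_minus] by fastforce

lemma H_inv: assumes "h \<in> H" "h \<notin> Q" shows "inverse h \<in> H"
proof -
  obtain a s where h: "a \<in> R" "s \<in> R" "s \<notin> Q" "h = a * inverse s" using assms unfolding H_def by blast
  then have "a \<notin> Q" using assms Q_div by blast
  then have "s * inverse a \<in> H" using h H_I by blast
  then show ?thesis using h by (simp add: mult.commute)
qed

lemma Q_H: assumes "y \<in> Q" "h \<in> H" shows "y * h \<in> Q"
proof -
  obtain a s where h: "a \<in> R" "s \<in> R" "s \<notin> Q" "h = a * inverse s" using assms unfolding H_def by blast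
  have "(y * a) * inverse s \<in> Q" using Q_div[OF Q_mult2[OF D_R assms(1)]] h by blast
  then show ?thesis using h by (simp add: mult.assoc)
qed

text \<open>By \<open>Q_div\<close>, \<open>R + (Q \<inter> R) / s\<close> is a module between
  \<open>R\<close> and \<open>D\<close>, hence a ring; multiplying the expression for
  \<open>(y / s) (z / s)\<close> by \<open>s\<close> clears the denominators. The two factors from
  \<open>Q\<close> are the origin of the square of \<open>y\<^sub>0\<close> below.\<close>

lemma QQ_div:
  assumes y: "y \<in> Q" "y \<in> R" "z \<in> Q" "z \<in> R" and s: "s \<in> R" "s \<notin> Q"
  shows "y * z * inverse s \<in> R"
proof -
  define A where "A = {r + u * inverse s | r u. r \<in> R \<and> u \<in> R \<and> u \<in> Q}"
  have s0: "s \<noteq> 0" using s zero_Q by auto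
  have sub: "submodule R A" unfolding submodule_def
  proof (intro conjI ballI)
    have "0 = 0 + 0 * inverse s" by simp
    then show "0 \<in> A" unfolding A_def using R_simps(1) zero_Q by blast
  next
    fix a b assume "a \<in> A" "b \<in> A"
    then obtain r u r' u' where h: "r \<in> R" "u \<in> R" "u \<in> Q" "r' \<in> R" "u' \<in> R" "u' \<in> Q" "a = r + u * inverse s" "b = r' + u' * inverse s"
      unfolding A_def by blast
    have "a + b = (r + r') + (u + u') * inverse s" unfolding h by (simp add: algebra_simps)
    then show "a + b \<in> A" unfolding A_def
      by (intro CollectI exI conjI, assumption) (intro R_simps Q_add h)+
  next
    fix a b assume a: "a \<in> R" and "b \<in> A"
    then obtain r u where h: "r \<in> R" "u \<in> R" "u \<in> Q" "b = r + u * inverse s"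
      unfolding A_def by blast
    have "a * b = a * r + (a * u) * inverse s" unfolding h by (simp add: algebra_simps)
    then show "a * b \<in> A" unfolding A_def
      by (intro CollectI exI conjI, assumption) (intro R_simps Q_mult D_R h a)+
  qed
  have I: "r + u * inverse s \<in> A" if "r \<in> R" "u \<in> R" "u \<in> Q" for r u
    unfolding A_def using that by blast
  have AD: "A \<subseteq> D"
  proof
    fix a assume "a \<in> A"
    then obtain r u where h: "r \<in> R" "u \<in> R" "u \<in> Q" "a = r + u * inverse s"
      unfolding A_def by blast
    show "a \<in> D" unfolding h(4) using D_add[OF D_R[OF h(1)] Q_D[OF Q_div[OF h(3) s]]] .
  qed
  have "(y * inverse s) * (z * inverse s) \<in> A"
  proof (rule ring_in_D[OF sub _ AD])
    show "1 \<in> A" using I[of 1 0] R_simps(1,2) zero_Q by simp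
    show "y * inverse s \<in> A" using I[of 0 y] R_simps(1) y by simp
    show "z * inverse s \<in> A" using I[of 0 z] R_simps(1) y by simp
  qed
  then obtain r u where h: "r \<in> R" "u \<in> R" "u \<in> Q" "(y * inverse s) * (z * inverse s) = r + u * inverse s"
    unfolding A_def by blast
  have "y * z * inverse s = s * ((y * inverse s) * (z * inverse s))" using s0 by (simp add: field_simps)
  also have "\<dots> = s * r + u" unfolding h using s0 by (simp add: field_simps)
  also have "\<dots> \<in> R" by (intro R_simps h s)
  finally show ?thesis .
qed

lemma H_fractional: assumes "h \<in> H" shows "y\<^sub>0 * y\<^sub>0 * h \<in> R"
proof -
  obtain a s where h: "a \<in> R" "s \<in> R" "s \<notin> Q" "h = a * inverse s" using assms unfolding H_def by blast
  have "a * (y\<^sub>0 * y\<^sub>0 * inverse s) \<in> R" using QQ_div[OF y\<^sub>0_Q y\<^sub>0(1) y\<^sub>0_Q y\<^sub>0(1) h(2,3)] h R_simps(5) by blast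
  then show ?thesis unfolding h by (simp add: mult_ac)
qed

text \<open>Stability of the module \<open>R + (\<nu> + \<theta>)H\<close> forces every \<open>\<nu> \<in> R\<close> to be a root, modulo \<open>Q\<close>, of the
  quadratic polynomial of \<open>-\<theta>\<close>; three values of \<open>\<nu>\<close> already contradict this.\<close>
lemma translate_root:
  assumes \<theta>: "\<theta> \<in> D" "\<theta> \<notin> H" and ab: "\<alpha> \<in> R" "\<beta> \<in> R" "\<theta> * \<theta> = \<alpha> + \<beta> * \<theta>" and \<nu>: "\<nu> \<in> R"
  shows "\<nu> * \<nu> + \<beta> * \<nu> - \<alpha> \<in> Q"
proof -
  define t where "t = \<nu> + \<theta>"
  have tD: "t \<in> D" unfolding t_def using \<theta> \<nu> D_add D_R by blast
  have tH: "t \<notin> H"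
  proof
    assume "t \<in> H"
    then have "t - \<nu> \<in> H" using H_diff R_H \<nu> by blast
    then show False using \<theta> unfolding t_def by simp
  qed
  define Y where "Y = {y + t * h | y h. y \<in> Q \<and> y \<in> H \<and> h \<in> H}"
  define M where "M = {r + t * h | r h. r \<in> R \<and> h \<in> H}"
  have H0: "0 \<in> H" and H1: "1 \<in> H" using R_H R_simps(1,2) by auto
  have YI: "y + t * h \<in> Y" if "y \<in> Q" "y \<in> H" "h \<in> H" for y h unfolding Y_def using that by blast
  have MI: "r + t * h \<in> M" if "r \<in> R" "h \<in> H" for r h unfolding M_def using that by blast
  have Y_add: "a + b \<in> Y" if "a \<in> Y" "b \<in> Y" for a b
  proof -
    obtain y h y' h' where e: "y \<in> Q" "y \<in> H" "h \<in> H" "y' \<in> Q" "y' \<in> H" "h' \<in> H" "a = y + t * h" "b = y' + t * h'"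
      using \<open>a \<in> Y\<close> \<open>b \<in> Y\<close> unfolding Y_def by blast
    have 1: "a + b = (y + y') + t * (h + h')" unfolding e by (simp add: algebra_simps)
    show ?thesis unfolding 1 by (intro YI Q_add H_add e)
  qed
  have Y_H: "k * a \<in> Y" if k: "k \<in> H" and "a \<in> Y" for a k
  proof -
    obtain y h where e: "y \<in> Q" "y \<in> H" "h \<in> H" "a = y + t * h"
      using \<open>a \<in> Y\<close> unfolding Y_def by blast
    have 1: "k * a = (y * k) + t * (h * k)" unfolding e by (simp add: algebra_simps)
    show ?thesis unfolding 1 by (intro YI Q_H H_mult e k)
  qed
  have Y_diff: "a - b \<in> Y" if "a \<in> Y" "b \<in> Y" for a b
    using Y_add[OF that(1) Y_H[OF H_minus[OF H1] that(2)]] by simp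
  have tY: "t * h \<in> Y" if "h \<in> H" for h using YI[OF zero_Q H0 that] by simp
  \<comment> \<open>Otherwise \<open>t\<close> has an inverse in \<open>H\<close>. That inverse is
    outside \<open>Q\<close>, as \<open>t \<in> D\<close>, so it is a unit of \<open>H\<close>, and
    \<open>t\<close> would lie in \<open>H\<close>.\<close>
  have one_Y: "1 \<notin> Y"
  proof
    assume "1 \<in> Y"
    then obtain y h where e: "y \<in> Q" "y \<in> H" "h \<in> H" "1 = y + t * h" unfolding Y_def by blast
    have nQ: "1 - y \<notin> Q" using Q_add[of "1 - y" y] e one_Q by auto
    then have i: "inverse (1 - y) \<in> H" using H_inv H_diff H1 e by blast
    define h' where "h' = h * inverse (1 - y)"
    have h': "h' \<in> H" unfolding h'_def using H_mult e i by blast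
    have "1 - y \<noteq> 0" using nQ zero_Q by auto
    moreover have "1 - y = t * h" using e(4) by (simp add: algebra_simps)
    ultimately have th: "t * h' = 1" unfolding h'_def by (metis mult.assoc right_inverse)
    show False
    proof (cases "h' \<in> Q")
      case True
      then show False using Q_mult[OF tD True] th one_Q by simp
    next
      case False
      then have "inverse h' \<in> H" using H_inv h' by blast
      moreover have "inverse h' = t" using th by (metis inverse_unique mult.commute)
      ultimately show False using tH by simp
    qed
  qed
  \<comment> \<open>If \<open>r\<close> is outside \<open>Q\<close>, then \<open>r x\<close> is a
    unit of \<open>H\<close>. Testing with its inverse puts \<open>1 - x r'\<close> into
    \<open>t H\<close>; this is a unit of \<open>R\<close> because \<open>x \<in> m\<close>, against
    \<open>one_Y\<close>.\<close>
  have MY: "z \<in> Y" if z: "\<And>h. h \<in> H \<Longrightarrow> z * h \<in> M" for z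
  proof -
    obtain r h where e: "r \<in> R" "h \<in> H" "z = r + t * h" using z[OF H1] unfolding M_def by auto
    show ?thesis
    proof (cases "r \<in> Q")
      case True
      then show ?thesis unfolding e(3) by (intro YI R_H e)
    next
      case False
      then have rx: "r * x \<notin> Q" "r \<noteq> 0" using Q_prime e x_Q zero_Q by auto
      then have i: "inverse (r * x) \<in> H" using H_inv R_H R_simps(5) e xR by blast
      obtain r' h1 where e': "r' \<in> R" "h1 \<in> H" "z * inverse (r * x) = r' + t * h1"
        using z[OF i] unfolding M_def by auto
      have "r * inverse (r * x) = r' + t * (h1 - h * inverse (r * x))"
        using e'(3) unfolding e(3) by (simp add: algebra_simps)
      then have "x * (r * inverse (r * x)) = x * (r' + t * (h1 - h * inverse (r * x)))" by (rule arg_cong)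
      moreover have "x * (r * inverse (r * x)) = 1" using rx(2) x(2) by (simp add: field_simps)
      ultimately have "1 = x * (r' + t * (h1 - h * inverse (r * x)))" by metis
      then have 1: "1 - x * r' = t * (x * (h1 - h * inverse (r * x)))"
        by (simp add: algebra_simps)
      have xr: "x * r' \<in> m" using m_mult2 e' x by blast
      have "1 - x * r' \<notin> m" using m_add[OF _ xr, of "1 - x * r'"] one_m by auto
      then have v: "inverse (1 - x * r') \<in> R" "1 - x * r' \<noteq> 0"
        using m_unit R_simps(4)[OF R_simps(2) m_R[OF xr]] zero_m by auto
      have "inverse (1 - x * r') * (t * (x * (h1 - h * inverse (r * x)))) \<in> Y"
        by (intro Y_H R_H v tY H_mult H_diff e e' i xR)
      then show ?thesis using one_Y v(2) unfolding 1[symmetric] by simp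
    qed
  qed
  have M: "submodule R M" unfolding submodule_def
  proof (intro conjI ballI)
    show "0 \<in> M" using MI[OF R_simps(1) H0] by simp
  next
    fix a b assume "a \<in> M" "b \<in> M"
    then obtain r h r' h' where e: "r \<in> R" "h \<in> H" "r' \<in> R" "h' \<in> H" "a = r + t * h" "b = r' + t * h'"
      unfolding M_def by blast
    have 1: "a + b = (r + r') + t * (h + h')" unfolding e by (simp add: algebra_simps)
    show "a + b \<in> M" unfolding 1 by (intro MI R_simps H_add e)
  next
    fix a b assume a: "a \<in> R" and "b \<in> M"
    then obtain r h where e: "r \<in> R" "h \<in> H" "b = r + t * h"
      unfolding M_def by blast
    have 1: "a * b = (a * r) + t * (a * h)" unfolding e by (simp add: algebra_simps)
    show "a * b \<in> M" unfolding 1 by (intro MI R_simps H_mult R_H e a)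
  qed
  have M1: "1 \<in> M" using MI[OF R_simps(2) H0] by simp
  have Mt: "t * h \<in> M" if "h \<in> H" for h using MI[OF R_simps(1) that] by simp
  define L where "L = colon (Eend M) M"
  obtain b where b: "b \<in> R" "b \<noteq> 0" "b * t \<in> R" using denom by blast
  have "1 \<in> setprod M L" unfolding L_def
  proof (rule stableD[OF M M1])
    show "y\<^sub>0 * y\<^sub>0 * b \<noteq> 0" using y\<^sub>0 b by simp
    fix z assume "z \<in> M"
    then obtain r h where e: "r \<in> R" "h \<in> H" "z = r + t * h" unfolding M_def by blast
    have "y\<^sub>0 * y\<^sub>0 * b * z = y\<^sub>0 * y\<^sub>0 * b * r + (b * t) * (y\<^sub>0 * y\<^sub>0 * h)" unfolding e by (simp add: algebra_simps)
    also have "\<dots> \<in> R" by (intro R_simps(3,5) y\<^sub>0 b e H_fractional)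
    finally show "y\<^sub>0 * y\<^sub>0 * b * z \<in> R" .
  qed simp
  \<comment> \<open>\<open>M\<close> contains \<open>1\<close> and \<open>t H\<close>, so
    \<open>l t\<close> and \<open>l t t\<close> multiply \<open>H\<close> into \<open>M\<close>, and
    \<open>MY\<close> applies.\<close>
  have LM: "l \<in> M" "l * t \<in> Y" "l * t * t \<in> Y" if l: "l \<in> L" for l
  proof -
    have lm: "l * a * c \<in> M" if "a \<in> M" "c \<in> M" for a c using l that unfolding L_def mem_colon_Eend by blast
    show "l \<in> M" using lm[OF M1 M1] by simp
    show "l * t \<in> Y"
    proof (rule MY)
      fix h assume "h \<in> H"
      then show "l * t * h \<in> M" using lm[OF M1 Mt] by (simp add: mult.assoc)
    qed
    show "l * t * t \<in> Y"
    proof (rule MY)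
      fix h assume "h \<in> H"
      then show "l * t * t * h \<in> M" using lm[OF Mt[OF H1] Mt] by (simp add: mult.assoc)
    qed
  qed
  have "\<exists>l\<in>L. l \<notin> Y"
  proof (rule ccontr)
    assume c: "\<not> ?thesis"
    have "1 \<in> Y" using \<open>1 \<in> setprod M L\<close>
    proof (induction rule: setprod_induct)
      case zero
      show ?case using tY[OF H0] by simp
    next
      case (add a c)
      then show ?case using Y_add by blast
    next
      case (prod z l)
      obtain r h where e: "r \<in> R" "h \<in> H" "z = r + t * h" using prod(1) unfolding M_def by blast
      have 1: "z * l = r * l + h * (l * t)" unfolding e by (simp add: algebra_simps)
      have "l \<in> Y" using prod c by blast
      then show ?case unfolding 1 by (intro Y_add Y_H R_H e LM prod)
    qed
    then show False using one_Y by simp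
  qed
  then obtain l where l: "l \<in> L" "l \<notin> Y" by blast
  obtain a b where e: "a \<in> R" "b \<in> H" "l = a + t * b" using LM(1)[OF l(1)] unfolding M_def by blast
  have aQ: "a \<notin> Q" using l(2) YI[of a b] R_H e by blast
  have "l * t - t * a \<in> Y" by (intro Y_diff LM l tY R_H e)
  then have bt: "b * (t * t) \<in> Y" unfolding e(3) by (simp add: algebra_simps)
  then obtain y z where yz: "y \<in> Q" "y \<in> H" "z \<in> H" "b * (t * t) = y + t * z" unfolding Y_def by blast
  have "l * t * t = a * (t * t) + t * (b * (t * t))" unfolding e(3) by (simp add: algebra_simps)
  also have "\<dots> = (a + z) * (t * t) + t * y" unfolding yz(4) by (simp add: algebra_simps)
  finally have "(a + z) * (t * t) = l * t * t - t * y" by simp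
  moreover have "l * t * t - t * y \<in> Y" by (intro Y_diff LM l tY yz)
  ultimately have az: "(a + z) * (t * t) \<in> Y" by simp
  have cancel: "t * t \<in> Y" if "c \<in> H" "c \<notin> Q" "c * (t * t) \<in> Y" for c
  proof -
    have "inverse c * (c * (t * t)) \<in> Y" using that Y_H H_inv by blast
    moreover have "c \<noteq> 0" using that zero_Q by auto
    then have "inverse c * (c * (t * t)) = t * t" by (simp add: mult.assoc[symmetric])
    ultimately show ?thesis by simp
  qed
  have azH: "a + z \<in> H" by (intro H_add R_H e yz)
  \<comment> \<open>Elements of \<open>H\<close> outside \<open>Q\<close> are units of
    \<open>H\<close> and can be cancelled. In the first case \<theta> would be a quotient in
    \<open>H\<close> unless \<kappa> \<in> Q; in the second \<open>t\<close> itself is in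
    \<open>Q\<close>, and the value is \<open>t\<close> times its conjugate.\<close>
  consider "t * t \<in> Y" | "b \<in> Q" "a + z \<in> Q" using cancel[OF e(2) _ bt] cancel[OF azH _ az] by blast
  then show ?thesis
  proof cases
    case 1
    then obtain y z where yz: "y \<in> Q" "y \<in> H" "z \<in> H" "t * t = y + t * z" unfolding Y_def by blast
    define \<kappa> where "\<kappa> = \<nu> + \<nu> + \<beta> - z"
    have \<kappa>H: "\<kappa> \<in> H" unfolding \<kappa>_def by (intro H_diff H_add R_H \<nu> ab yz)
    have "\<nu> * \<nu> + (\<nu> * \<theta> + \<nu> * \<theta>) + \<theta> * \<theta> = y + (\<nu> + \<theta>) * z"
      using yz(4) unfolding t_def by (simp add: algebra_simps)
    then have eq: "\<kappa> * \<theta> = y + \<nu> * z - \<nu> * \<nu> - \<alpha>"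
      unfolding ab(3) \<kappa>_def by (simp add: algebra_simps)
    have \<kappa>Q: "\<kappa> \<in> Q"
    proof (rule ccontr)
      assume c: "\<kappa> \<notin> Q"
      then have "\<kappa> \<noteq> 0" using zero_Q by auto
      then have "\<theta> = inverse \<kappa> * (y + \<nu> * z - \<nu> * \<nu> - \<alpha>)" unfolding eq[symmetric]
        by (simp add: mult.assoc[symmetric])
      also have "\<dots> \<in> H" by (intro H_mult H_inv c \<kappa>H H_diff H_add yz R_H \<nu> ab)
      finally show False using \<theta> by simp
    qed
    have "\<nu> * \<nu> + \<beta> * \<nu> - \<alpha> = \<kappa> * \<theta> - y + \<kappa> * \<nu>"
      unfolding eq unfolding \<kappa>_def by (simp add: algebra_simps)
    also have "\<dots> \<in> Q" by (intro Q_add Q_diff Q_mult2 \<kappa>Q yz \<theta> D_R \<nu>)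
    finally show ?thesis .
  next
    case 2
    have zQ: "z \<notin> Q" using Q_diff[OF 2(2), of z] aQ by auto
    then have "z \<noteq> 0" using zero_Q by auto
    have "t = (b * (t * t) - y) * inverse z" unfolding yz(4) using \<open>z \<noteq> 0\<close> by simp
    also have "\<dots> \<in> Q"
      by (rule Q_H[OF Q_diff[OF Q_mult2[OF D_mult[OF tD tD] 2(1)] yz(1)] H_inv[OF yz(3) zQ]])
    finally have tQ: "t \<in> Q" .
    have "\<nu> * \<nu> + \<beta> * \<nu> - \<alpha> = t * (\<nu> + \<beta> - \<theta>)"
      unfolding t_def using ab(3) by (simp add: algebra_simps)
    also have "\<dots> \<in> Q" by (intro Q_mult2 D_diff D_add D_R \<nu> ab \<theta> tQ)
    finally show ?thesis .
  qed
qed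

text \<open>With f(\<nu>) = \<nu> \<nu> + \<beta> \<nu> - \<alpha>, the combination f(x) - f(0) - x
  (f(1) - f(0)) cancels \<alpha> and \<beta> and leaves x (x - 1). But \<open>x\<close> is outside
  \<open>Q\<close> and \<open>x - 1\<close> is a unit of \<open>R\<close>.\<close>

lemma D_H: "D \<subseteq> H"
proof (rule ccontr)
  assume "\<not> ?thesis"
  then obtain \<theta> where \<theta>: "\<theta> \<in> D" "\<theta> \<notin> H" by blast
  obtain \<alpha> \<beta> where ab: "\<alpha> \<in> R" "\<beta> \<in> R" "\<theta> * \<theta> = \<alpha> + \<beta> * \<theta>" using \<theta>(1) by (rule D_E)
  note r = translate_root[OF \<theta> ab]
  have "(x * x + \<beta> * x - \<alpha>) - (0 * 0 + \<beta> * 0 - \<alpha>) - x * ((1 * 1 + \<beta> * 1 - \<alpha>) - (0 * 0 + \<beta> * 0 - \<alpha>)) \<in> Q"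
    by (rule Q_diff[OF Q_diff[OF r[OF xR] r[OF R_simps(1)]] Q_mult[OF D_R[OF xR] Q_diff[OF r[OF R_simps(2)] r[OF R_simps(1)]]]])
  then have *: "x * (x - 1) \<in> Q" by (simp add: algebra_simps)
  have "x - 1 \<notin> m" using m_diff[OF x(1), of "x - 1"] one_m by auto
  then have "x - 1 \<notin> Q" using Q_D m_unit[of "x - 1"] R_simps(4)[OF xR R_simps(2)] Q_mult[of "inverse (x - 1)" "x - 1"] D_R one_Q zero_m
    by (metis left_inverse)
  then show False using * Q_prime[OF xR x_Q] by blast
qed

lemma D_fractional: "y \<in> D \<Longrightarrow> y\<^sub>0 * y\<^sub>0 * y \<in> R"
  using D_H H_fractional by blast

end

section \<open>The case of a local ring \<open>D\<close>\<close>

context local_stable begin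

text \<open>If locality fails at \<eta>, then \<open>D = R + R \<eta>\<close> by
  \<open>D_nonlocal\<close>, and a denominator of \<eta> serves all of \<open>D\<close>. The value
  \<open>inverse 0 = 0\<close> does no harm: of 0 and 1 one is a unit anyway.\<close>

lemma valuation_or_fractional:
  "(\<exists>d. d \<noteq> 0 \<and> (\<forall>y\<in>D. d * y \<in> R)) \<or> (\<forall>\<eta>\<in>D. inverse \<eta> \<in> D \<or> inverse (1 - \<eta>) \<in> D)"
proof (rule ccontr)
  assume c: "\<not> ?thesis"
  then obtain \<eta> where \<eta>: "\<eta> \<in> D" "inverse \<eta> \<notin> D" "inverse (1 - \<eta>) \<notin> D" by blast
  obtain d where d: "d \<in> R" "d \<noteq> 0" "d * \<eta> \<in> R" using denom by blast
  have "d * y \<in> R" if y: "y \<in> D" for y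
  proof -
    obtain p q where pq: "p \<in> R" "q \<in> R" "y = p + q * \<eta>" using D_nonlocal[OF \<eta> y] by blast
    have "d * y = d * p + q * (d * \<eta>)" unfolding pq by (simp add: algebra_simps)
    also have "\<dots> \<in> R" by (intro R_simps pq d)
    finally show ?thesis .
  qed
  then show False using c d by blast
qed

context
  assumes local_D: "\<And>\<eta>. \<eta> \<in> D \<Longrightarrow> inverse \<eta> \<in> D \<or> inverse (1 - \<eta>) \<in> D"
begin

text \<open>In \<open>u + v \<theta> = 1\<close> both summands lie in \<open>D\<close>, so one is a
  unit. If it is \<open>u\<close>, then \<theta> = (u \<theta>) / u is in \<open>D\<close>; if it is
  \<open>v \<theta>\<close>, then \<open>v / (v \<theta>)\<close> inverts \<theta>. The subcases
  with zero come from \<open>inverse 0 = 0\<close>.\<close>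

lemma D_valuation: assumes "\<theta> \<notin> D" shows "inverse \<theta> \<in> D"
proof -
  obtain u v where uv: "u + v * \<theta> = 1" "u \<in> D" "u * \<theta> \<in> D" "v \<in> D" "v * \<theta> \<in> D"
    using theta_split[of \<theta>] by metis
  from local_D[OF uv(2)] show ?thesis
  proof
    assume i: "inverse u \<in> D"
    show ?thesis
    proof (cases "u = 0")
      case True
      then have "v = inverse \<theta>" using uv(1) by (metis add_0 inverse_unique mult.commute)
      then show ?thesis using uv by simp
    next
      case False
      then have "\<theta> = (u * \<theta>) * inverse u" by simp
      then show ?thesis using assms D_mult[OF uv(3) i] by metis
    qed
  next
    assume i: "inverse (1 - u) \<in> D"
    have u1: "1 - u = v * \<theta>" using uv(1) by (simp add: algebra_simps)
    show ?thesis
    proof (cases "v * \<theta> = 0")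
      case True
      then have "u = 1" using uv(1) by (metis add.right_neutral)
      then show ?thesis using uv assms by simp
    next
      case False
      then have "inverse \<theta> = v * inverse (v * \<theta>)" by simp
      then show ?thesis using D_mult[OF uv(4) i] unfolding u1 by metis
    qed
  qed
qed

text \<open>The maximal ideal of \<open>D\<close>. Zero is listed separately because
  \<open>inverse 0 = 0\<close> belongs to \<open>D\<close>.\<close>

definition nD where "nD = {y \<in> D. y = 0 \<or> inverse y \<notin> D}"

lemma nD_D: "y \<in> nD \<Longrightarrow> y \<in> D" unfolding nD_def by simp

lemma nD_mult: assumes "d \<in> D" "y \<in> nD" shows "d * y \<in> nD"
proof (rule ccontr)
  assume c: "d * y \<notin> nD"
  have "d * y \<in> D" using assms D_mult nD_D by blast
  then have i: "d * y \<noteq> 0" "inverse (d * y) \<in> D" using c unfolding nD_def by auto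
  then have "inverse y = d * inverse (d * y)" by simp
  then have "inverse y \<in> D" using D_mult[OF assms(1) i(2)] by metis
  then show False using assms i(1) unfolding nD_def by auto
qed

lemma nD_add: assumes y: "y \<in> nD" and z: "z \<in> nD" shows "y + z \<in> nD"
proof (rule ccontr)
  assume c: "y + z \<notin> nD"
  have "y + z \<in> D" using assms D_add nD_D by blast
  then have i: "y + z \<noteq> 0" "inverse (y + z) \<in> D" using c unfolding nD_def by auto
  define a where "a = y * inverse (y + z)"
  have a: "a \<in> D" unfolding a_def using D_mult nD_D y i by blast
  have a1: "1 - a = z * inverse (y + z)"
    unfolding a_def using i(1) by (metis add_diff_cancel_left' distrib_right right_inverse)
  have an: "a \<in> nD" "1 - a \<in> nD"
    using nD_mult[OF i(2) y] nD_mult[OF i(2) z] unfolding a1 unfolding a_def by (simp_all add: mult.commute)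
  from local_D[OF a] show False
  proof
    assume "inverse a \<in> D"
    then have "a = 0" using an unfolding nD_def by auto
    then show False using an D_R[OF R_simps(2)] unfolding nD_def by simp
  next
    assume "inverse (1 - a) \<in> D"
    then have "a = 1" using an unfolding nD_def by auto
    then show False using an D_R[OF R_simps(2)] unfolding nD_def by simp
  qed
qed

lemma one_nD: "1 \<notin> nD" unfolding nD_def using D_R[OF R_simps(2)] by simp

lemma unit_D: "y \<in> D \<Longrightarrow> y \<notin> nD \<Longrightarrow> inverse y \<in> D \<and> y \<noteq> 0" unfolding nD_def by auto

lemma nD_minus: "y \<in> nD \<Longrightarrow> - y \<in> nD"
  using nD_mult[of "- 1" y] D_minus[OF D_R[OF R_simps(2)]] by simp

lemma m_nD: assumes "y \<in> m" shows "y \<in> nD"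
  using D_unit_R[OF m_R[OF assms]] unit_in_m[OF assms] D_R[OF m_R[OF assms]] unfolding nD_def by auto

lemma nD_R: assumes "r \<in> R" "r \<in> nD" shows "r \<in> m"
  using assms m_unit D_R zero_m unfolding nD_def by auto

text \<open>Otherwise \<open>z = inverse e\<close> is a non-unit of \<open>D\<close>, and its
  equation multiplied by \<open>e e\<close> reads \<open>1 = e e a + b e\<close> with
  \<open>a \<in> m\<close>: either \<open>1 \<in> m\<close>, or \<open>b\<close> is a unit and
  \<open>e \<in> R\<close>.\<close>

lemma Eend_m: assumes e: "\<And>y. y \<in> m \<Longrightarrow> e * y \<in> m" shows "e \<in> D"
proof (rule ccontr)
  assume c: "e \<notin> D"
  define z where "z = inverse e"
  have z: "z \<in> D" unfolding z_def using D_valuation[OF c] .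
  have e0: "e \<noteq> 0" using c D_R[OF R_simps(1)] by auto
  have zn: "z \<in> nD" using z c unfolding nD_def z_def by simp
  obtain a b where ab: "a \<in> R" "b \<in> R" "z * z = a + b * z" using z by (rule D_E)
  have "a = (z - b) * z" using ab by (simp add: algebra_simps)
  also have "\<dots> \<in> nD" by (intro nD_mult zn D_diff z D_R ab)
  finally have am: "a \<in> m" using nD_R ab by blast
  have ez: "e * z = 1" unfolding z_def using e0 by simp
  have "e * e * (z * z) = e * e * a + b * e * (e * z)" unfolding ab(3) by (simp add: algebra_simps)
  moreover have "e * e * (z * z) = (e * z) * (e * z)" by (simp add: algebra_simps)
  ultimately have 1: "1 = e * (e * a) + b * e" unfolding ez by (simp add: mult.assoc)
  have ea: "e * (e * a) \<in> m" using e am by blast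
  show False
  proof (cases "b \<in> m")
    case True
    have "e * (e * a) + e * b \<in> m" by (intro m_add ea e True)
    then show False using 1 one_m by (simp add: mult.commute)
  next
    case False
    then have b: "inverse b \<in> R" "b \<noteq> 0" using m_unit ab zero_m by auto
    have "b * e = 1 - e * (e * a)" using 1 by (metis add_diff_cancel_left')
    then have "e = inverse b * (1 - e * (e * a))" using b(2) by (metis left_inverse mult.assoc mult_1)
    also have "\<dots> \<in> R" by (intro R_simps b m_R ea)
    finally show False using c D_R by blast
  qed
qed

text \<open>An element of least value in \<open>m\<close>. Stability of \<open>m\<close> gives
  products \<open>x l\<close> in \<open>E(m) \<subseteq> D\<close> with sum \<open>1\<close>; one of
  them is a unit of \<open>D\<close>, and \<open>y / x = (y l) / (x l)\<close>.\<close>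

lemma m_bound:
  obtains x where "x \<in> m" "x \<noteq> 0" "\<And>y. y \<in> m \<Longrightarrow> y * inverse x \<in> D"
proof -
  define L where "L = colon (Eend m) m"
  obtain w where w: "w \<in> m" "w \<noteq> 0" using m_nz by blast
  have sm: "submodule R m" unfolding submodule_def using zero_m m_add m_mult by auto
  have st: "1 \<in> setprod m L" unfolding L_def
    by (rule stableD[OF sm w, of 1]) (auto intro: m_R)
  have LD: "x * l \<in> D" if "x \<in> m" "l \<in> L" for x l
  proof (rule Eend_m)
    fix y assume "y \<in> m"
    then have "l * x * y \<in> m" using that unfolding L_def mem_colon_Eend by blast
    then show "x * l * y \<in> m" by (simp add: mult_ac)
  qed
  have "\<exists>x\<in>m. \<exists>l\<in>L. x * l \<notin> nD"
  proof (rule ccontr)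
    assume c: "\<not> ?thesis"
    from st have "1 \<in> nD"
    proof (induction rule: setprod_induct)
      case zero
      show ?case using m_nD zero_m by blast
    qed (use nD_add c in blast)+
    then show False using one_nD by simp
  qed
  then obtain x l where xl: "x \<in> m" "l \<in> L" "x * l \<notin> nD" by blast
  have u: "inverse (x * l) \<in> D" "x * l \<noteq> 0" using unit_D[OF LD[OF xl(1,2)] xl(3)] by auto
  show thesis
  proof (rule that[of x])
    show "x \<in> m" "x \<noteq> 0" using xl u by auto
    fix y assume "y \<in> m"
    then have "(y * l) * inverse (x * l) \<in> D" using LD xl u D_mult by blast
    moreover have "(y * l) * inverse (x * l) = y * inverse x" using u(2) by (simp add: field_simps)
    ultimately show "y * inverse x \<in> D" by metis
  qed
qed

text \<open>Twice a positive value is at least the value of \<open>x\<close>. In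
  \<open>y (y - b) = a\<close> one has \<open>a \<in> m\<close>; if \<open>b\<close> is a unit, so
  is \<open>y - b\<close>, and \<open>y\<close> itself is divisible by \<open>x\<close>.\<close>

lemma nD_square:
  assumes x: "x \<in> m" "x \<noteq> 0" "\<And>y. y \<in> m \<Longrightarrow> y * inverse x \<in> D" and y: "y \<in> nD"
  shows "y * y * inverse x \<in> D"
proof -
  obtain a b where ab: "a \<in> R" "b \<in> R" "y * y = a + b * y" using nD_D[OF y] by (rule D_E)
  have yD: "y \<in> D" using nD_D y .
  have ya: "y * (y - b) = a" using ab by (simp add: algebra_simps)
  have "(y - b) * y \<in> nD" by (intro nD_mult y D_diff yD D_R ab)
  then have am: "a \<in> m" using nD_R ab ya by (simp add: mult.commute)
  show ?thesis
  proof (cases "b \<in> m")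
    case True
    have "y * y * inverse x = a * inverse x + (b * inverse x) * y" unfolding ab(3) by (simp add: algebra_simps)
    also have "\<dots> \<in> D" by (intro D_add D_mult x(3) am True yD)
    finally show ?thesis .
  next
    case False
    have "y - b \<notin> nD"
    proof
      assume "y - b \<in> nD"
      then have "y + - (y - b) \<in> nD" by (intro nD_add y nD_minus)
      then show False using nD_R[OF ab(2)] False by simp
    qed
    then have u: "inverse (y - b) \<in> D" "y - b \<noteq> 0" using unit_D[of "y - b"] D_diff[OF yD D_R[OF ab(2)]] by auto
    have "y = a * inverse (y - b)" using ya u(2) by (metis mult.assoc mult.right_neutral right_inverse)
    then have "y * y * inverse x = y * ((a * inverse x) * inverse (y - b))" by (metis mult.assoc mult.commute)
    also have "\<dots> \<in> D" by (intro D_mult yD x(3) am u)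
    finally show ?thesis .
  qed
qed

lemma D_root: assumes "w * w \<in> D" shows "w \<in> D"
proof (rule ccontr)
  assume c: "w \<notin> D"
  then have i: "inverse w \<in> D" by (rule D_valuation)
  have w0: "w \<noteq> 0" using c D_R[OF R_simps(1)] by auto
  have n: "inverse w \<in> nD" unfolding nD_def using i c by simp
  have "(w * w) * (inverse w * inverse w) \<in> nD" by (intro nD_mult assms i n)
  moreover have "(w * w) * (inverse w * inverse w) = 1" using w0 by (simp add: field_simps)
  ultimately show False using one_nD by simp
qed

text \<open>Without a least value, every nonzero \<open>c \<in> I\<close> is a multiple
  \<open>s c'\<close> of some \<open>c' \<in> I\<close> with \<open>s \<in> nD\<close>. By
  \<open>nD_square\<close> two such steps gain a factor \<open>x\<close>, so the elements of
  \<open>I\<close> are divisible by all powers of \<open>x\<close>: the situation of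
  \<open>deep_valuation\<close>.\<close>

lemma minimal_or_fractional:
  assumes I: "submodule R I" "I \<subseteq> D" "i \<in> I" "i \<noteq> 0"
    and nc: "\<not> (\<exists>c\<in>I. c \<noteq> 0 \<and> (\<forall>y\<in>I. y * inverse c \<in> D))"
  shows "\<exists>d. d \<noteq> 0 \<and> (\<forall>y\<in>D. d * y \<in> R)"
proof -
  obtain x where x: "x \<in> m" "x \<noteq> 0" "\<And>y. y \<in> m \<Longrightarrow> y * inverse x \<in> D" by (rule m_bound) blast
  have one: "\<exists>c'\<in>I. c' \<noteq> 0 \<and> c * inverse c' \<in> nD" if c: "c \<in> I" "c \<noteq> 0" for c
  proof -
    obtain c' where c': "c' \<in> I" "c' * inverse c \<notin> D" using nc c by blast
    then have "c' \<noteq> 0" using D_R[OF R_simps(1)] by auto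
    moreover have "inverse (c' * inverse c) = c * inverse c'" by (simp add: mult.commute)
    then have "c * inverse c' \<in> D" "inverse (c * inverse c') \<notin> D"
      using D_valuation[OF c'(2)] c'(2) by (auto simp: mult.commute)
    ultimately show ?thesis using c' unfolding nD_def by blast
  qed
  have two: "\<exists>c'\<in>I. c' \<noteq> 0 \<and> c * inverse c' * inverse x \<in> D" if c: "c \<in> I" "c \<noteq> 0" for c
  proof -
    obtain c1 where c1: "c1 \<in> I" "c1 \<noteq> 0" "c * inverse c1 \<in> nD" using one[OF c] by blast
    obtain c2 where c2: "c2 \<in> I" "c2 \<noteq> 0" "c1 * inverse c2 \<in> nD" using one[OF c1(1,2)] by blast
    define s t where "s = c * inverse c1" and "t = c1 * inverse c2"
    have st: "s * s * inverse x \<in> D" "t * t * inverse x \<in> D"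
      using nD_square[OF x] c1 c2 unfolding s_def t_def by auto
    have e: "s * t = c * inverse c2" unfolding s_def t_def using c1(2) by (simp add: field_simps)
    have "(s * t * inverse x) * (s * t * inverse x) = (s * s * inverse x) * (t * t * inverse x)"
      by (simp add: mult_ac)
    also have "\<dots> \<in> D" using st D_mult by blast
    finally have "s * t * inverse x \<in> D" by (rule D_root)
    then show ?thesis using c2 e by auto
  qed
  have many: "\<exists>c'\<in>I. c' \<noteq> 0 \<and> c * inverse c' * inverse (x ^ k) \<in> D" if c: "c \<in> I" "c \<noteq> 0" for c k
  proof (induction k)
    case 0
    show ?case using c D_R[OF R_simps(2)] by (intro bexI[of _ c]) auto
  next
    case (Suc k)
    then obtain c1 where c1: "c1 \<in> I" "c1 \<noteq> 0" "c * inverse c1 * inverse (x ^ k) \<in> D" by blast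
    obtain c2 where c2: "c2 \<in> I" "c2 \<noteq> 0" "c1 * inverse c2 * inverse x \<in> D" using two[OF c1(1,2)] by blast
    have "c * inverse c2 * inverse (x ^ Suc k) = (c * inverse c1 * inverse (x ^ k)) * (c1 * inverse c2 * inverse x)"
      using c1(2) by (simp add: field_simps)
    then show ?case using c2(1,2) D_mult[OF c1(3) c2(3)] by metis
  qed
  have deep: "c * inverse (x ^ k) \<in> D" if c: "c \<in> I" for c k
  proof (cases "c = 0")
    case True
    then show ?thesis using D_R[OF R_simps(1)] by simp
  next
    case False
    obtain c' where c': "c' \<in> I" "c' \<noteq> 0" "c * inverse c' * inverse (x ^ k) \<in> D" using many[OF c False] by blast
    have "c * inverse (x ^ k) = c' * (c * inverse c' * inverse (x ^ k))" using c'(2) by (simp add: field_simps)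
    then show ?thesis using D_mult[OF _ c'(3), of c'] c'(1) I(2) by (metis subsetD)
  qed
  obtain a b where ab: "a \<in> R" "b \<in> R" "i * i = a + b * i" using I(2,3) D_E[of i] by blast
  have iD: "i \<in> D" using I by auto
  \<comment> \<open>A nonzero multiple of \<open>i\<close> inside \<open>R\<close>: up to sign the
    norm \<open>a = (i - b) i\<close>, or, if that vanishes, \<open>i = b\<close> itself.\<close>
  define y where "y = (if a = 0 then i else a)"
  have y: "y \<in> R" "y \<noteq> 0"
  proof -
    have "i = b" if "a = 0" using ab(3) I(4) that by simp
    then show "y \<in> R" "y \<noteq> 0" unfolding y_def using ab I(4) by auto
  qed
  have "y * inverse (x ^ k) \<in> D" for k
  proof (cases "a = 0")
    case True
    then show ?thesis unfolding y_def using deep I by simp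
  next
    case False
    have "a = (i - b) * i" using ab(3) by (simp add: algebra_simps)
    then have "a * inverse (x ^ k) = (i - b) * (i * inverse (x ^ k))" by (simp add: mult.assoc)
    also have "\<dots> \<in> D" by (intro D_mult D_diff iD D_R ab deep I)
    finally show ?thesis unfolding y_def using False by simp
  qed
  then interpret deep_valuation R m x y
    by unfold_locales (use x y D_valuation in auto)
  show ?thesis using D_fractional y by (intro exI[of _ "y * y"]) auto
qed

end

section \<open>Ideals of overrings of a local stable domain\<close>

text \<open>\<open>J\<close> is left a mere set, since only a common denominator and the products
  with \<open>E(I)\<close> matter later. It is \<open>I \<inter> D\<close> if \<open>D\<close> is
  fractional, and otherwise a single element of least value in \<open>I \<inter> D\<close>.\<close>

theorem fractional_generation:
  assumes T: "subring T" "R \<subseteq> T" and I: "submodule T I" "I \<subseteq> T" "I \<noteq> {0}"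
  shows "\<exists>J d. J \<subseteq> I \<and> d \<noteq> 0 \<and> (\<forall>x\<in>J. d * x \<in> R) \<and> I \<subseteq> setprod J (Eend I)"
proof -
  define I0 where "I0 = I \<inter> D"
  have TI: "t * i \<in> I" if "t \<in> T" "i \<in> I" for t i using I that unfolding submodule_def by blast
  have Iadd: "i + j \<in> I" if "i \<in> I" "j \<in> I" for i j using I that unfolding submodule_def by blast
  have TE: "t \<in> Eend I" if "t \<in> T" for t unfolding Eend_def colon_def using TI that by blast
  \<comment> \<open>\<open>theta_split\<close> at \<open>x\<close> itself: \<open>u\<close> and
    \<open>v\<close> lie in \<open>R + R x \<subseteq> T\<close>, so \<open>u x\<close> and
    \<open>v x\<close> stay in the ideal.\<close>
  have split: "\<exists>u v. u * x \<in> I0 \<and> v * x \<in> I0 \<and> x = u * x + v * x * x" if x: "x \<in> I" for x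
  proof -
    obtain u v where uv: "u + v * x = 1" "u * x \<in> D" "v * x \<in> D"
      "\<exists>p\<in>R. \<exists>q\<in>R. u = p + q * x" "\<exists>p\<in>R. \<exists>q\<in>R. v = p + q * x"
      using theta_split[of x] by metis
    have "p + q * x \<in> T" if "p \<in> R" "q \<in> R" for p q
      using T x I(2) that unfolding subring_def by (meson subsetD)
    then have "u \<in> T" "v \<in> T" using uv(4,5) by auto
    then have "u * x \<in> I0" "v * x \<in> I0" using TI x uv unfolding I0_def by auto
    moreover have "x = u * x + v * x * x" using uv(1) by (metis distrib_right mult_1)
    ultimately show ?thesis by blast
  qed
  obtain i where i: "i \<in> I" "i \<noteq> 0" using I unfolding submodule_def by blast
  have I0: "submodule R I0"
    unfolding submodule_def I0_def using I(1) T(2) D_add D_mult D_R R_simps(1) unfolding submodule_def by blast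
  obtain i0 where i0: "i0 \<in> I0" "i0 \<noteq> 0"
    using split[OF i(1)] i(2) by (metis add_0 mult_zero_left)
  have caseD: ?thesis if d: "d \<noteq> 0" "\<And>y. y \<in> D \<Longrightarrow> d * y \<in> R" for d
  proof (intro exI[of _ I0] exI[of _ d] conjI ballI)
    show "I0 \<subseteq> I" unfolding I0_def by simp
    show "d \<noteq> 0" by fact
    show "d * x \<in> R" if "x \<in> I0" for x using that d unfolding I0_def by simp
    show "I \<subseteq> setprod I0 (Eend I)"
    proof
      fix x assume x: "x \<in> I"
      obtain u v where uv: "u * x \<in> I0" "v * x \<in> I0" "x = u * x + v * x * x" using split[OF x] by blast
      have "(u * x) * 1 + (v * x) * x \<in> setprod I0 (Eend I)"
        using x I(2) T(1) TE uv unfolding subring_def by (intro setprod_add setprod_prod) auto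
      then show "x \<in> setprod I0 (Eend I)" using uv(3) by simp
    qed
  qed
  show ?thesis
  proof (cases "\<exists>d. d \<noteq> 0 \<and> (\<forall>y\<in>D. d * y \<in> R)")
    case True
    then show ?thesis using caseD by blast
  next
    case False
    then have loc: "\<And>\<eta>. \<eta> \<in> D \<Longrightarrow> inverse \<eta> \<in> D \<or> inverse (1 - \<eta>) \<in> D"
      using valuation_or_fractional by blast
    have "I0 \<subseteq> D" unfolding I0_def by simp
    then obtain c where c: "c \<in> I0" "c \<noteq> 0" "\<forall>y\<in>I0. y * inverse c \<in> D"
      using minimal_or_fractional[OF loc I0 _ i0] False by blast
    \<comment> \<open>\<open>(I \<inter> D) / c\<close> lies between \<open>R\<close> and
      \<open>D\<close> because \<open>c\<close> has least value. So it is a ring; it acts on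
      \<open>I \<inter> D\<close>, and through \<open>split\<close> on \<open>I\<close>.\<close>
    define S where "S = {z. c * z \<in> I0}"
    have S: "submodule R S"
      using I0 unfolding S_def submodule_def by (auto simp: distrib_left mult.left_commute)
    have SD: "S \<subseteq> D"
    proof
      fix z assume "z \<in> S"
      then have "c * z * inverse c \<in> D" using c(3) unfolding S_def by blast
      moreover have "c * z * inverse c = z" using c(2) by simp
      ultimately show "z \<in> D" by simp
    qed
    have S1: "1 \<in> S" unfolding S_def using c by simp
    have divS: "\<exists>z\<in>S. y = c * z" if "y \<in> I0" for y
    proof -
      have "c * (inverse c * y) = y" using c(2) by (simp add: mult.assoc[symmetric])
      then show ?thesis using that unfolding S_def by (metis mem_Collect_eq)
    qed
    have SE: "s \<in> Eend I" if s: "s \<in> S" for s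
      unfolding Eend_def colon_def
    proof (intro CollectI ballI)
      have sI0: "s * y \<in> I" if y: "y \<in> I0" for y
      proof -
        obtain z where z: "z \<in> S" "y = c * z" using divS[OF y] by blast
        have "s * z \<in> S" using ring_in_D[OF S S1 SD s z(1)] .
        then have "c * (s * z) \<in> I" unfolding S_def I0_def by simp
        then show ?thesis unfolding z by (simp add: mult_ac)
      qed
      fix x assume x: "x \<in> I"
      obtain u v where uv: "u * x \<in> I0" "v * x \<in> I0" "x = u * x + v * x * x" using split[OF x] by blast
      have "s * (u * x) + x * (s * (v * x)) \<in> I"
        using x I(2) by (intro Iadd sI0 uv TI) auto
      moreover have "s * x = s * (u * x) + x * (s * (v * x))"
        by (subst uv(3)) (simp add: algebra_simps)
      ultimately show "s * x \<in> I" by simp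
    qed
    obtain d where d: "d \<in> R" "d \<noteq> 0" "d * c \<in> R" using denom by blast
    show ?thesis
    proof (intro exI[of _ "{c}"] exI[of _ d] conjI ballI)
      show "{c} \<subseteq> I" using c unfolding I0_def by simp
      show "d * x \<in> R" if "x \<in> {c}" for x using d that by auto
      show "d \<noteq> 0" by fact
      show "I \<subseteq> setprod {c} (Eend I)"
      proof
        fix x assume x: "x \<in> I"
        obtain u v where uv: "u * x \<in> I0" "v * x \<in> I0" "x = u * x + v * x * x" using split[OF x] by blast
        obtain z1 z2 where z: "z1 \<in> S" "z2 \<in> S" "u * x = c * z1" "v * x = c * z2"
          using divS uv by metis
        have "z2 * x \<in> Eend I"
          using SE[OF z(2)] TE[of x] x I(2) unfolding Eend_def colon_def by (auto simp: mult.assoc)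
        then have "c * z1 + c * (z2 * x) \<in> setprod {c} (Eend I)"
          using SE[OF z(1)] by (intro setprod_add setprod_prod) auto
        moreover have "x = c * z1 + c * (z2 * x)"
          by (subst uv(3)) (simp add: z mult.assoc)
        ultimately show "x \<in> setprod {c} (Eend I)" by simp
      qed
    qed
  qed
qed

end

subsection \<open>Maximal \<open>t\<close>-ideals and the \<open>w\<close>-operation\<close>

lemma fgen_eq_setprod: "fgen R F = setprod R F"
  unfolding fgen_def setprod_def ..

lemma setprod_submodule: "subring R \<Longrightarrow> submodule R (setprod R F)"
  unfolding submodule_def subring_def
  by (auto intro: setprod_add setprod_scale)

lemma setprod_least: "submodule R I \<Longrightarrow> F \<subseteq> I \<Longrightarrow> setprod R F \<subseteq> I"
proof
  fix z assume I: "submodule R I" "F \<subseteq> I" and "z \<in> setprod R F"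
  from this(3) show "z \<in> I"
    by (induction rule: setprod_induct) (use I in \<open>auto simp: submodule_def\<close>)
qed

lemma setprod_superset: "subring R \<Longrightarrow> F \<subseteq> setprod R F"
  using setprod_prod[of 1 R _ F] unfolding subring_def by auto

lemma colon_antimono: "A \<subseteq> B \<Longrightarrow> colon R B \<subseteq> colon R A"
  unfolding colon_def by auto

text \<open>For \<open>A i \<subseteq> R\<close> this is
  \<open>(d^2 R : A_0^2 ... A_{n-1}^2)\<close> inside \<open>R\<close>; stage \<open>Suc n\<close>
  brings in \<open>A n\<close>. The start is \<open>d^2 R\<close> because the \<open>A i\<close>
  used later contain \<open>d\<close>, so that \<open>d^2 (R : A^2)\<close> lies in
  \<open>R\<close>.\<close>

primrec colon_chain :: "'a::field set \<Rightarrow> 'a \<Rightarrow> (nat \<Rightarrow> 'a set) \<Rightarrow> nat \<Rightarrow> 'a set" where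
  "colon_chain R d A 0 = {d * d * r | r. r \<in> R}"
| "colon_chain R d A (Suc n) = {y \<in> R. \<forall>a\<in>A n. \<forall>b\<in>A n. y * a * b \<in> colon_chain R d A n}"

section \<open>The \<open>t\<close>-operation\<close>

locale quotient_domain =
  fixes R :: "'a::field set"
  assumes subring_R: "subring R" and quot: "has_quotient_field_UNIV R"
begin

lemma R_simps: "0 \<in> R" "1 \<in> R" "x \<in> R \<Longrightarrow> y \<in> R \<Longrightarrow> x + y \<in> R"
  "x \<in> R \<Longrightarrow> y \<in> R \<Longrightarrow> x - y \<in> R" "x \<in> R \<Longrightarrow> y \<in> R \<Longrightarrow> x * y \<in> R"
  using subring_R unfolding subring_def by auto

lemma submodule_R: "submodule R R"
  unfolding submodule_def using R_simps by auto

lemma colon_setprod: "colon R (setprod R F) = colon R F"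
proof
  show "colon R (setprod R F) \<subseteq> colon R F"
    by (rule colon_antimono[OF setprod_superset[OF subring_R]])
  show "colon R F \<subseteq> colon R (setprod R F)"
  proof
    fix x assume x: "x \<in> colon R F"
    have "x * z \<in> R" if "z \<in> setprod R F" for z
      using that
    proof (induction rule: setprod_induct)
      case zero
      show ?case using R_simps(1) by simp
    next
      case (add y z)
      then show ?case using R_simps(3) by (simp add: distrib_left)
    next
      case (prod a b)
      then have "a * (x * b) \<in> R" using x R_simps(5) unfolding colon_def by blast
      then show ?case by (simp add: mult_ac)
    qed
    then show "x \<in> colon R (setprod R F)" unfolding colon_def by simp
  qed
qed

lemma t_op_iff:
  assumes "submodule R I"
  shows "x \<in> t_op R I \<longleftrightarrow> (\<exists>F. finite F \<and> F \<subseteq> I \<and> (\<exists>f\<in>F. f \<noteq> 0) \<and> x \<in> colon R (colon R F))"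
proof -
  have nz: "setprod R F \<noteq> {0} \<longleftrightarrow> (\<exists>f\<in>F. f \<noteq> 0)" for F
    using setprod_superset[OF subring_R, of F] setprod_least[of R "{0}" F]
    by (auto simp: submodule_def subset_eq)
  have sub: "setprod R F \<subseteq> I \<longleftrightarrow> F \<subseteq> I" for F
    using setprod_superset[OF subring_R, of F] setprod_least[OF assms, of F] by blast
  show ?thesis
    unfolding t_op_def v_op_def fgen_eq_setprod
  proof
    assume "x \<in> \<Union> {colon R (colon R J) |J. \<exists>F. finite F \<and> J = setprod R F \<and> J \<noteq> {0} \<and> J \<subseteq> I}"
    then obtain F where "finite F" "setprod R F \<noteq> {0}" "setprod R F \<subseteq> I" "x \<in> colon R (colon R (setprod R F))"
      by blast
    then show "\<exists>F. finite F \<and> F \<subseteq> I \<and> (\<exists>f\<in>F. f \<noteq> 0) \<and> x \<in> colon R (colon R F)"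
      unfolding nz sub colon_setprod by blast
  next
    assume "\<exists>F. finite F \<and> F \<subseteq> I \<and> (\<exists>f\<in>F. f \<noteq> 0) \<and> x \<in> colon R (colon R F)"
    then obtain F where "finite F" "setprod R F \<noteq> {0}" "setprod R F \<subseteq> I" "x \<in> colon R (colon R (setprod R F))"
      unfolding nz sub colon_setprod by blast
    then show "x \<in> \<Union> {colon R (colon R J) |J. \<exists>F. finite F \<and> J = setprod R F \<and> J \<noteq> {0} \<and> J \<subseteq> I}"
      by blast
  qed
qed

lemma nonzero_idealD:
  assumes "nonzero_ideal R I"
  shows "submodule R I" "I \<subseteq> R" "\<exists>i\<in>I. i \<noteq> 0"
  using assms unfolding nonzero_ideal_def nonzero_submodule_def submodule_def by auto

lemma nonzero_idealI: "submodule R I \<Longrightarrow> I \<subseteq> R \<Longrightarrow> i \<in> I \<Longrightarrow> i \<noteq> 0 \<Longrightarrow> nonzero_ideal R I"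
  unfolding nonzero_ideal_def nonzero_submodule_def by auto

lemma t_op_superset:
  assumes "nonzero_ideal R I" shows "I \<subseteq> t_op R I"
proof
  fix x assume x: "x \<in> I"
  obtain i where "i \<in> I" "i \<noteq> 0" using nonzero_idealD[OF assms] by blast
  \<comment> \<open>The element \<open>i\<close> keeps the finite set nonzero when
    \<open>x = 0\<close>.\<close>
  moreover have "x \<in> colon R (colon R {x, i})" unfolding colon_def by (auto simp: mult.commute)
  ultimately show "x \<in> t_op R I"
    using x unfolding t_op_iff[OF nonzero_idealD(1)[OF assms]] by (intro exI[of _ "{x, i}"]) auto
qed

lemma t_op_ideal:
  assumes "nonzero_ideal R I" shows "nonzero_ideal R (t_op R I)"
proof -
  note I = nonzero_idealD[OF assms]
  note iff = t_op_iff[OF I(1)]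
  have "submodule R (t_op R I)"
    unfolding submodule_def
  proof (intro conjI ballI)
    show "0 \<in> t_op R I" using t_op_superset[OF assms] I(1) unfolding submodule_def by blast
  next
    fix x y assume "x \<in> t_op R I" "y \<in> t_op R I"
    then obtain F G where F: "finite F" "F \<subseteq> I" "\<exists>f\<in>F. f \<noteq> 0" "x \<in> colon R (colon R F)"
      and G: "finite G" "G \<subseteq> I" "y \<in> colon R (colon R G)" unfolding iff by blast
    have "x \<in> colon R (colon R (F \<union> G))" "y \<in> colon R (colon R (F \<union> G))"
      using F(4) G(3) colon_antimono[OF colon_antimono, of _ "F \<union> G"] by blast+
    then have "x + y \<in> colon R (colon R (F \<union> G))"
      unfolding colon_def[of R "colon R _"] using R_simps(3) by (auto simp: distrib_right)
    then show "x + y \<in> t_op R I" unfolding iff using F G by (intro exI[of _ "F \<union> G"]) auto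
  next
    fix r x assume r: "r \<in> R" and "x \<in> t_op R I"
    then obtain F where F: "finite F" "F \<subseteq> I" "\<exists>f\<in>F. f \<noteq> 0" "x \<in> colon R (colon R F)"
      unfolding iff by blast
    then have "r * x \<in> colon R (colon R F)"
      unfolding colon_def[of R "colon R _"] using R_simps(5)[OF r] by (auto simp: mult.assoc)
    then show "r * x \<in> t_op R I" unfolding iff using F by blast
  qed
  moreover have "t_op R I \<subseteq> R"
  proof
    fix x assume "x \<in> t_op R I"
    then obtain F where F: "F \<subseteq> I" "x \<in> colon R (colon R F)" unfolding iff by blast
    have "1 \<in> colon R F" unfolding colon_def using F I(2) by auto
    then show "x \<in> R" using F(2) unfolding colon_def[of R "colon R F"] by force
  qed
  ultimately show ?thesis using I(3) t_op_superset[OF assms] nonzero_idealI by blast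
qed

lemma t_op_idem:
  assumes "nonzero_ideal R I" shows "t_op R (t_op R I) = t_op R I"
proof
  note I = nonzero_idealD[OF assms] and It = nonzero_idealD[OF t_op_ideal[OF assms]]
  show "t_op R I \<subseteq> t_op R (t_op R I)" by (rule t_op_superset[OF t_op_ideal[OF assms]])
  show "t_op R (t_op R I) \<subseteq> t_op R I"
  proof
    fix x assume "x \<in> t_op R (t_op R I)"
    then obtain F where F: "finite F" "F \<subseteq> t_op R I" "\<exists>f\<in>F. f \<noteq> 0" "x \<in> colon R (colon R F)"
      unfolding t_op_iff[OF It(1)] by blast
    have "\<forall>f\<in>F. \<exists>G. finite G \<and> G \<subseteq> I \<and> (\<exists>g\<in>G. g \<noteq> 0) \<and> f \<in> colon R (colon R G)"
      using F(2) unfolding t_op_iff[OF I(1)] subset_eq[of F] mem_Collect_eq by (simp add: t_op_iff[OF I(1)] subset_eq)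
    then obtain G where G: "\<And>f. f \<in> F \<Longrightarrow> finite (G f) \<and> G f \<subseteq> I \<and> (\<exists>g\<in>G f. g \<noteq> 0) \<and> f \<in> colon R (colon R (G f))"
      by metis
    define U where "U = \<Union> (G ` F)"
    have "f \<in> colon R (colon R U)" if "f \<in> F" for f
      using G[OF that] colon_antimono[OF colon_antimono, of "G f" U R R] that unfolding U_def by blast
    then have fy: "f * y \<in> R" if "f \<in> F" "y \<in> colon R U" for f y
      using that unfolding colon_def[of R "colon R U"] by blast
    have "y * f \<in> R" if "f \<in> F" "y \<in> colon R U" for f y
      using fy[OF that] by (simp add: mult.commute)
    then have "colon R U \<subseteq> colon R F" unfolding colon_def[of R F] by blast
    then have "x \<in> colon R (colon R U)" using F(4) colon_antimono by blast
    moreover have "finite U" "U \<subseteq> I" using F(1) G unfolding U_def by auto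
    moreover have "\<exists>u\<in>U. u \<noteq> 0" using F(3) G unfolding U_def by blast
    ultimately show "x \<in> t_op R I" unfolding t_op_iff[OF I(1)] by blast
  qed
qed

text \<open>Zorn's lemma applies because \<open>1 \<in> t_op R N\<close> involves only finitely many
  elements of \<open>N\<close>. A maximal \<open>M\<close> is a \<open>t\<close>-ideal since its
  \<open>t\<close>-closure competes with it.\<close>

lemma tMax_superset:
  assumes I: "nonzero_ideal R I" and 1: "1 \<notin> t_op R I"
  shows "\<exists>M\<in>tMax R. I \<subseteq> M"
proof -
  let ?A = "{N. nonzero_ideal R N \<and> I \<subseteq> N \<and> 1 \<notin> t_op R N}"
  have "\<exists>M\<in>?A. \<forall>X\<in>?A. M \<subseteq> X \<longrightarrow> X = M"
  proof (rule subset_Zorn_nonempty)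
    show "?A \<noteq> {}" using I 1 by blast
    fix C assume C: "C \<noteq> {}" "subset.chain ?A C"
    then have CA: "\<And>N. N \<in> C \<Longrightarrow> nonzero_ideal R N \<and> I \<subseteq> N \<and> 1 \<notin> t_op R N"
      unfolding subset.chain_def by blast
    have lin: "N \<subseteq> N' \<or> N' \<subseteq> N" if "N \<in> C" "N' \<in> C" for N N'
      using C(2) that unfolding subset_chain_def by blast
    have sub: "submodule R (\<Union>C)" unfolding submodule_def
    proof (intro conjI ballI)
      show "0 \<in> \<Union>C" using C(1) CA nonzero_idealD(1) unfolding submodule_def by blast
    next
      fix x y assume "x \<in> \<Union>C" "y \<in> \<Union>C"
      then obtain N N' where N: "N \<in> C" "x \<in> N" "N' \<in> C" "y \<in> N'" by blast
      then obtain N'' where "N'' \<in> C" "x \<in> N''" "y \<in> N''" using lin by blast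
      then show "x + y \<in> \<Union>C" using CA nonzero_idealD(1) unfolding submodule_def by blast
    next
      fix r x assume "r \<in> R" "x \<in> \<Union>C"
      then show "r * x \<in> \<Union>C" using CA nonzero_idealD(1) unfolding submodule_def by blast
    qed
    have "nonzero_ideal R (\<Union>C)"
    proof -
      obtain N where N: "N \<in> C" using C(1) by blast
      then obtain i where "i \<in> N" "i \<noteq> 0" using CA nonzero_idealD(3) by blast
      moreover have "\<Union>C \<subseteq> R" using CA nonzero_idealD(2) by blast
      ultimately show ?thesis using nonzero_idealI[OF sub] N by blast
    qed
    moreover have "I \<subseteq> \<Union>C" using C(1) CA by blast
    moreover have "1 \<notin> t_op R (\<Union>C)"
    proof
      assume "1 \<in> t_op R (\<Union>C)"
      then obtain F where F: "finite F" "F \<subseteq> \<Union>C" "\<exists>f\<in>F. f \<noteq> 0" "1 \<in> colon R (colon R F)"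
        unfolding t_op_iff[OF sub] by blast
      obtain N where "N \<in> C" "F \<subseteq> N" using finite_subset_Union_chain[OF F(1,2) C] by blast
      then have "1 \<in> t_op R N" unfolding t_op_iff[OF nonzero_idealD(1)[OF conjunct1[OF CA[OF \<open>N \<in> C\<close>]]]] using F by blast
      then show False using CA \<open>N \<in> C\<close> by blast
    qed
    ultimately show "\<Union>C \<in> ?A" by blast
  qed
  then obtain M where M: "nonzero_ideal R M" "I \<subseteq> M" "1 \<notin> t_op R M"
    and max: "\<And>X. nonzero_ideal R X \<Longrightarrow> I \<subseteq> X \<Longrightarrow> 1 \<notin> t_op R X \<Longrightarrow> M \<subseteq> X \<Longrightarrow> X = M" by auto
  have "t_op R M = M"
    using max[OF t_op_ideal[OF M(1)]] t_op_superset[OF M(1)] M t_op_idem[OF M(1)] by auto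
  then have tM: "t_ideal R M" "M \<noteq> R" using M R_simps(2) unfolding t_ideal_def by auto
  have "N = M" if "t_ideal R N" "N \<noteq> R" "M \<subseteq> N" for N
  proof (rule max)
    have N: "nonzero_ideal R N" "t_op R N = N" using that unfolding t_ideal_def by auto
    then show "nonzero_ideal R N" by simp
    have "1 \<notin> N"
    proof
      assume "1 \<in> N"
      then have "R \<subseteq> N" using nonzero_idealD(1)[OF N(1)] unfolding submodule_def by force
      then show False using nonzero_idealD(2)[OF N(1)] that(2) by blast
    qed
    then show "1 \<notin> t_op R N" using N by simp
  qed (use that M in auto)
  then have "M \<in> tMax R" using tM unfolding tMax_def by blast
  then show ?thesis using M by blast
qed

lemma tMaxD:
  assumes "M \<in> tMax R"
  shows "nonzero_ideal R M" "submodule R M" "M \<subseteq> R" "t_op R M = M" "1 \<notin> M" "R \<noteq> UNIV"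
proof -
  show M: "nonzero_ideal R M" "t_op R M = M" using assms unfolding tMax_def t_ideal_def by auto
  show s: "submodule R M" "M \<subseteq> R" using nonzero_idealD[OF M(1)] by auto
  have "M \<noteq> R" using assms unfolding tMax_def by simp
  show 1: "1 \<notin> M"
  proof
    assume "1 \<in> M"
    then have "R \<subseteq> M" using s unfolding submodule_def by force
    then show False using s \<open>M \<noteq> R\<close> by blast
  qed
  obtain i where i: "i \<in> M" "i \<noteq> 0" using nonzero_idealD(3)[OF M(1)] by blast
  show "R \<noteq> UNIV"
  proof
    assume "R = UNIV"
    then have "inverse i * i \<in> M" using i s unfolding submodule_def by blast
    then show False using 1 i by simp
  qed
qed

lemma tMax_eq: "M \<in> tMax R \<Longrightarrow> N \<in> tMax R \<Longrightarrow> M \<subseteq> N \<Longrightarrow> N = M"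
  unfolding tMax_def by blast

section \<open>The \<open>w\<close>-operation through finite sets\<close>

text \<open>Finite generating sets of Glaz-Vasconcelos ideals, the finitely generated
  \<open>J\<close> with \<open>(R : J) = R\<close>. Sets of generators, unlike ideals, can be
  carried unchanged to an overring.\<close>

definition dense :: "'a set \<Rightarrow> bool" where
  "dense F \<longleftrightarrow> finite F \<and> F \<subseteq> R \<and> colon R F \<subseteq> R"

lemma dense_not_tMax:
  assumes "dense F" "M \<in> tMax R" obtains f where "f \<in> F" "f \<notin> M" "f \<in> R"
proof -
  have "\<not> F \<subseteq> M"
  proof
    assume FM: "F \<subseteq> M"
    have "\<exists>f\<in>F. f \<noteq> 0"
    proof (rule ccontr)
      assume "\<not> ?thesis"
      then have "colon R F = UNIV" unfolding colon_def using R_simps(1) by auto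
      then show False using assms tMaxD(6)[OF assms(2)] unfolding dense_def by auto
    qed
    moreover have "1 \<in> colon R (colon R F)" using assms(1) unfolding dense_def colon_def by auto
    ultimately have "1 \<in> t_op R M" unfolding t_op_iff[OF tMaxD(2)[OF assms(2)]]
      using FM assms(1) unfolding dense_def by blast
    then show False using tMaxD(4,5)[OF assms(2)] by simp
  qed
  then show thesis using that assms(1) unfolding dense_def by blast
qed

lemma dense_exists:
  assumes I: "nonzero_ideal R I" and M: "\<And>M. M \<in> tMax R \<Longrightarrow> \<not> I \<subseteq> M"
  obtains F where "dense F" "F \<subseteq> I" "\<exists>f\<in>F. f \<noteq> 0"
proof -
  have "1 \<in> t_op R I" using tMax_superset[OF I] M by blast
  then obtain F where F: "finite F" "F \<subseteq> I" "\<exists>f\<in>F. f \<noteq> 0" "1 \<in> colon R (colon R F)"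
    unfolding t_op_iff[OF nonzero_idealD(1)[OF I]] by blast
  have "colon R F \<subseteq> R" using F(4) unfolding colon_def by auto
  then show thesis using that F nonzero_idealD(2)[OF I] unfolding dense_def by blast
qed

lemma ideal_plus_principal:
  assumes M: "nonzero_ideal R M" and a: "a \<in> R"
  shows "nonzero_ideal R {g + a * r | g r. g \<in> M \<and> r \<in> R}" "M \<subseteq> {g + a * r | g r. g \<in> M \<and> r \<in> R}"
    "a \<in> {g + a * r | g r. g \<in> M \<and> r \<in> R}"
proof -
  let ?N = "{g + a * r | g r. g \<in> M \<and> r \<in> R}"
  note Mi = nonzero_idealD[OF M]
  have M0: "0 \<in> M" using Mi unfolding submodule_def by blast
  show s: "M \<subseteq> ?N"
  proof
    fix g assume "g \<in> M"
    moreover have "g = g + a * 0" by simp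
    ultimately show "g \<in> ?N" using R_simps(1) by blast
  qed
  have "a = 0 + a * 1" by simp
  then show "a \<in> ?N" using R_simps(2) M0 by blast
  have "submodule R ?N" unfolding submodule_def
  proof (intro conjI ballI)
    show "0 \<in> ?N" using s M0 by blast
  next
    fix x y assume "x \<in> ?N" "y \<in> ?N"
    then obtain g r g' r' where h: "g \<in> M" "r \<in> R" "g' \<in> M" "r' \<in> R" "x = g + a * r" "y = g' + a * r'" by blast
    have "x + y = (g + g') + a * (r + r')" unfolding h by (simp add: algebra_simps)
    moreover have "g + g' \<in> M" "r + r' \<in> R" using h R_simps(3) Mi unfolding submodule_def by auto
    ultimately show "x + y \<in> ?N" by blast
  next
    fix c x assume c: "c \<in> R" and "x \<in> ?N"
    then obtain g r where h: "g \<in> M" "r \<in> R" "x = g + a * r" by blast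
    have "c * x = (c * g) + a * (c * r)" unfolding h by (simp add: algebra_simps)
    moreover have "c * g \<in> M" "c * r \<in> R" using h c R_simps(5) Mi unfolding submodule_def by auto
    ultimately show "c * x \<in> ?N" by blast
  qed
  moreover have "?N \<subseteq> R" using Mi(2) R_simps(3,5) a by auto
  ultimately show "nonzero_ideal R ?N" using Mi(3) s nonzero_idealI by blast
qed

text \<open>\<open>M + a R\<close> lies in no maximal \<open>t\<close>-ideal, so it contains a dense
  \<open>F\<close>. Then \<open>b F \<subseteq> M\<close>, and \<open>b\<close> lies in the
  \<open>v\<close>-closure of \<open>b F\<close>, hence in the \<open>t\<close>-closure of
  \<open>M\<close>.\<close>

lemma tMax_prime:
  assumes M: "M \<in> tMax R" and ab: "a \<in> R" "b \<in> R" "a * b \<in> M" "a \<notin> M"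
  shows "b \<in> M"
proof (cases "b = 0")
  case True
  then show ?thesis using tMaxD(2)[OF M] unfolding submodule_def by auto
next
  case False
  let ?N = "{g + a * r | g r. g \<in> M \<and> r \<in> R}"
  note N = ideal_plus_principal[OF tMaxD(1)[OF M] ab(1)]
  have "\<not> ?N \<subseteq> M'" if "M' \<in> tMax R" for M'
    using tMax_eq[OF M that] N(2,3) ab(4) by blast
  then obtain F where F: "dense F" "F \<subseteq> ?N" "\<exists>f\<in>F. f \<noteq> 0" using dense_exists[OF N(1)] by blast
  have "b \<in> t_op R M" unfolding t_op_iff[OF tMaxD(2)[OF M]]
  proof (intro exI[of _ "(*) b ` F"] conjI)
    show "finite ((*) b ` F)" using F unfolding dense_def by simp
    show "\<exists>f\<in>(*) b ` F. f \<noteq> 0" using F(3) False by auto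
    show "(*) b ` F \<subseteq> M"
    proof
      fix x assume "x \<in> (*) b ` F"
      then obtain g r where h: "g \<in> M" "r \<in> R" "x = b * (g + a * r)" using F(2) by blast
      have "x = b * g + r * (a * b)" unfolding h by (simp add: algebra_simps)
      then show "x \<in> M" using h ab tMaxD(2)[OF M] unfolding submodule_def by auto
    qed
    show "b \<in> colon R (colon R ((*) b ` F))" unfolding colon_def[of R "colon R _"]
    proof (intro CollectI ballI)
      fix y assume "y \<in> colon R ((*) b ` F)"
      then have "b * y \<in> colon R F" unfolding colon_def by (auto simp: mult_ac)
      then show "b * y \<in> R" using F(1) unfolding dense_def by blast
    qed
  qed
  then show ?thesis using tMaxD(4)[OF M] by simp
qed

lemma setprod_loc:
  assumes M: "M \<in> tMax R" and E: "submodule R E"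
  shows "setprod E (loc R M) = {e / s | e s. e \<in> E \<and> s \<in> R \<and> s \<notin> M}"
proof (intro equalityI subsetI)
  fix x assume "x \<in> setprod E (loc R M)"
  then show "x \<in> {e / s | e s. e \<in> E \<and> s \<in> R \<and> s \<notin> M}"
  proof (induction rule: setprod_induct)
    case zero
    have "(0::'a) = 0 / 1" "0 \<in> E" using E unfolding submodule_def by auto
    then show ?case using R_simps(2) tMaxD(5)[OF M] by blast
  next
    case (add x y)
    then obtain e s e' s' where h: "e \<in> E" "s \<in> R" "s \<notin> M" "x = e / s" "e' \<in> E" "s' \<in> R" "s' \<notin> M" "y = e' / s'" by blast
    have "0 \<in> M" using tMaxD(2)[OF M] unfolding submodule_def by blast
    then have "s \<noteq> 0" "s' \<noteq> 0" using h by auto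
    then have "x + y = (s' * e + s * e') / (s * s')" unfolding h by (simp add: field_simps)
    moreover have "s' * e + s * e' \<in> E" using h E unfolding submodule_def by auto
    moreover have "s * s' \<in> R" "s * s' \<notin> M" using R_simps(5)[OF h(2,6)] tMax_prime[OF M h(2,6)] h(3,7) by auto
    ultimately show ?case by blast
  next
    case (prod e y)
    then obtain a s where h: "a \<in> R" "s \<in> R" "s \<notin> M" "y = a / s" unfolding loc_def by blast
    have "e * y = (a * e) / s" "a * e \<in> E" using h prod E unfolding submodule_def by auto
    then show ?case using h by blast
  qed
next
  fix x assume "x \<in> {e / s | e s. e \<in> E \<and> s \<in> R \<and> s \<notin> M}"
  then obtain e s where h: "e \<in> E" "s \<in> R" "s \<notin> M" "x = e * (1 / s)" by auto
  then have "1 / s \<in> loc R M" unfolding loc_def using R_simps(2) by blast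
  then show "x \<in> setprod E (loc R M)" unfolding h(4) using h(1) setprod_prod by blast
qed

text \<open>The \<open>r \<in> R\<close> with \<open>r x \<in> E\<close> form an ideal, nonzero
  because \<open>E\<close> contains a nonzero element of \<open>R\<close>. If \<open>x\<close> is in
  every localization of \<open>E\<close>, this ideal is in no maximal \<open>t\<close>-ideal and
  contains a dense set.\<close>

lemma w_op_iff:
  assumes E: "submodule R E" "E \<noteq> {0}"
  shows "x \<in> w_op R E \<longleftrightarrow> (\<exists>F. dense F \<and> (\<forall>f\<in>F. f * x \<in> E))"
proof
  assume x: "x \<in> w_op R E"
  let ?b = "{r \<in> R. r * x \<in> E}"
  have sub: "submodule R ?b"
    using E R_simps unfolding submodule_def by (auto simp: distrib_right mult.assoc)
  obtain e where e: "e \<in> E" "e \<noteq> 0" using E unfolding submodule_def by auto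
  obtain a b where ab: "a \<in> R" "b \<in> R" "b \<noteq> 0" "x = a / b" using quot unfolding has_quotient_field_UNIV_def by blast
  obtain c d where cd: "c \<in> R" "d \<in> R" "d \<noteq> 0" "e = c / d" using quot unfolding has_quotient_field_UNIV_def by blast
  have c: "c \<in> E" "c \<noteq> 0"
  proof -
    have "c = d * e" using cd by simp
    then show "c \<in> E" using cd e E unfolding submodule_def by blast
    show "c \<noteq> 0" using e cd by auto
  qed
  have "a * c \<in> E" using ab(1) c(1) E(1) unfolding submodule_def by blast
  moreover have "(b * c) * x = a * c" using ab by simp
  ultimately have "(b * c) * x \<in> E" by metis
  then have "b * c \<in> ?b" "b * c \<noteq> 0" using ab cd c R_simps(5) by auto
  then have b: "nonzero_ideal R ?b" using nonzero_idealI[OF sub] by blast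
  have "\<not> ?b \<subseteq> M" if M: "M \<in> tMax R" for M
  proof -
    have "x \<in> setprod E (loc R M)" using x M unfolding w_op_def by blast
    then obtain e s where h: "e \<in> E" "s \<in> R" "s \<notin> M" "x = e / s" unfolding setprod_loc[OF M E(1)] by blast
    have "s \<noteq> 0" using h tMaxD(2)[OF M] unfolding submodule_def by auto
    then have "s \<in> ?b" using h by simp
    then show ?thesis using h by blast
  qed
  then obtain F where "dense F" "F \<subseteq> ?b" using dense_exists[OF b] by blast
  then show "\<exists>F. dense F \<and> (\<forall>f\<in>F. f * x \<in> E)" by blast
next
  assume "\<exists>F. dense F \<and> (\<forall>f\<in>F. f * x \<in> E)"
  then obtain F where F: "dense F" "\<And>f. f \<in> F \<Longrightarrow> f * x \<in> E" by blast
  have "x \<in> setprod E (loc R M)" if M: "M \<in> tMax R" for M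
  proof -
    obtain f where f: "f \<in> F" "f \<notin> M" "f \<in> R" using dense_not_tMax[OF F(1) M] .
    have "f \<noteq> 0" using f tMaxD(2)[OF M] unfolding submodule_def by auto
    then have "x = (f * x) / f" by simp
    then show ?thesis unfolding setprod_loc[OF M E(1)] using F(2)[OF f(1)] f by blast
  qed
  then show "x \<in> w_op R E" unfolding w_op_def by blast
qed

lemma dense_colon: "dense F \<Longrightarrow> (\<And>f. f \<in> F \<Longrightarrow> f * x \<in> R) \<Longrightarrow> x \<in> R"
  unfolding dense_def colon_def by (simp add: mult.commute subset_iff)

lemma dense_one: "dense {1}"
  unfolding dense_def colon_def using R_simps(2) by auto

lemma w_op_superset:
  assumes "submodule R E" "E \<noteq> {0}" shows "E \<subseteq> w_op R E"
proof
  fix x assume "x \<in> E"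
  then show "x \<in> w_op R E" unfolding w_op_iff[OF assms] using dense_one by (intro exI[of _ "{1}"]) auto
qed

lemma w_idealI:
  assumes I: "nonzero_ideal R I" and w: "\<And>F x. dense F \<Longrightarrow> x \<in> R \<Longrightarrow> (\<And>f. f \<in> F \<Longrightarrow> f * x \<in> I) \<Longrightarrow> x \<in> I"
  shows "w_ideal R I"
proof -
  note Ii = nonzero_idealD[OF I]
  have n: "I \<noteq> {0}" using Ii by auto
  have "w_op R I \<subseteq> I"
  proof
    fix x assume "x \<in> w_op R I"
    then obtain F where F: "dense F" "\<forall>f\<in>F. f * x \<in> I" unfolding w_op_iff[OF Ii(1) n] by blast
    moreover have "x \<in> R" using dense_colon[OF F(1)] F(2) Ii(2) by blast
    ultimately show "x \<in> I" using w by blast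
  qed
  then show ?thesis using w_op_superset[OF Ii(1) n] I unfolding w_ideal_def by blast
qed

section \<open>Localization at a maximal \<open>t\<close>-ideal\<close>

lemma zero_tMax: "M \<in> tMax R \<Longrightarrow> 0 \<in> M"
  using tMaxD(2) unfolding submodule_def by blast

lemma tMax_mult:
  assumes "M \<in> tMax R" "s \<in> R" "s \<notin> M" "t \<in> R" "t \<notin> M"
  shows "s * t \<in> R" "s * t \<notin> M"
  using assms R_simps(5) tMax_prime by blast+

lemma locI: "a \<in> R \<Longrightarrow> s \<in> R \<Longrightarrow> s \<notin> M \<Longrightarrow> a / s \<in> loc R M"
  unfolding loc_def by blast

lemma loc_inverse: "s \<in> R \<Longrightarrow> s \<notin> M \<Longrightarrow> inverse s \<in> loc R M"
  using locI[of 1 s M] R_simps(2) by (simp add: divide_inverse)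

lemma R_loc: "M \<in> tMax R \<Longrightarrow> r \<in> R \<Longrightarrow> r \<in> loc R M"
  using locI[of r 1 M] R_simps(2) tMaxD(5) by simp

lemma subring_loc:
  assumes M: "M \<in> tMax R" shows "subring (loc R M)"
proof -
  have "x + y \<in> loc R M \<and> x - y \<in> loc R M \<and> x * y \<in> loc R M" if "x \<in> loc R M" "y \<in> loc R M" for x y
  proof -
    obtain a s b t where h: "a \<in> R" "s \<in> R" "s \<notin> M" "x = a / s" "b \<in> R" "t \<in> R" "t \<notin> M" "y = b / t"
      using \<open>x \<in> loc R M\<close> \<open>y \<in> loc R M\<close> unfolding loc_def by blast
    have st: "s * t \<in> R" "s * t \<notin> M" using tMax_mult[OF M h(2,3,6,7)] .
    have "s \<noteq> 0" "t \<noteq> 0" using h zero_tMax[OF M] by auto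
    then have "x + y = (a * t + b * s) / (s * t)" "x - y = (a * t - b * s) / (s * t)" "x * y = (a * b) / (s * t)"
      unfolding h by (simp_all add: field_simps)
    then show ?thesis using locI[OF _ st] R_simps(3-5) h(1,2,5,6) by simp
  qed
  then show ?thesis unfolding subring_def using R_loc[OF M] R_simps(1,2) by blast
qed

lemma loc_mult: "M \<in> tMax R \<Longrightarrow> x \<in> loc R M \<Longrightarrow> y \<in> loc R M \<Longrightarrow> x * y \<in> loc R M"
  and loc_add: "M \<in> tMax R \<Longrightarrow> x \<in> loc R M \<Longrightarrow> y \<in> loc R M \<Longrightarrow> x + y \<in> loc R M"
  using subring_loc[of M] unfolding subring_def by blast+

lemma setprod_loc_scale:
  assumes M: "M \<in> tMax R" and z: "z \<in> setprod E (loc R M)" and r: "r \<in> loc R M"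
  shows "r * z \<in> setprod E (loc R M)"
  using z
proof (induction rule: setprod_induct)
  case (prod a b)
  have "a * (r * b) \<in> setprod E (loc R M)" using prod setprod_prod loc_mult[OF M r] by blast
  then show ?case by (simp add: mult_ac)
qed (auto simp: distrib_left intro: setprod_add)

lemma setprod_loc_superset:
  assumes M: "M \<in> tMax R" shows "E \<subseteq> setprod E (loc R M)"
proof
  fix e assume "e \<in> E"
  then have "e * 1 \<in> setprod E (loc R M)" using R_loc[OF M R_simps(2)] setprod_prod by blast
  then show "e \<in> setprod E (loc R M)" by simp
qed

text \<open>The form in which stability is used: \<open>1\<close> is in the product only up to
  closure, but a member of \<open>F\<close> becomes a unit at each \<open>M\<close>.\<close>

lemma w_stable_dense:
  assumes w: "w_stable R" and I: "w_ideal R I"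
  obtains F where "dense F" "F \<subseteq> setprod I (colon (Eend I) I)"
proof -
  let ?X = "setprod I (colon (Eend I) I)"
  have Ii: "nonzero_ideal R I" using I unfolding w_ideal_def by blast
  note Id = nonzero_idealD[OF Ii]
  have sub: "submodule R ?X"
    unfolding submodule_def
    using Id(1) by (auto intro!: setprod_add setprod_scale simp: submodule_def)
  obtain i where i: "i \<in> I" "i \<noteq> 0" using Id(3) by blast
  have RI: "a * b \<in> I" if "a \<in> R" "b \<in> I" for a b using Id(1) that unfolding submodule_def by blast
  have "i \<in> colon (Eend I) I" unfolding mem_colon_Eend
  proof (intro ballI)
    fix x y assume "x \<in> I" "y \<in> I"
    then show "i * x * y \<in> I" using RI[of "i * x" y] R_simps(5)[of i x] i(1) Id(2) by blast
  qed
  then have "i * i \<in> ?X" using i setprod_prod by blast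
  moreover have "i * i \<noteq> 0" using i by simp
  ultimately have nz: "?X \<noteq> {0}" by blast
  have "w_op R ?X = Eend I" using w I unfolding w_stable_def by blast
  moreover have "1 \<in> Eend I" unfolding Eend_def colon_def by simp
  ultimately have "1 \<in> w_op R ?X" by (rule ssubst)
  then obtain F where "dense F" "\<forall>f\<in>F. f * 1 \<in> ?X" unfolding w_op_iff[OF sub nz] by blast
  then show thesis using that[of F] by (simp add: subset_eq)
qed

text \<open>A fractional ideal \<aa> of the localization, scaled by \<open>d\<close>, contracts to
  the \<open>w\<close>-ideal \<open>J = R \<inter> d \<aa>\<close>. Some element of
  \<open>J (J : J^2)\<close> is outside \<open>M\<close>, hence a unit, and
  \<open>d (J : J^2) \<subseteq> (\<aa> : \<aa>^2)\<close>.\<close>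

lemma local_stable_loc:
  assumes w: "w_stable R" and M: "M \<in> tMax R"
  shows "local_stable (loc R M) (setprod M (loc R M))"
proof
  note Ms = setprod_loc[OF M tMaxD(2)[OF M]]
  show "subring (loc R M)" by (rule subring_loc[OF M])
  show "has_quotient_field_UNIV (loc R M)"
    using quot R_loc[OF M] unfolding has_quotient_field_UNIV_def by blast
  show "setprod M (loc R M) \<subseteq> loc R M" unfolding Ms using tMaxD(3)[OF M] locI by blast
  show "x + y \<in> setprod M (loc R M)" if "x \<in> setprod M (loc R M)" "y \<in> setprod M (loc R M)" for x y
    using that setprod_add by blast
  show "r * x \<in> setprod M (loc R M)" if "r \<in> loc R M" "x \<in> setprod M (loc R M)" for r x
    using that setprod_loc_scale[OF M] by blast
  show "inverse x \<in> loc R M" if "x \<in> loc R M" "x \<notin> setprod M (loc R M)" for x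
  proof -
    obtain a s where h: "a \<in> R" "s \<in> R" "s \<notin> M" "x = a / s" using \<open>x \<in> loc R M\<close> unfolding loc_def by blast
    then have "a \<notin> M" using that(2) unfolding Ms by blast
    then have "s / a \<in> loc R M" using h locI by blast
    then show ?thesis using h by simp
  qed
  show "1 \<notin> setprod M (loc R M)"
  proof
    assume "1 \<in> setprod M (loc R M)"
    then obtain a s where h: "a \<in> M" "s \<in> R" "s \<notin> M" "1 = a / s" unfolding Ms by blast
    then show False using zero_tMax[OF M] by (metis divide_eq_1_iff)
  qed
  show "\<exists>x\<in>setprod M (loc R M). x \<noteq> 0"
    using nonzero_idealD(3)[OF tMaxD(1)[OF M]] setprod_loc_superset[OF M] by blast
  show "stable (loc R M)" unfolding stable_def
  proof (intro allI impI)
    fix \<aa> assume "fractional (loc R M) \<aa>"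
    then obtain d0 where \<aa>: "submodule (loc R M) \<aa>" "\<aa> \<noteq> {0}" and d0: "d0 \<noteq> 0" "\<And>x. x \<in> \<aa> \<Longrightarrow> d0 * x \<in> loc R M"
      unfolding fractional_def nonzero_submodule_def by blast
    have a_mult: "r * x \<in> \<aa>" if "r \<in> loc R M" "x \<in> \<aa>" for r x using \<aa> that unfolding submodule_def by blast
    obtain d1 d where d1: "d \<in> R" "d1 \<in> R" "d1 \<noteq> 0" "d0 = d / d1" using quot unfolding has_quotient_field_UNIV_def by blast
    have d: "d \<noteq> 0" using d0 d1 by auto
    have da: "d * x \<in> loc R M" if "x \<in> \<aa>" for x
    proof -
      have "d1 * (d0 * x) \<in> loc R M" by (intro loc_mult[OF M] R_loc[OF M] d1 d0 that)
      then show ?thesis using d1 by simp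
    qed
    define J where "J = {r \<in> R. r * inverse d \<in> \<aa>}"
    have to_J: "\<exists>s\<in>R. s \<notin> M \<and> s * (d * x) \<in> J" if x: "x \<in> \<aa>" for x
    proof -
      obtain a s where h: "a \<in> R" "s \<in> R" "s \<notin> M" "d * x = a / s" using da[OF x] unfolding loc_def by blast
      have "s \<noteq> 0" using h zero_tMax[OF M] by auto
      then have "s * (d * x) = a" using h by simp
      moreover have "s * (d * x) * inverse d = s * x" using d by (simp add: field_simps)
      moreover have "s * x \<in> \<aa>" using a_mult R_loc[OF M] h x by blast
      ultimately have "s * (d * x) \<in> J" unfolding J_def using h(1) by simp
      then show ?thesis using h by blast
    qed
    have Jsub: "submodule R J" unfolding J_def submodule_def
      using \<aa>(1) R_simps R_loc[OF M] by (auto simp: submodule_def distrib_right mult.assoc)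
    obtain x0 where x0: "x0 \<in> \<aa>" "x0 \<noteq> 0" using \<aa> unfolding submodule_def by auto
    obtain s0 where "s0 \<in> R" "s0 \<notin> M" "s0 * (d * x0) \<in> J" using to_J[OF x0(1)] by blast
    moreover have "s0 * (d * x0) \<noteq> 0" using calculation x0 d zero_tMax[OF M] by auto
    moreover have "J \<subseteq> R" unfolding J_def by simp
    ultimately have Jn: "nonzero_ideal R J" using nonzero_idealI[OF Jsub] by blast
    have Jw: "w_ideal R J"
    proof (rule w_idealI[OF Jn])
      fix F x assume F: "dense F" and x: "x \<in> R" and fx: "\<And>f. f \<in> F \<Longrightarrow> f * x \<in> J"
      obtain f where f: "f \<in> F" "f \<notin> M" "f \<in> R" using dense_not_tMax[OF F M] .
      have "f \<noteq> 0" using f zero_tMax[OF M] by auto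
      have "inverse f * (f * x * inverse d) \<in> \<aa>"
        using a_mult[OF loc_inverse[OF f(3,2)]] fx[OF f(1)] unfolding J_def by blast
      moreover have "inverse f * (f * x * inverse d) = x * inverse d" using \<open>f \<noteq> 0\<close> by (simp add: field_simps)
      ultimately have "x * inverse d \<in> \<aa>" by metis
      then show "x \<in> J" unfolding J_def using x by simp
    qed
    obtain F where F: "dense F" "F \<subseteq> setprod J (colon (Eend J) J)" using w_stable_dense[OF w Jw] .
    obtain f where f: "f \<in> F" "f \<notin> M" "f \<in> R" using dense_not_tMax[OF F(1) M] .
    have f0: "f \<noteq> 0" using f zero_tMax[OF M] by auto
    have dl: "d * l \<in> colon (Eend \<aa>) \<aa>" if l: "l \<in> colon (Eend J) J" for l
      unfolding mem_colon_Eend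
    proof (intro ballI)
      fix x y assume xy: "x \<in> \<aa>" "y \<in> \<aa>"
      obtain s where s: "s \<in> R" "s \<notin> M" "s * (d * x) \<in> J" using to_J[OF xy(1)] by blast
      obtain t where t: "t \<in> R" "t \<notin> M" "t * (d * y) \<in> J" using to_J[OF xy(2)] by blast
      have nz: "s \<noteq> 0" "t \<noteq> 0" using s t zero_tMax[OF M] by auto
      have "l * (s * (d * x)) * (t * (d * y)) \<in> J" using l s t unfolding mem_colon_Eend by blast
      then have "l * (s * (d * x)) * (t * (d * y)) * inverse d \<in> \<aa>" unfolding J_def by simp
      then have "(inverse s * inverse t) * (l * (s * (d * x)) * (t * (d * y)) * inverse d) \<in> \<aa>"
        by (rule a_mult[rotated]) (intro loc_mult[OF M] loc_inverse s t)
      moreover have "(inverse s * inverse t) * (l * (s * (d * x)) * (t * (d * y)) * inverse d) = d * l * x * y"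
        using nz d by (simp add: field_simps)
      ultimately show "d * l * x * y \<in> \<aa>" by metis
    qed
    have "f \<in> setprod J (colon (Eend J) J)" using F f by blast
    then have "f \<in> setprod \<aa> (colon (Eend \<aa>) \<aa>)"
    proof (induction rule: setprod_induct)
      case (prod j l)
      have "(j * inverse d) * (d * l) \<in> setprod \<aa> (colon (Eend \<aa>) \<aa>)"
        using prod dl setprod_prod unfolding J_def by blast
      moreover have "(j * inverse d) * (d * l) = j * l" using d by (simp add: field_simps)
      ultimately show ?case by metis
    qed (auto intro: setprod_add)
    then have "inverse f * f \<in> setprod \<aa> (colon (Eend \<aa>) \<aa>)"
      by (rule setprod_scale) (intro a_mult loc_inverse f)
    then show "1 \<in> setprod \<aa> (colon (Eend \<aa>) \<aa>)" using f0 by simp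
  qed
qed

section \<open>Separating infinitely many maximal \<open>t\<close>-ideals\<close>

text \<open>For \<open>x \<in> M\<close> outside \<open>M'\<close>, a dense subset of
  \<open>M' + x R\<close> shows that no maximal \<open>t\<close>-ideal contains both
  \<open>x\<close> and certain finitely many elements of \<open>M'\<close>. So each member of
  \<open>X\<close> misses one of the two finite sets, and one of them is missed infinitely often.
  Adding one element for each \<open>K \<in> P\<close> takes care of \<open>P\<close>.\<close>

lemma tMax_separate:
  assumes P: "finite P" "P \<subseteq> tMax R" and X: "X \<subseteq> tMax R" "infinite X" "X \<inter> P = {}"
  shows "\<exists>F M X'. finite F \<and> M \<in> X \<and> F \<subseteq> M \<and> X' \<subseteq> X \<and> infinite X' \<and> (\<forall>K\<in>X'. \<not> F \<subseteq> K) \<and> (\<forall>K\<in>P. \<not> F \<subseteq> K)"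
proof -
  obtain M where M: "M \<in> X" using X(2) by (metis finite.emptyI ex_in_conv)
  have "infinite (X - {M})" using X(2) by simp
  then obtain M' where "M' \<in> X - {M}" by (metis finite.emptyI ex_in_conv)
  then have M': "M' \<in> X" "M' \<noteq> M" by auto
  have MX: "M \<in> tMax R" "M' \<in> tMax R" using M M' X by auto
  have diff: "\<exists>x\<in>A. x \<notin> B" if "A \<in> tMax R" "B \<in> tMax R" "A \<noteq> B" for A B
    using tMax_eq[OF that(1,2)] that(3) by blast
  obtain x where x: "x \<in> M" "x \<notin> M'" using diff[OF MX] M' by blast
  have xR: "x \<in> R" using x tMaxD(3)[OF MX(1)] by blast
  let ?N = "{g + x * r | g r. g \<in> M' \<and> r \<in> R}"
  note N = ideal_plus_principal[OF tMaxD(1)[OF MX(2)] xR]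
  have "\<not> ?N \<subseteq> K" if "K \<in> tMax R" for K
    using tMax_eq[OF MX(2) that] N(2,3) x(2) by blast
  then obtain F0 where F0: "dense F0" "F0 \<subseteq> ?N" using dense_exists[OF N(1)] by blast
  have "\<forall>f\<in>F0. \<exists>g. g \<in> M' \<and> (\<exists>r\<in>R. f = g + x * r)" using F0(2) by blast
  then obtain g where g: "\<And>f. f \<in> F0 \<Longrightarrow> g f \<in> M' \<and> (\<exists>r\<in>R. f = g f + x * r)" by metis
  have "\<forall>K\<in>P. \<exists>y. y \<in> M \<and> y \<notin> K" using diff[OF MX(1)] P(2) M X(3) by blast
  then obtain p where p: "\<And>K. K \<in> P \<Longrightarrow> p K \<in> M \<and> p K \<notin> K" by metis
  have "\<forall>K\<in>P. \<exists>y. y \<in> M' \<and> y \<notin> K" using diff[OF MX(2)] P(2) M' X(3) by blast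
  then obtain q where q: "\<And>K. K \<in> P \<Longrightarrow> q K \<in> M' \<and> q K \<notin> K" by metis
  define F where "F = insert x (p ` P)"
  define G where "G = g ` F0 \<union> q ` P"
  have fin: "finite F" "finite G" using P(1) F0(1) unfolding F_def G_def dense_def by auto
  have sub: "F \<subseteq> M" "G \<subseteq> M'" using x p q g unfolding F_def G_def by auto
  have sep: "\<not> F \<subseteq> K" "\<not> G \<subseteq> K" if "K \<in> P" for K using p[OF that] q[OF that] that unfolding F_def G_def by blast+
  have no_both: "\<not> (F \<subseteq> K \<and> G \<subseteq> K)" if K: "K \<in> tMax R" for K
  proof
    assume c: "F \<subseteq> K \<and> G \<subseteq> K"
    obtain f where f: "f \<in> F0" "f \<notin> K" using dense_not_tMax[OF F0(1) K] .
    obtain r where r: "r \<in> R" "f = g f + x * r" using g[OF f(1)] by blast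
    have "g f \<in> K" "x \<in> K" using c f(1) unfolding F_def G_def by auto
    then have "g f + r * x \<in> K" using r tMaxD(2)[OF K] unfolding submodule_def by blast
    then show False using f r by (simp add: mult.commute)
  qed
  have "X = {K \<in> X. \<not> F \<subseteq> K} \<union> {K \<in> X. \<not> G \<subseteq> K}" using no_both X(1) by blast
  then consider "infinite {K \<in> X. \<not> F \<subseteq> K}" | "infinite {K \<in> X. \<not> G \<subseteq> K}" using X(2) by (metis finite_UnI)
  then show ?thesis
  proof cases
    case 1
    show ?thesis by (intro exI[of _ F] exI[of _ M] exI[of _ "{K \<in> X. \<not> F \<subseteq> K}"]) (use 1 fin sub sep M in auto)
  next
    case 2
    show ?thesis by (intro exI[of _ G] exI[of _ M'] exI[of _ "{K \<in> X. \<not> G \<subseteq> K}"]) (use 2 fin sub sep M' in auto)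
  qed
qed

text \<open>A state keeps an infinite reserve \<open>X\<close> of ideals not containing
  \<open>F\<close>, and the list \<open>P\<close> of earlier choices. Later ideals are taken from
  the reserve, which handles \<open>i < j\<close>; earlier ones are in \<open>P\<close>, which
  handles \<open>j < i\<close>.\<close>

lemma tMax_sequence:
  assumes X0: "X0 \<subseteq> tMax R" "infinite X0"
  obtains F M :: "nat \<Rightarrow> 'a set" where "\<And>i. finite (F i)" "\<And>i. F i \<subseteq> M i" "\<And>i. M i \<in> X0" "\<And>i j. i \<noteq> j \<Longrightarrow> \<not> F i \<subseteq> M j"
proof -
  define Pr where "Pr = (\<lambda>(n::nat) (F, M, X, P). finite F \<and> F \<subseteq> M \<and> M \<in> X0 \<and> X \<subseteq> X0 \<and> infinite X \<and> (\<forall>K\<in>X. \<not> F \<subseteq> K)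
     \<and> finite P \<and> P \<subseteq> X0 \<and> X \<inter> P = {} \<and> (\<forall>K\<in>P. \<not> F \<subseteq> (K::'a set)))"
  define Q where "Q = (\<lambda>(n::nat) (F::'a set, M, X, P) (F'::'a set, M'::'a set, X', P'). M' \<in> X \<and> X' \<subseteq> X \<and> P' = insert (M::'a set) P)"
  have "\<exists>f. \<forall>n. Pr n (f n) \<and> Q n (f n) (f (Suc n))"
  proof (rule dependent_nat_choice)
    obtain F M X' where "finite F" "M \<in> X0" "F \<subseteq> M" "X' \<subseteq> X0" "infinite X'" "\<forall>K\<in>X'. \<not> F \<subseteq> K"
      using tMax_separate[of "{}" X0] X0 by auto
    then have "Pr 0 (F, M, X', {})" unfolding Pr_def by auto
    then show "\<exists>x. Pr 0 x" by blast
  next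
    fix st n assume "Pr n st"
    obtain F M X P where st: "st = (F, M, X, P)" by (cases st) auto
    have h: "finite F" "F \<subseteq> M" "M \<in> X0" "X \<subseteq> X0" "infinite X" "\<forall>K\<in>X. \<not> F \<subseteq> K"
       "finite P" "P \<subseteq> X0" "X \<inter> P = {}" using \<open>Pr n st\<close> unfolding st Pr_def by auto
    have MX: "M \<notin> X" using h by blast
    have "\<exists>F' M' X'. finite F' \<and> M' \<in> X \<and> F' \<subseteq> M' \<and> X' \<subseteq> X \<and> infinite X' \<and> (\<forall>K\<in>X'. \<not> F' \<subseteq> K) \<and> (\<forall>K\<in>insert M P. \<not> F' \<subseteq> K)"
      by (rule tMax_separate) (use h X0(1) MX in auto)
    then obtain F' M' X' where h': "finite F'" "M' \<in> X" "F' \<subseteq> M'" "X' \<subseteq> X" "infinite X'" "\<forall>K\<in>X'. \<not> F' \<subseteq> K" "\<forall>K\<in>insert M P. \<not> F' \<subseteq> K"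
      by (elim exE conjE) (rule that; assumption)
    have "Pr (Suc n) (F', M', X', insert M P)" unfolding Pr_def prod.case using h h' MX by (intro conjI) auto
    moreover have "Q n st (F', M', X', insert M P)" unfolding Q_def st using h' by auto
    ultimately show "\<exists>y. Pr (Suc n) y \<and> Q n st y" by blast
  qed
  then obtain f where f: "\<And>n. Pr n (f n)" "\<And>n. Q n (f n) (f (Suc n))" by blast
  define F where "F n = fst (f n)" for n
  define M where "M n = fst (snd (f n))" for n
  define X where "X n = fst (snd (snd (f n)))" for n
  define P where "P n = snd (snd (snd (f n)))" for n
  have fn: "f n = (F n, M n, X n, P n)" for n unfolding F_def M_def X_def P_def by simp
  have pr: "finite (F n)" "F n \<subseteq> M n" "M n \<in> X0" "\<forall>K\<in>X n. \<not> F n \<subseteq> K" "\<forall>K\<in>P n. \<not> F n \<subseteq> K" for n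
    using f(1)[of n] unfolding fn Pr_def by auto
  have q: "M (Suc n) \<in> X n" "X (Suc n) \<subseteq> X n" "P (Suc n) = insert (M n) (P n)" for n
    using f(2)[of n] unfolding fn Q_def by auto
  have X: "X (i + k) \<subseteq> X i" for i k by (induction k) (use q(2) in fastforce)+
  have MX: "M j \<in> X i" if "i < j" for i j
    using q(1)[of "j - 1"] X[of i "j - 1 - i"] that by auto
  have "M i \<in> P (i + Suc k)" for i k by (induction k) (use q(3) in auto)
  then have MP: "M i \<in> P j" if "i < j" for i j using that by (metis less_iff_Suc_add add_Suc_right)
  show thesis
  proof (rule that[of F M])
    fix i j :: nat assume "i \<noteq> j"
    then consider "i < j" | "j < i" by linarith
    then show "\<not> F i \<subseteq> M j" using MX MP pr(4,5) by cases blast+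
  qed (use pr in auto)
qed

subsection \<open>Finite \<open>t\<close>-character\<close>

lemma common_denominator:
  assumes M: "M \<in> tMax R" and "finite Z" "Z \<subseteq> loc R M"
  shows "\<exists>s\<in>R. s \<notin> M \<and> (\<forall>z\<in>Z. s * z \<in> R)"
  using assms(2,3)
proof (induction rule: finite_induct)
  case empty
  show ?case using R_simps(2) tMaxD(5)[OF M] by blast
next
  case (insert z Z)
  then obtain s where s: "s \<in> R" "s \<notin> M" "\<forall>z\<in>Z. s * z \<in> R" by auto
  obtain a t where t: "a \<in> R" "t \<in> R" "t \<notin> M" "z = a / t" using insert.prems unfolding loc_def by blast
  have "t \<noteq> 0" using t zero_tMax[OF M] by auto
  then have "s * t * z = s * a" using t by simp
  then have 1: "s * t * z \<in> R" using R_simps(5)[OF s(1) t(1)] by metis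
  have "s * t * y \<in> R" if "y \<in> Z" for y
    using R_simps(5)[OF t(2), of "s * y"] s(3) that by (simp add: mult_ac)
  then show ?case using 1 tMax_mult[OF M s(1,2) t(2,3)] by blast
qed

lemma colon_chain_submodule:
  assumes d: "d \<in> R"
  shows "submodule R (colon_chain R d A n)" "colon_chain R d A n \<subseteq> R"
proof -
  have "submodule R (colon_chain R d A n) \<and> colon_chain R d A n \<subseteq> R"
  proof (induction n)
    case 0
    have "submodule R {d * d * r | r. r \<in> R}" unfolding submodule_def
    proof (intro conjI ballI)
      have "0 = d * d * 0" by simp
      then show "0 \<in> {d * d * r | r. r \<in> R}" using R_simps(1) by blast
    next
      fix x y assume "x \<in> {d * d * r | r. r \<in> R}" "y \<in> {d * d * r | r. r \<in> R}"
      then obtain r s where h: "r \<in> R" "s \<in> R" "x = d * d * r" "y = d * d * s" by blast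
      then have "x + y = d * d * (r + s)" by (simp add: distrib_left)
      then show "x + y \<in> {d * d * r | r. r \<in> R}" using R_simps(3) h by blast
    next
      fix c x assume c: "c \<in> R" and "x \<in> {d * d * r | r. r \<in> R}"
      then obtain r where h: "r \<in> R" "x = d * d * r" by blast
      then have "c * x = d * d * (c * r)" by (simp add: mult_ac)
      then show "c * x \<in> {d * d * r | r. r \<in> R}" using R_simps(5) h c by blast
    qed
    then show ?case using R_simps(5) d by auto
  next
    case (Suc n)
    then show ?case using R_simps
      unfolding submodule_def by (auto simp: distrib_right mult.assoc)
  qed
  then show "submodule R (colon_chain R d A n)" "colon_chain R d A n \<subseteq> R" by auto
qed

lemma colon_chain_mono:
  assumes d: "d \<in> R" and A: "\<And>i. A i \<subseteq> R" and nk: "n \<le> k"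
  shows "colon_chain R d A n \<subseteq> colon_chain R d A k"
proof -
  have step: "colon_chain R d A n \<subseteq> colon_chain R d A (Suc n)" for n
  proof
    fix y assume y: "y \<in> colon_chain R d A n"
    have "y * a * b \<in> colon_chain R d A n" if "a \<in> A n" "b \<in> A n" for a b
    proof -
      have "a * b \<in> R" using that A R_simps(5) by blast
      then have "(a * b) * y \<in> colon_chain R d A n"
        using y colon_chain_submodule(1)[OF d, of A n] unfolding submodule_def by blast
      then show ?thesis by (simp add: mult_ac)
    qed
    then show "y \<in> colon_chain R d A (Suc n)" using y colon_chain_submodule(2)[OF d, of A n] by auto
  qed
  show ?thesis using lift_Suc_mono_le[of "colon_chain R d A", OF step nk] .
qed

lemma colon_chain_w:
  assumes d: "d \<in> R" "d \<noteq> 0" and F: "dense F" and "\<And>f. f \<in> F \<Longrightarrow> f * x \<in> colon_chain R d A n"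
  shows "x \<in> colon_chain R d A n"
  using assms(4)
proof (induction n arbitrary: x)
  case 0
  have "f * (x * inverse (d * d)) \<in> R" if fF: "f \<in> F" for f
  proof -
    obtain r where "r \<in> R" "f * x = d * d * r" using 0[OF fF] by auto
    then have "f * (x * inverse (d * d)) = d * d * r * inverse (d * d)" by (metis mult.assoc)
    also have "\<dots> = r" using d by (simp add: field_simps)
    finally show ?thesis using \<open>r \<in> R\<close> by simp
  qed
  then have "x * inverse (d * d) \<in> R" using dense_colon[OF F] by blast
  moreover have "x = d * d * (x * inverse (d * d))" using d by (simp add: field_simps)
  ultimately show ?case unfolding colon_chain.simps by blast
next
  case (Suc n)
  have "x \<in> R" using dense_colon[OF F] Suc.prems colon_chain_submodule(2)[OF d(1), of A "Suc n"] by blast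
  moreover have "x * a * b \<in> colon_chain R d A n" if ab: "a \<in> A n" "b \<in> A n" for a b
  proof (rule Suc.IH)
    fix f assume "f \<in> F"
    then have "f * x * a * b \<in> colon_chain R d A n" using Suc.prems ab by auto
    then show "f * (x * a * b) \<in> colon_chain R d A n" by (simp add: mult_ac)
  qed
  ultimately show ?case by simp
qed

text \<open>Given maximal \<open>t\<close>-ideals \<open>M\<^sub>n \<ni> d\<close> separated by finitely generated \<open>A\<^sub>n \<ni> d\<close>, the ideal
  \<open>I = \<Union>(d\<^sup>2R : A\<^sub>0\<^sup>2 \<dots> A\<^sub>n\<^sub>-\<^sub>1\<^sup>2)\<close> is \<open>w\<close>-stable only if some \<open>C = (R\<^sub>M : A\<^sup>2)\<close>, with \<open>M = M\<^sub>N\<close> and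
  \<open>A = A\<^sub>N\<close>, is a ring. Then \<open>(A : A\<^sup>2) \<subseteq> C\<close> and \<open>1 = (\<Sum>a l)\<^sup>3 \<in> A R\<^sub>M\<close>, which is impossible.\<close>
lemma finite_character:
  assumes w: "w_stable R" and d: "d \<in> R" "d \<noteq> 0"
  shows "finite {M \<in> tMax R. d \<in> M}"
proof (rule ccontr)
  assume inf: "infinite {M \<in> tMax R. d \<in> M}"
  obtain F0 Ms :: "nat \<Rightarrow> 'a set" where F0: "\<And>i. finite (F0 i)" "\<And>i. F0 i \<subseteq> Ms i"
    "\<And>i. Ms i \<in> {M \<in> tMax R. d \<in> M}" "\<And>i j. i \<noteq> j \<Longrightarrow> \<not> F0 i \<subseteq> Ms j"
    using tMax_sequence[OF _ inf] by blast
  define A where "A i = insert d (F0 i)" for i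
  have tM: "Ms i \<in> tMax R" for i using F0(3) by blast
  have A: "finite (A i)" "A i \<subseteq> Ms i" "d \<in> A i" "A i \<subseteq> R" for i
    using F0(1-3)[of i] tMaxD(3)[OF tM] unfolding A_def by auto
  have A_sep: "\<exists>a\<in>A i. a \<notin> Ms j" if "i \<noteq> j" for i j using F0(4)[OF that] unfolding A_def by blast
  define K where "K = colon_chain R d A"
  define I where "I = (\<Union>n. K n)"
  note Ks = colon_chain_submodule[OF d(1), of A, folded K_def]
  have K_mono: "K n \<subseteq> K k" if "n \<le> k" for n k
    unfolding K_def by (rule colon_chain_mono[OF d(1) A(4) that])
  have KI: "K n \<subseteq> I" for n unfolding I_def by blast
  have dir: "\<exists>n. x \<in> K n \<and> y \<in> K n" if xy: "x \<in> I" "y \<in> I" for x y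
  proof -
    obtain n k where "x \<in> K n" "y \<in> K k" using xy unfolding I_def by blast
    then show ?thesis using K_mono[of n "max n k"] K_mono[of k "max n k"] by auto
  qed
  have Isub: "submodule R I" unfolding submodule_def
  proof (intro conjI ballI)
    show "0 \<in> I" using Ks(1)[of 0] KI unfolding submodule_def by blast
    show "x + y \<in> I" if "x \<in> I" "y \<in> I" for x y
      using dir[OF that] Ks(1) KI unfolding submodule_def by blast
    fix r x assume r: "r \<in> R" and "x \<in> I"
    then obtain n where n: "x \<in> K n" unfolding I_def by blast
    have "r * x \<in> K n" using Ks(1)[of n] r n unfolding submodule_def by blast
    then show "r * x \<in> I" using KI by blast
  qed
  have "d * d * 1 \<in> K 0" unfolding K_def colon_chain.simps using R_simps(2) by blast
  then have "d * d \<in> I" using KI by auto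
  then have In: "nonzero_ideal R I" using nonzero_idealI[OF Isub, of "d * d"] Ks(2) d unfolding I_def by auto
  have Iw: "w_ideal R I"
  proof (rule w_idealI[OF In])
    fix F x assume F: "dense F" and fx: "\<And>f. f \<in> F \<Longrightarrow> f * x \<in> I"
    have "\<forall>f\<in>F. \<exists>n. f * x \<in> K n" using fx unfolding I_def by blast
    then obtain n where n: "\<And>f. f \<in> F \<Longrightarrow> f * x \<in> K (n f)" by metis
    have "f * x \<in> K (Max (n ` F))" if "f \<in> F" for f
    proof -
      have "n f \<le> Max (n ` F)" using F that unfolding dense_def by simp
      then show ?thesis using n[OF that] K_mono by blast
    qed
    then have "x \<in> K (Max (n ` F))" unfolding K_def by (rule colon_chain_w[OF d F])
    then show "x \<in> I" using KI by blast
  qed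
  define L where "L = colon (Eend I) I"
  obtain F where F: "dense F" "F \<subseteq> setprod I L" unfolding L_def using w_stable_dense[OF w Iw] .
  have "\<exists>n. z \<in> setprod (K n) L" if "z \<in> setprod I L" for z
    using that
  proof (induction rule: setprod_induct)
    case zero
    show ?case by simp
  next
    case (add x y)
    then obtain n k where "x \<in> setprod (K n) L" "y \<in> setprod (K k) L" by blast
    then have "x \<in> setprod (K (max n k)) L" "y \<in> setprod (K (max n k)) L"
      using setprod_mono[OF K_mono subset_refl, of n "max n k" L] setprod_mono[OF K_mono subset_refl, of k "max n k" L] by auto
    then show ?case using setprod_add by blast
  next
    case (prod a b)
    then show ?case using setprod_prod unfolding I_def by blast
  qed
  then have "\<forall>f\<in>F. \<exists>n. f \<in> setprod (K n) L" using F(2) by blast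
  then obtain n where n: "\<And>f. f \<in> F \<Longrightarrow> f \<in> setprod (K (n f)) L" by metis
  \<comment> \<open>Stability is witnessed at a stage \<open>N\<close>, and \<open>M\<close> is the
    ideal with this very index. As \<open>A 0, ..., A (N - 1)\<close> escape it, \<open>K N\<close>
    lies locally in \<open>d^2 R_M\<close> (\<open>K1\<close>), while \<open>I\<close> is only known
    to lie in \<open>d^2 C\<close> (\<open>K2\<close>).\<close>
  define N where "N = Max (n ` F)"
  have FN: "f \<in> setprod (K N) L" if "f \<in> F" for f
  proof -
    have "n f \<le> N" using F(1) that unfolding dense_def N_def by simp
    then show ?thesis using n[OF that] setprod_mono[OF K_mono subset_refl] by blast
  qed
  define M where "M = Ms N"
  have M: "M \<in> tMax R" unfolding M_def by (rule tM)
  interpret ls: local_stable "loc R M" "setprod M (loc R M)" by (rule local_stable_loc[OF w M])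
  obtain f where f: "f \<in> F" "f \<notin> M" "f \<in> R" using dense_not_tMax[OF F(1) M] .
  define \<delta> where "\<delta> = inverse (d * d)"
  have \<delta>: "d * d * \<delta> = 1" unfolding \<delta>_def using d(2) by (simp add: field_simps)
  have M0: "s \<noteq> 0" if "s \<notin> M" for s using that zero_tMax[OF M] by auto
  have cancel: "y * \<delta> \<in> loc R M" if "y * a * a * \<delta> \<in> loc R M" "a \<in> R" "a \<notin> M" for y a
  proof -
    have "(inverse a * inverse a) * (y * a * a * \<delta>) \<in> loc R M"
      by (rule loc_mult[OF M loc_mult[OF M loc_inverse[OF that(2,3)] loc_inverse[OF that(2,3)]] that(1)])
    moreover have "(inverse a * inverse a) * (y * a * a * \<delta>) = y * \<delta>" using M0[OF that(3)] by (simp add: field_simps)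
    ultimately show ?thesis by metis
  qed
  have K1: "y * \<delta> \<in> loc R M" if "n \<le> N" "y \<in> K n" for n y
    using that
  proof (induction n arbitrary: y)
    case 0
    then obtain r where r: "r \<in> R" "y = d * d * r" unfolding K_def by auto
    have "y * \<delta> = (d * d * \<delta>) * r" unfolding r by (simp add: mult_ac)
    then have "y * \<delta> = r" unfolding \<delta> by simp
    then show ?case using r(1) R_loc[OF M] by metis
  next
    case (Suc n)
    obtain a where a: "a \<in> A n" "a \<notin> M" using A_sep[of n N] Suc.prems(1) unfolding M_def by auto
    have "y * a * a \<in> K n" using Suc.prems(2) a unfolding K_def by simp
    then have "y * a * a * \<delta> \<in> loc R M" using Suc by simp
    then show ?case using cancel a A(4)[of n] by blast
  qed
  have K2: "y * a * b * \<delta> \<in> loc R M" if "y \<in> K n" "a \<in> A N" "b \<in> A N" for n y a b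
    using that(1)
  proof (induction n arbitrary: y)
    case 0
    have "(a * b) * (y * \<delta>) \<in> loc R M"
      using loc_mult[OF M R_loc[OF M] K1[of 0 y]] 0 R_simps(5) that A(4)[of N] by blast
    then show ?case by (simp add: mult_ac)
  next
    case (Suc n)
    show ?case
    proof (cases "n = N")
      case True
      then have "y * a * b \<in> K N" using Suc.prems that unfolding K_def by simp
      then show ?thesis using K1 by blast
    next
      case False
      obtain c where c: "c \<in> A n" "c \<notin> M" using A_sep[of n N] False unfolding M_def by auto
      have "y * c * c \<in> K n" using Suc.prems c unfolding K_def by simp
      then have "(y * c * c) * a * b * \<delta> \<in> loc R M" by (rule Suc.IH)
      then have "(y * a * b) * c * c * \<delta> \<in> loc R M" by (simp add: mult_ac)
      then show ?thesis using cancel c A(4)[of n] by blast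
    qed
  qed
  define C where "C = {c. \<forall>a\<in>A N. \<forall>b\<in>A N. c * a * b \<in> loc R M}"
  have C_add: "c + c' \<in> C" if "c \<in> C" "c' \<in> C" for c c'
    using that loc_add[OF M] unfolding C_def by (auto simp: distrib_right)
  have C_scale: "r * c \<in> C" if "r \<in> loc R M" "c \<in> C" for r c
    using that loc_mult[OF M that(1)] unfolding C_def by (auto simp: mult.assoc)
  have I_C: "y * \<delta> \<in> C" if y: "y \<in> I" for y
    unfolding C_def
  proof (intro CollectI ballI)
    fix a b assume "a \<in> A N" "b \<in> A N"
    then have "y * a * b * \<delta> \<in> loc R M" using K2 y unfolding I_def by blast
    then show "y * \<delta> * a * b \<in> loc R M" by (simp add: mult_ac)
  qed
  have C_I: "\<exists>s\<in>R. s \<notin> M \<and> s * (c * d * d) \<in> I" if c: "c \<in> C" for c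
  proof -
    let ?Z = "(\<lambda>(a, b). c * a * b) ` (A N \<times> A N)"
    have "finite ?Z" "?Z \<subseteq> loc R M" using A(1) c unfolding C_def by auto
    then obtain s where s: "s \<in> R" "s \<notin> M" "\<forall>z\<in>?Z. s * z \<in> R" using common_denominator[OF M] by blast
    have sab: "s * (c * a * b) \<in> R" if "a \<in> A N" "b \<in> A N" for a b using s(3) that by auto
    have "s * (c * d * d) * a * b \<in> K N" if "a \<in> A N" "b \<in> A N" for a b
    proof -
      have "d * d * (s * (c * a * b)) \<in> K 0" unfolding K_def colon_chain.simps using sab[OF that] by blast
      then have "d * d * (s * (c * a * b)) \<in> K N" using K_mono[of 0 N] by auto
      then show ?thesis by (simp add: mult_ac)
    qed
    then have "s * (c * d * d) \<in> K (Suc N)" using sab[OF A(3) A(3)] unfolding K_def by simp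
    then show ?thesis using s KI by blast
  qed
  \<comment> \<open>The unit \<open>f\<close> lies in \<open>K N\<close> times \<open>L\<close>, and
    \<open>L I I \<subseteq> I\<close>, so \<open>f y z\<close> is in \<open>K N\<close> times
    \<open>I\<close>; \<open>K1\<close> and \<open>I_C\<close> absorb one \<delta> each.\<close>
  have II: "y * \<delta> * (z * \<delta>) \<in> C" if yz: "y \<in> I" "z \<in> I" for y z
  proof -
    have "g * y * z * \<delta> * \<delta> \<in> C" if "g \<in> setprod (K N) L" for g
      using that
    proof (induction rule: setprod_induct)
      case zero
      have "0 \<in> C" unfolding C_def using R_loc[OF M R_simps(1)] by simp
      then show ?case by simp
    next
      case (add g h)
      then show ?case using C_add by (simp add: distrib_right)
    next
      case (prod k l)
      have "l * y * z \<in> I" using prod(2) yz unfolding L_def mem_colon_Eend by blast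
      then have "(k * \<delta>) * ((l * y * z) * \<delta>) \<in> C" using C_scale[OF K1[OF _ prod(1)] I_C] by blast
      then show ?case by (simp add: mult_ac)
    qed
    then have "f * y * z * \<delta> * \<delta> \<in> C" using FN[OF f(1)] by blast
    then have "inverse f * (f * y * z * \<delta> * \<delta>) \<in> C" by (rule C_scale[OF loc_inverse[OF f(3,2)]])
    moreover have "inverse f * (f * y * z * \<delta> * \<delta>) = y * \<delta> * (z * \<delta>)" using M0[OF f(2)] by (simp add: field_simps)
    ultimately show ?thesis by metis
  qed
  have C_mult: "c * c' \<in> C" if cc: "c \<in> C" "c' \<in> C" for c c'
  proof -
    obtain s where s: "s \<in> R" "s \<notin> M" "s * (c * d * d) \<in> I" using C_I[OF cc(1)] by blast
    obtain t where t: "t \<in> R" "t \<notin> M" "t * (c' * d * d) \<in> I" using C_I[OF cc(2)] by blast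
    have "(inverse s * inverse t) * (s * (c * d * d) * \<delta> * (t * (c' * d * d) * \<delta>)) \<in> C"
      by (rule C_scale[OF loc_mult[OF M loc_inverse[OF s(1,2)] loc_inverse[OF t(1,2)]] II[OF s(3) t(3)]])
    moreover have "(inverse s * inverse t) * (s * (c * d * d) * \<delta> * (t * (c' * d * d) * \<delta>)) = c * c' * (d * d * \<delta>) * (d * d * \<delta>)"
      using M0[OF s(2)] M0[OF t(2)] by (simp add: field_simps)
    ultimately show ?thesis unfolding \<delta> by simp
  qed
  define \<aa> where "\<aa> = setprod (loc R M) (A N)"
  have asub: "submodule (loc R M) \<aa>" unfolding \<aa>_def by (rule setprod_submodule[OF subring_loc[OF M]])
  have da: "d \<in> \<aa>" using setprod_superset[OF subring_loc[OF M], of "A N"] A(3) unfolding \<aa>_def by blast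
  have am: "a \<in> setprod M (loc R M)" if "a \<in> \<aa>" for a
    using that unfolding \<aa>_def
  proof (induction rule: setprod_induct)
    case (prod r a)
    then have "a * r \<in> setprod M (loc R M)" using A(2)[of N] setprod_prod unfolding M_def by blast
    then show ?case by (simp add: mult.commute)
  qed (auto intro: setprod_add)
  have aloc: "a \<in> loc R M" if "a \<in> \<aa>" for a using am[OF that] ls.m_R by blast
  have C1: "c * a * b \<in> loc R M" if c: "c \<in> C" and a: "a \<in> \<aa>" and b: "b \<in> A N" for a b c
    using a unfolding \<aa>_def
  proof (induction rule: setprod_induct)
    case zero
    show ?case using ls.R_simps(1) by simp
  next
    case (add x y)
    then show ?case using loc_add[OF M] by (simp add: distrib_left distrib_right)
  next
    case (prod r a)
    then have "r * (c * a * b) \<in> loc R M" using c b loc_mult[OF M] unfolding C_def by blast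
    then show ?case by (simp add: mult_ac)
  qed
  have C2: "c * a * b \<in> loc R M" if c: "c \<in> C" and a: "a \<in> \<aa>" and b: "b \<in> \<aa>" for a b c
    using b unfolding \<aa>_def
  proof (induction rule: setprod_induct)
    case zero
    show ?case using ls.R_simps(1) by simp
  next
    case (add x y)
    then show ?case using loc_add[OF M] by (simp add: distrib_left)
  next
    case (prod r b)
    then have "r * (c * a * b) \<in> loc R M" using C1[OF c a] loc_mult[OF M] by blast
    then show ?case by (simp add: mult_ac)
  qed
  define La where "La = colon (Eend \<aa>) \<aa>"
  have LC: "l \<in> C" if "l \<in> La" for l
  proof -
    have "A N \<subseteq> \<aa>" unfolding \<aa>_def by (rule setprod_superset[OF subring_loc[OF M]])
    then show ?thesis using that aloc unfolding La_def mem_colon_Eend C_def by blast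
  qed
  have one: "1 \<in> setprod \<aa> La" unfolding La_def
    by (rule ls.stableD[OF asub da d(2), of 1]) (auto intro: aloc)
  \<comment> \<open>The ring \<open>C\<close> absorbs two of the three factors from \<aa>; the third
    keeps the product in the maximal ideal. Hence the cube.\<close>
  have t1: "a * l * (a' * l') * (a'' * l'') \<in> setprod M (loc R M)"
    if "a \<in> \<aa>" "a' \<in> \<aa>" "a'' \<in> \<aa>" "l \<in> La" "l' \<in> La" "l'' \<in> La" for a a' a'' l l' l''
  proof -
    have "l * l' * l'' * a' * a'' \<in> loc R M"
      by (rule C2[OF C_mult[OF C_mult[OF LC[OF that(4)] LC[OF that(5)]] LC[OF that(6)]] that(2,3)])
    then have "(l * l' * l'' * a' * a'') * a \<in> setprod M (loc R M)" using am[OF that(1)] ls.m_mult by blast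
    then show ?thesis by (simp add: mult_ac)
  qed
  have t2: "a * l * (a' * l') * z \<in> setprod M (loc R M)"
    if h: "a \<in> \<aa>" "a' \<in> \<aa>" "l \<in> La" "l' \<in> La" and z: "z \<in> setprod \<aa> La" for a a' l l' z
    using z by (induction rule: setprod_induct) (use t1 h in \<open>auto simp: distrib_left intro: setprod_add\<close>)
  have t3: "a * l * y * z \<in> setprod M (loc R M)"
    if h: "a \<in> \<aa>" "l \<in> La" "z \<in> setprod \<aa> La" and y: "y \<in> setprod \<aa> La" for a l y z
    using y by (induction rule: setprod_induct) (use t2 h in \<open>auto simp: distrib_left distrib_right intro: setprod_add\<close>)
  have t4: "x * y * z \<in> setprod M (loc R M)"
    if h: "z \<in> setprod \<aa> La" "y \<in> setprod \<aa> La" and x: "x \<in> setprod \<aa> La" for x y z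
    using x by (induction rule: setprod_induct) (use t3 h in \<open>auto simp: distrib_right intro: setprod_add\<close>)
  show False using t4[OF one one one] ls.one_m by simp
qed

end

subsection \<open>Stability of \<open>t\<close>-linked overrings\<close>

theorem theorem2p10:
  fixes R T :: "'a::field set"
  assumes "subring R" and "has_quotient_field_UNIV R" and "R \<noteq> UNIV"
    and "subring T" and "R \<subseteq> T"
    and "t_linked R T"
    and "w_stable R"
  shows "w_stable T"
proof -
  interpret R: quotient_domain R by unfold_locales (fact assms)+
  interpret T: quotient_domain T
  proof
    show "subring T" by fact
    show "has_quotient_field_UNIV T"
      using assms(2,5) unfolding has_quotient_field_UNIV_def by blast
  qed
  have TR: "submodule R E" if "submodule T E" for E
    using that assms(5) unfolding submodule_def by blast
  have T_nz: "T \<noteq> {0}" using T.R_simps(2) by auto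
  \<comment> \<open>Exactly the content of \<open>t\<close>-linkedness; it makes every
    \<open>w\<close>-closure over \<open>R\<close> part of the \<open>w\<close>-closure over
    \<open>T\<close>.\<close>
  have dense_T: "T.dense F" if F: "R.dense F" for F
    unfolding T.dense_def
  proof (intro conjI)
    show "finite F" "F \<subseteq> T" using F assms(5) unfolding R.dense_def by auto
    show "colon T F \<subseteq> T"
    proof
      fix x assume "x \<in> colon T F"
      then have "\<forall>f\<in>F. f * x \<in> T" unfolding colon_def by (simp add: mult.commute)
      then have "x \<in> w_op R T" unfolding R.w_op_iff[OF TR[OF T.submodule_R] T_nz] using F by blast
      then show "x \<in> T" using assms(6) unfolding t_linked_def by simp
    qed
  qed
  show ?thesis unfolding w_stable_def
  proof (intro allI impI)
    fix I assume wI: "w_ideal T I"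
    then have In: "nonzero_ideal T I" and Iw: "w_op T I = I" unfolding w_ideal_def by auto
    note Id = T.nonzero_idealD[OF In]
    have I_nz: "I \<noteq> {0}" using Id(3) by auto
    have TI: "t * i \<in> I" if "t \<in> T" "i \<in> I" for t i using Id(1) that unfolding submodule_def by blast
    have IRsub: "submodule R I" using TR[OF Id(1)] .
    have I_dense: "x \<in> I" if "T.dense F" "\<And>f. f \<in> F \<Longrightarrow> f * x \<in> I" for F x
    proof -
      have "x \<in> w_op T I" unfolding T.w_op_iff[OF Id(1) I_nz] using that by blast
      then show ?thesis using Iw by simp
    qed
    have wRI: "x \<in> I" if x: "x \<in> w_op R I" for x
    proof -
      obtain F where "R.dense F" "\<forall>f\<in>F. f * x \<in> I" using x unfolding R.w_op_iff[OF IRsub I_nz] by blast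
      then show ?thesis using I_dense[OF dense_T] by blast
    qed
    define L where "L = colon (Eend I) I"
    define X where "X = setprod I L"
    have Xsub: "submodule T X"
      unfolding submodule_def X_def
      using Id(1) by (auto intro!: setprod_add setprod_scale simp: submodule_def)
    obtain i where i: "i \<in> I" "i \<noteq> 0" using Id(3) by blast
    have "i \<in> L" unfolding L_def mem_colon_Eend
    proof (intro ballI)
      fix x y assume "x \<in> I" "y \<in> I"
      then show "i * x * y \<in> I" using TI[of "i * x" y] T.R_simps(5)[of i x] i(1) Id(2) by blast
    qed
    then have "i * i \<in> X" unfolding X_def using i setprod_prod by blast
    moreover have "i * i \<noteq> 0" using i by simp
    ultimately have X_nz: "X \<noteq> {0}" by blast
    have X_E: "x * j \<in> I" if x: "x \<in> X" and j: "j \<in> I" for x j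
      using x unfolding X_def
    proof (induction rule: setprod_induct)
      case zero
      show ?case using Id(1) unfolding submodule_def by simp
    next
      case (add a b)
      then show ?case using Id(1) unfolding submodule_def by (simp add: distrib_right)
    next
      case (prod a l)
      then have "l * a * j \<in> I" using j unfolding L_def mem_colon_Eend by blast
      then show ?case by (simp add: mult_ac)
    qed
    obtain d where d: "d \<in> I" "d \<in> R" "d \<noteq> 0"
    proof -
      obtain a b where ab: "a \<in> R" "b \<in> R" "b \<noteq> 0" "i = a / b"
        using assms(2) unfolding has_quotient_field_UNIV_def by blast
      then have "a = b * i" by simp
      then have "a \<in> I" using TI ab(2) assms(5) i(1) by blast
      moreover have "a \<noteq> 0" using ab i by auto
      ultimately show thesis using that ab by blast
    qed
    define \<M> where "\<M> = {M \<in> tMax R. d \<in> M}"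
    have fin: "finite \<M>" unfolding \<M>_def by (rule R.finite_character[OF assms(7) d(2,3)])
    have "\<forall>M\<in>\<M>. \<exists>J e. e \<in> R \<and> e \<noteq> 0 \<and> J \<subseteq> setprod I (loc R M) \<and> (\<forall>x\<in>J. e * x \<in> loc R M) \<and>
        setprod I (loc R M) \<subseteq> setprod J (Eend (setprod I (loc R M)))"
    proof
      fix M assume "M \<in> \<M>"
      then have M: "M \<in> tMax R" unfolding \<M>_def by blast
      interpret ls: local_stable "loc R M" "setprod M (loc R M)" by (rule R.local_stable_loc[OF assms(7) M])
      let ?T = "setprod T (loc R M)" and ?I = "setprod I (loc R M)"
      have scale: "z * w \<in> setprod E (loc R M)" if zw: "z \<in> ?T" "w \<in> setprod E (loc R M)"
        and E: "\<And>t e. t \<in> T \<Longrightarrow> e \<in> E \<Longrightarrow> t * e \<in> E" for z w E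
        using zw(1)
      proof (induction rule: setprod_induct)
        case (prod t r)
        have "r * (t * w) \<in> setprod E (loc R M)"
          using R.setprod_loc_scale[OF M setprod_scale[OF zw(2)] prod(2)] E prod(1) by blast
        then show ?case by (simp add: mult_ac)
      qed (auto simp: distrib_right intro: setprod_add)
      have "subring ?T" unfolding subring_def
      proof (intro conjI ballI)
        show "0 \<in> ?T" by simp
        show "1 \<in> ?T" using R.setprod_loc_superset[OF M] T.R_simps(2) by blast
        fix x y assume xy: "x \<in> ?T" "y \<in> ?T"
        show "x + y \<in> ?T" using xy setprod_add by blast
        show "x * y \<in> ?T" using scale[OF xy] T.R_simps(5) by blast
        have "- 1 * y \<in> ?T" using R.setprod_loc_scale[OF M xy(2)] ls.R_simps(6)[OF ls.R_simps(2)] by blast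
        then have "x + - 1 * y \<in> ?T" using xy setprod_add by blast
        then show "x - y \<in> ?T" by simp
      qed
      moreover have "loc R M \<subseteq> ?T"
      proof
        fix z assume "z \<in> loc R M"
        then have "1 * z \<in> ?T" using T.R_simps(2) setprod_prod by blast
        then show "z \<in> ?T" by simp
      qed
      moreover have "submodule ?T ?I" unfolding submodule_def
        using scale[of _ _ I] TI setprod_add by auto
      moreover have "?I \<subseteq> ?T" using setprod_mono[OF Id(2) subset_refl] .
      moreover have "?I \<noteq> {0}" using R.setprod_loc_superset[OF M, of I] i by blast
      ultimately obtain J e where Je: "J \<subseteq> ?I" "e \<noteq> 0" "\<forall>x\<in>J. e * x \<in> loc R M" "?I \<subseteq> setprod J (Eend ?I)"
        using ls.fractional_generation[of ?T ?I] by blast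
      \<comment> \<open>The numerator of \<open>e\<close> is a denominator inside \<open>R\<close>,
        hence usable in the other localizations as well.\<close>
      obtain a b where ab: "a \<in> R" "b \<in> R" "b \<noteq> 0" "e = a / b"
        using assms(2) unfolding has_quotient_field_UNIV_def by blast
      have "a * x \<in> loc R M" if "x \<in> J" for x
      proof -
        have "b * (e * x) \<in> loc R M" using R.loc_mult[OF M R.R_loc[OF M ab(2)]] Je(3) that by blast
        then show ?thesis using ab by simp
      qed
      moreover have "a \<noteq> 0" using Je(2) ab by auto
      ultimately show "\<exists>J e. e \<in> R \<and> e \<noteq> 0 \<and> J \<subseteq> ?I \<and> (\<forall>x\<in>J. e * x \<in> loc R M) \<and> ?I \<subseteq> setprod J (Eend ?I)"
        using Je ab(1) by blast
    qed
    then obtain J e where Je: "\<And>M. M \<in> \<M> \<Longrightarrow> e M \<in> R \<and> e M \<noteq> 0 \<and> J M \<subseteq> setprod I (loc R M) \<and>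
        (\<forall>x\<in>J M. e M * x \<in> loc R M) \<and> setprod I (loc R M) \<subseteq> setprod (J M) (Eend (setprod I (loc R M)))"
      by metis
    define c where "c = prod e \<M>"
    have prod_R: "prod e B \<in> R" if "B \<subseteq> \<M>" for B
    proof -
      have "finite B" using that fin finite_subset by blast
      then show ?thesis using that
        by (induction rule: finite_induct) (auto simp: R.R_simps(2) Je intro: R.R_simps(5))
    qed
    have c: "c \<in> R" "c \<noteq> 0" unfolding c_def using prod_R[of \<M>] fin Je by auto
    have cJ: "c * x \<in> loc R M" if M: "M \<in> \<M>" and x: "x \<in> J M" for M x
    proof -
      have "c = e M * prod e (\<M> - {M})" unfolding c_def using fin M by (simp add: prod.remove)
      then have cx: "c * x = prod e (\<M> - {M}) * (e M * x)" by (simp add: mult_ac)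
      have tM: "M \<in> tMax R" using M unfolding \<M>_def by blast
      have "prod e (\<M> - {M}) \<in> R" by (rule prod_R) blast
      moreover have "e M * x \<in> loc R M" using Je[OF M] x by blast
      ultimately show ?thesis unfolding cx by (rule R.loc_mult[OF tM R.R_loc[OF tM]])
    qed
    \<comment> \<open>The ideal \<open>c J\<close> for the \<open>J\<close> of the overview:
      stability is available for ideals inside \<open>R\<close>.\<close>
    define J' where "J' = {r \<in> R. r * inverse c \<in> I}"
    have J'sub: "submodule R J'" unfolding J'_def submodule_def
      using IRsub R.R_simps by (auto simp: submodule_def distrib_right mult.assoc)
    have mem_J': "c * y \<in> J'" if "y \<in> I" "c * y \<in> R" for y
    proof -
      have "c * y * inverse c = y" using c(2) by simp
      then have "c * y * inverse c \<in> I" using that(1) by metis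
      then show ?thesis unfolding J'_def using that(2) by blast
    qed
    have cd: "c * d \<in> J'" using mem_J'[OF d(1)] R.R_simps(5) c d by blast
    have J'n: "nonzero_ideal R J'"
      by (rule R.nonzero_idealI[OF J'sub _ cd]) (use c d in \<open>auto simp: J'_def\<close>)
    have J'w: "w_ideal R J'"
    proof (rule R.w_idealI[OF J'n])
      fix F x assume F: "R.dense F" and x: "x \<in> R" and fx: "\<And>f. f \<in> F \<Longrightarrow> f * x \<in> J'"
      have "f * (x * inverse c) \<in> I" if "f \<in> F" for f
        using fx[OF that] unfolding J'_def by (simp add: mult.assoc)
      then have "x * inverse c \<in> I" using I_dense[OF dense_T[OF F]] by blast
      then show "x \<in> J'" unfolding J'_def using x by simp
    qed
    obtain F where F: "R.dense F" "F \<subseteq> setprod J' (colon (Eend J') J')"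
      using R.w_stable_dense[OF assms(7) J'w] .
    \<comment> \<open>As \<open>J' = c J\<close>, the elements \<open>c l\<close> make up
      \<open>(J : J^2)\<close>.\<close>
    have LL: "c * l \<in> L" if l: "l \<in> colon (Eend J') J'" for l
      unfolding L_def mem_colon_Eend
    proof (intro ballI)
      fix x y assume xy: "x \<in> I" "y \<in> I"
      have lJ: "l * c * p * q \<in> I" if "p \<in> I" "c * p \<in> R" "q \<in> I" "c * q \<in> R" for p q
      proof -
        have "l * (c * p) * (c * q) \<in> J'" using l mem_J' that unfolding mem_colon_Eend by blast
        then have "l * (c * p) * (c * q) * inverse c \<in> I" unfolding J'_def by simp
        moreover have "l * (c * p) * (c * q) * inverse c = l * c * p * q" using c(2) by (simp add: field_simps)
        ultimately show ?thesis by metis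
      qed
      have "c * l * x * y \<in> setprod I (loc R M)" if M: "M \<in> tMax R" for M
      proof (cases "d \<in> M")
        case False
        \<comment> \<open>Here \<open>d \<in> J\<close> is a unit at \<open>M\<close>:
          \<open>l c d d \<in> I\<close> bounds \<open>l c\<close>, and \<open>x y \<in> T\<close>
          costs nothing.\<close>
        have cdR: "c * d \<in> R" using R.R_simps(5) c d by blast
        have "l * c * d * d \<in> I" using lJ[OF d(1) cdR d(1) cdR] .
        moreover have "x * y \<in> T" using xy Id(2) T.R_simps(5) by blast
        ultimately have "(x * y) * (l * c * d * d) \<in> I" using TI by blast
        moreover have "inverse d * inverse d \<in> loc R M" using R.loc_mult[OF M] R.loc_inverse[OF d(2) False] by blast
        ultimately have "(x * y) * (l * c * d * d) * (inverse d * inverse d) \<in> setprod I (loc R M)"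
          by (rule setprod_prod)
        moreover have "(x * y) * (l * c * d * d) * (inverse d * inverse d) = c * l * x * y"
          using d(3) by (simp add: field_simps)
        ultimately show ?thesis by metis
      next
        case True
        then have MM: "M \<in> \<M>" unfolding \<M>_def using M by blast
        let ?I = "setprod I (loc R M)"
        \<comment> \<open>A unit of the localization moves \<open>j\<close> into \<open>I\<close>
          and \<open>c j\<close> into \<open>R\<close> at once, so that \<open>lJ\<close>
          applies.\<close>
        have clear: "\<exists>u\<in>R. u \<notin> M \<and> u * j \<in> I \<and> c * (u * j) \<in> R" if j: "j \<in> J M" for j
        proof -
          have "j \<in> ?I" using Je[OF MM] j by blast
          then obtain p s where s: "p \<in> I" "s \<in> R" "s \<notin> M" "j = p / s"
            unfolding R.setprod_loc[OF M IRsub] by blast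
          obtain q t where t: "q \<in> R" "t \<in> R" "t \<notin> M" "c * j = q / t"
            using cJ[OF MM j] unfolding loc_def by blast
          have nz: "s \<noteq> 0" "t \<noteq> 0" using s t R.zero_tMax[OF M] by auto
          have "t * p \<in> I" using TI s(1) t(2) assms(5) by blast
          moreover have "(s * t) * j = t * p" using s(4) nz by simp
          moreover have "c * ((s * t) * j) = s * q"
          proof -
            have "c * ((s * t) * j) = s * (t * (c * j))" by (simp add: mult_ac)
            also have "t * (c * j) = q" using t(4) nz by simp
            finally show ?thesis .
          qed
          moreover have "s * q \<in> R" using R.R_simps(5) s t by blast
          ultimately show ?thesis using R.tMax_mult[OF M s(2,3) t(2,3)] by metis
        qed
        have jj: "c * l * j * j' \<in> ?I" if jm: "j \<in> J M" "j' \<in> J M" for j j'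
        proof -
          obtain u where u: "u \<in> R" "u \<notin> M" "u * j \<in> I" "c * (u * j) \<in> R" using clear[OF jm(1)] by blast
          obtain v where v: "v \<in> R" "v \<notin> M" "v * j' \<in> I" "c * (v * j') \<in> R" using clear[OF jm(2)] by blast
          have nz: "u \<noteq> 0" "v \<noteq> 0" using u v R.zero_tMax[OF M] by auto
          have "l * c * (u * j) * (v * j') * (inverse u * inverse v) \<in> ?I"
            by (rule setprod_prod[OF lJ[OF u(3,4) v(3,4)] R.loc_mult[OF M R.loc_inverse[OF u(1,2)] R.loc_inverse[OF v(1,2)]]])
          moreover have "l * c * (u * j) * (v * j') * (inverse u * inverse v) = c * l * j * j'"
            using nz by (simp add: field_simps)
          ultimately show ?thesis by metis
        qed
        let ?S = "setprod (J M) (Eend ?I)"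
        \<comment> \<open>The inclusion known on \<open>J M\<close> extends to all of the localized
          ideal, because its endomorphisms can be pulled out of both arguments.\<close>
        have b1: "c * l * (j * h) * q \<in> ?I" if jh: "j \<in> J M" "h \<in> Eend ?I" and q: "q \<in> ?S" for j h q
          using q
        proof (induction rule: setprod_induct)
          case zero
          show ?case by simp
        next
          case (add a b)
          then show ?case using setprod_add by (simp add: distrib_left)
        next
          case (prod j' h')
          have "h * (h' * (c * l * j * j')) \<in> ?I"
            using jj[OF jh(1) prod(1)] jh(2) prod(2) unfolding Eend_def colon_def by blast
          then show ?case by (simp add: mult_ac)
        qed
        have b2: "c * l * p * q \<in> ?I" if p: "p \<in> ?S" and q: "q \<in> ?S" for p q
          using p
        proof (induction rule: setprod_induct)
          case zero
          show ?case by simp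
        next
          case (add a b)
          then show ?case using setprod_add by (simp add: distrib_left distrib_right)
        next
          case (prod j h)
          then show ?case using b1 q by blast
        qed
        have "x \<in> ?S" "y \<in> ?S" using xy R.setprod_loc_superset[OF M, of I] Je[OF MM] by blast+
        then show ?thesis by (rule b2)
      qed
      then have "c * l * x * y \<in> w_op R I" unfolding w_op_def by blast
      then show "c * l * x * y \<in> I" by (rule wRI)
    qed
    have FX: "f \<in> X" if "f \<in> F" for f
    proof -
      have "f \<in> setprod J' (colon (Eend J') J')" using F that by blast
      then show ?thesis
      proof (induction rule: setprod_induct)
        case (prod j l)
        have "(j * inverse c) * (c * l) \<in> X"
          unfolding X_def using prod LL setprod_prod unfolding J'_def by blast
        moreover have "(j * inverse c) * (c * l) = j * l" using c(2) by (simp add: field_simps)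
        ultimately show ?case by metis
      qed (auto simp: X_def intro: setprod_add)
    qed
    have "w_op T X = Eend I"
    proof (intro equalityI subsetI)
      fix x assume "x \<in> w_op T X"
      then obtain G where G: "T.dense G" "\<forall>g\<in>G. g * x \<in> X" unfolding T.w_op_iff[OF Xsub X_nz] by blast
      have "x * j \<in> I" if j: "j \<in> I" for j
      proof (rule I_dense[OF G(1)])
        fix g assume "g \<in> G"
        then have "g * x * j \<in> I" using X_E[OF _ j] G(2) by blast
        then show "g * (x * j) \<in> I" by (simp add: mult.assoc)
      qed
      then show "x \<in> Eend I" unfolding Eend_def colon_def by blast
    next
      fix x assume x: "x \<in> Eend I"
      \<comment> \<open>\<open>X\<close> is an \<open>E(I)\<close>-module, so multiplying
        \<open>F \<subseteq> X\<close> by \<open>x\<close> stays in \<open>X\<close>, and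
        \<open>F\<close> is still dense over \<open>T\<close>.\<close>
      have "f * x \<in> X" if "f \<in> F" for f
      proof -
        have "x * f \<in> X" using setprod_scale[of f I L x I] FX[OF that] x
          unfolding X_def Eend_def colon_def by blast
        then show ?thesis by (simp add: mult.commute)
      qed
      then show "x \<in> w_op T X" unfolding T.w_op_iff[OF Xsub X_nz] using dense_T[OF F(1)] by blast
    qed
    then show "w_op T (setprod I (colon (Eend I) I)) = Eend I" unfolding X_def L_def .
  qed
qed

end
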